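(* Let $\Phi$ be a state on $\mathcal{A}^{\mathbb{Z}}$ and $\Theta\subseteq\mathcal{S}_{\mathrm{erg}}(\mathcal{A}^{\mathbb{Z}})$. The following are equivalent: 1. For each $\Psi\in\Theta$ the pair $(\Psi,\Phi)$ satisfies the HP-condition. 2. The relative entropy rate $s(\Psi,\Phi)\in[0,+\infty]$ exists for each $\Psi\in\Theta$, and for every subset $\Omega\subseteq\Theta$ and every $\eta>0$ there is a sequence of projections $p_n\in\mathcal{A}^{(n)}$ such that $\lim_{n\to\infty}\Psi^{(n)}(p_n)=1$ for all $\Psi\in\Omega$, and - if $s(\Omega,\Phi)<\infty$: $\limsup_{n\to\infty}\frac1n\log\Phi^{(n)}(p_n)\le -s(\Omega,\Phi)+\eta$; - if $s(\Omega,\Phi)=\infty$: $\limsup_{n\to\infty}\frac1n\log\Phi^{(n)}(p_n)\le -1/\eta$; and moreover every sequence of projections $\tilde p_n\in\mathcal{A}^{(n)}$ with $\lim_{n}\Psi^{(n)}(\tilde p_n)=1$ for all $\Psi\in\Omega$ satisfies $\liminf_{n\to\infty}\frac1n\log\Phi^{(n)}(\tilde p_n)\ge -s(\Omega,\Phi)$.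
   Context: $\mathcal{A}$ is a finite-dimensional $C^*$-algebra, $\mathcal{A}\cong\bigoplus_{i=1}^m M_{k_i}(\mathbb{C})$, with canonical trace $\mathrm{Tr}$ (sum of the matrix traces). For finite $T\subset\mathbb{Z}$ let $\mathcal{A}^T=\bigotimes_{t\in T}\mathcal{A}$, with the canonical embeddings $\mathcal{A}^T\subset\mathcal{A}^{T'}$ for $T\subset T'$; $\mathcal{A}^{\mathbb{Z}}$ is the norm completion of $\bigcup_T\mathcal{A}^T$ (quasilocal algebra). A state is a positive linear functional with value $1$ at the unit. For a state $\Psi$ on $\mathcal{A}^{\mathbb{Z}}$, $\Psi^{(T)}$ is its restriction to $\mathcal{A}^T$; $\mathcal{A}^{(n)}:=\mathcal{A}^{\{0,\dots,n-1\}}$, $\Psi^{(n)}:=\Psi^{(\{0,\dots,n-1\})}$, and $D_{\Psi^{(n)}}$ is its density operator ($\Psi^{(n)}(X)=\mathrm{Tr}(D_{\Psi^{(n)}}X)$). $\tau$ is the canonical shift on $\mathcal{A}^{\mathbb{Z}}$; $\mathcal{S}_{\mathrm{stat}}(\mathcal{A}^{\mathbb{Z}})$ is the set of $\tau$-invariant states and $\mathcal{S}_{\mathrm{erg}}(\mathcal{A}^{\mathbb{Z}})$ its extreme points (ergodic states). For states $\psi,\varphi$ on a finite-dimensional $C^*$-algebra, $S(\psi,\varphi)=\mathrm{Tr}\,D_\psi(\log D_\psi-\log D_\varphi)$ if $\mathrm{supp}(\psi)\le\mathrm{supp}(\varphi)$ and $+\infty$ otherwise. The relative entropy rate is $s(\Psi,\Phi):=\lim_{n}\frac1nS(\Psi^{(n)},\Phi^{(n)})$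 when this limit exists in $[0,+\infty]$; for a set $\Omega$ of states for which all these rates exist, $s(\Omega,\Phi):=\inf_{\Psi\in\Omega}s(\Psi,\Phi)$. For $\varepsilon\in(0,1)$, $\beta_{\varepsilon,n}(\Psi,\Phi):=\min\{\log\Phi(q): q\in\mathcal{A}^{(n)}\text{ projection},\ \Psi(q)\ge1-\varepsilon\}$ and $\bar\beta_\varepsilon(\Psi,\Phi):=\limsup_n\frac1n\beta_{\varepsilon,n}(\Psi,\Phi)$. The pair $(\Psi,\Phi)$ satisfies the HP-condition if $s(\Psi,\Phi)$ exists (in $[0,\infty]$) and $\bar\beta_\varepsilon(\Psi,\Phi)\le -s(\Psi,\Phi)$ for all $\varepsilon\in(0,1)$. *)

theory Defs
  imports Complex_Main "HOL-Library.FuncSet" "HOL-Library.Extended_Real"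
begin

text \<open>Concrete model of the finite-dimensional C*-algebra
  A = M_{k_0} (+) ... (+) M_{k_{m-1}} given by the list of block sizes ks.
  Basis indices of A are pairs (i,a) with i < m, a < k_i; A is the algebra of
  block-diagonal matrices.  A^T (T finite subset of Z) acts on functions of
  configurations sigma : T -> basis indices; it consists of the matrices
  X(sigma,tau) that vanish unless sigma t and tau t lie in the same block for
  every t in T (this is exactly the tensor product of the block algebras).\<close>

type_synonym cfg = "int \<Rightarrow> nat \<times> nat"
type_synonym lmat = "cfg \<Rightarrow> cfg \<Rightarrow> complex"
type_synonym lvec = "cfg \<Rightarrow> complex"
type_synonym qstate = "int set \<Rightarrow> lmat \<Rightarrow> complex"

definition blocks :: "nat list \<Rightarrow> (nat \<times> nat) set" where
  "blocks ks = {(i, a). i < length ks \<and> a < ks ! i}"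

definition Conf :: "nat list \<Rightarrow> int set \<Rightarrow> cfg set" where
  "Conf ks T = PiE T (\<lambda>_. blocks ks)"

definition mats :: "nat list \<Rightarrow> int set \<Rightarrow> lmat set" where
  "mats ks T = {X. \<forall>\<sigma> \<tau>. X \<sigma> \<tau> \<noteq> 0 \<longrightarrow> \<sigma> \<in> Conf ks T \<and> \<tau> \<in> Conf ks T}"

definition loc_alg :: "nat list \<Rightarrow> int set \<Rightarrow> lmat set" where
  "loc_alg ks T = {X. \<forall>\<sigma> \<tau>. X \<sigma> \<tau> \<noteq> 0 \<longrightarrow>
      \<sigma> \<in> Conf ks T \<and> \<tau> \<in> Conf ks T \<and> (\<forall>t\<in>T. fst (\<sigma> t) = fst (\<tau> t))}"

definition mmul :: "nat list \<Rightarrow> int set \<Rightarrow> lmat \<Rightarrow> lmat \<Rightarrow> lmat" where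
  "mmul ks T X Y = (\<lambda>\<sigma> \<tau>. \<Sum>\<rho>\<in>Conf ks T. X \<sigma> \<rho> * Y \<rho> \<tau>)"

definition madj :: "lmat \<Rightarrow> lmat" where
  "madj X = (\<lambda>\<sigma> \<tau>. cnj (X \<tau> \<sigma>))"

definition madd :: "lmat \<Rightarrow> lmat \<Rightarrow> lmat" where
  "madd X Y = (\<lambda>\<sigma> \<tau>. X \<sigma> \<tau> + Y \<sigma> \<tau>)"

definition msmul :: "complex \<Rightarrow> lmat \<Rightarrow> lmat" where
  "msmul c X = (\<lambda>\<sigma> \<tau>. c * X \<sigma> \<tau>)"

definition mone :: "nat list \<Rightarrow> int set \<Rightarrow> lmat" where
  "mone ks T = (\<lambda>\<sigma> \<tau>. if \<sigma> \<in> Conf ks T \<and> \<sigma> = \<tau> then 1 else 0)"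

definition mtr :: "nat list \<Rightarrow> int set \<Rightarrow> lmat \<Rightarrow> complex" where
  "mtr ks T X = (\<Sum>\<sigma>\<in>Conf ks T. X \<sigma> \<sigma>)"

definition vecs :: "nat list \<Rightarrow> int set \<Rightarrow> lvec set" where
  "vecs ks T = {v. \<forall>\<sigma>. \<sigma> \<notin> Conf ks T \<longrightarrow> v \<sigma> = 0}"

definition mulv :: "nat list \<Rightarrow> int set \<Rightarrow> lmat \<Rightarrow> lvec \<Rightarrow> lvec" where
  "mulv ks T X v = (\<lambda>\<sigma>. if \<sigma> \<in> Conf ks T then \<Sum>\<rho>\<in>Conf ks T. X \<sigma> \<rho> * v \<rho> else 0)"

definition vinner :: "nat list \<Rightarrow> int set \<Rightarrow> lvec \<Rightarrow> lvec \<Rightarrow> complex" where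
  "vinner ks T v w = (\<Sum>\<sigma>\<in>Conf ks T. cnj (v \<sigma>) * w \<sigma>)"

definition psd :: "nat list \<Rightarrow> int set \<Rightarrow> lmat \<Rightarrow> bool" where
  "psd ks T X = (\<forall>v\<in>vecs ks T. Im (vinner ks T v (mulv ks T X v)) = 0
                              \<and> 0 \<le> Re (vinner ks T v (mulv ks T X v)))"

definition op_le :: "nat list \<Rightarrow> int set \<Rightarrow> lmat \<Rightarrow> lmat \<Rightarrow> bool" where
  "op_le ks T P Q = psd ks T (\<lambda>\<sigma> \<tau>. Q \<sigma> \<tau> - P \<sigma> \<tau>)"

definition is_orth_proj :: "nat list \<Rightarrow> int set \<Rightarrow> lmat \<Rightarrow> bool" where
  "is_orth_proj ks T P = (P \<in> mats ks T \<and> mmul ks T P P = P \<and> madj P = P)"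

definition eigspace :: "nat list \<Rightarrow> int set \<Rightarrow> lmat \<Rightarrow> complex \<Rightarrow> lvec set" where
  "eigspace ks T D c = {v \<in> vecs ks T. mulv ks T D v = (\<lambda>\<sigma>. c * v \<sigma>)}"

definition eigvals :: "nat list \<Rightarrow> int set \<Rightarrow> lmat \<Rightarrow> complex set" where
  "eigvals ks T D = {c. \<exists>v\<in>eigspace ks T D c. v \<noteq> (\<lambda>_. 0)}"

definition eigproj :: "nat list \<Rightarrow> int set \<Rightarrow> lmat \<Rightarrow> complex \<Rightarrow> lmat" where
  "eigproj ks T D c = (THE P. is_orth_proj ks T P \<and>
      {mulv ks T P w | w. w \<in> vecs ks T} = eigspace ks T D c)"

definition mfun :: "nat list \<Rightarrow> int set \<Rightarrow> (complex \<Rightarrow> complex) \<Rightarrow> lmat \<Rightarrow> lmat" where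
  "mfun ks T f D = (\<lambda>\<sigma> \<tau>. \<Sum>c\<in>eigvals ks T D. f c * eigproj ks T D c \<sigma> \<tau>)"

text \<open>logarithm of a density matrix (on its support; the value on the kernel is
  irrelevant for the relative entropy, set to 0)\<close>
definition mlog :: "nat list \<Rightarrow> int set \<Rightarrow> lmat \<Rightarrow> lmat" where
  "mlog ks T D = mfun ks T (\<lambda>c. complex_of_real (if 0 < Re c then ln (Re c) else 0)) D"

definition msupp :: "nat list \<Rightarrow> int set \<Rightarrow> lmat \<Rightarrow> lmat" where
  "msupp ks T D = mfun ks T (\<lambda>c. if c \<noteq> 0 then 1 else 0) D"

definition is_local_state :: "nat list \<Rightarrow> int set \<Rightarrow> (lmat \<Rightarrow> complex) \<Rightarrow> bool" where
  "is_local_state ks T \<omega> =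
     ((\<forall>X\<in>loc_alg ks T. \<forall>Y\<in>loc_alg ks T. \<omega> (madd X Y) = \<omega> X + \<omega> Y) \<and>
      (\<forall>X\<in>loc_alg ks T. \<forall>c. \<omega> (msmul c X) = c * \<omega> X) \<and>
      (\<forall>X\<in>loc_alg ks T. Im (\<omega> (mmul ks T (madj X) X)) = 0 \<and>
                          0 \<le> Re (\<omega> (mmul ks T (madj X) X))) \<and>
      \<omega> (mone ks T) = 1)"

definition density :: "nat list \<Rightarrow> int set \<Rightarrow> (lmat \<Rightarrow> complex) \<Rightarrow> lmat" where
  "density ks T \<omega> = (THE D. D \<in> loc_alg ks T \<and>
      (\<forall>X\<in>loc_alg ks T. \<omega> X = mtr ks T (mmul ks T D X)))"

definition rel_entropy :: "nat list \<Rightarrow> int set \<Rightarrow> (lmat \<Rightarrow> complex) \<Rightarrow> (lmat \<Rightarrow> complex) \<Rightarrow> ereal" where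
  "rel_entropy ks T \<psi> \<phi> =
    (let D\<psi> = density ks T \<psi>; D\<phi> = density ks T \<phi> in
     if op_le ks T (msupp ks T D\<psi>) (msupp ks T D\<phi>)
     then ereal (Re (mtr ks T (mmul ks T D\<psi>
              (\<lambda>\<sigma> \<tau>. mlog ks T D\<psi> \<sigma> \<tau> - mlog ks T D\<phi> \<sigma> \<tau>))))
     else \<infinity>)"

text \<open>canonical embedding A^T \<subseteq> A^T' (X \<mapsto> X \<otimes> 1)\<close>
definition emb :: "nat list \<Rightarrow> int set \<Rightarrow> int set \<Rightarrow> lmat \<Rightarrow> lmat" where
  "emb ks T T' X = (\<lambda>\<sigma> \<tau>. if \<sigma> \<in> Conf ks T' \<and> \<tau> \<in> Conf ks T' \<and> (\<forall>t\<in>T' - T. \<sigma> t = \<tau> t)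
                          then X (restrict \<sigma> T) (restrict \<tau> T) else 0)"

text \<open>A state on the quasilocal algebra A^Z, represented (bijectively) by the
  consistent family of its restrictions to the local algebras A^T, T finite.\<close>
definition is_state :: "nat list \<Rightarrow> qstate \<Rightarrow> bool" where
  "is_state ks \<Psi> =
     ((\<forall>T. finite T \<longrightarrow> is_local_state ks T (\<Psi> T)) \<and>
      (\<forall>T T' X. finite T' \<and> T \<subseteq> T' \<and> X \<in> loc_alg ks T \<longrightarrow> \<Psi> T' (emb ks T T' X) = \<Psi> T X))"

definition shift_mat :: "lmat \<Rightarrow> lmat" where
  "shift_mat X = (\<lambda>\<sigma> \<tau>. X (\<lambda>t. \<sigma> (t + 1)) (\<lambda>t. \<tau> (t + 1)))"

definition stationary :: "nat list \<Rightarrow> qstate \<Rightarrow> bool" where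
  "stationary ks \<Psi> = (is_state ks \<Psi> \<and>
     (\<forall>T X. finite T \<and> X \<in> loc_alg ks T \<longrightarrow> \<Psi> ((\<lambda>t. t + 1) ` T) (shift_mat X) = \<Psi> T X))"

definition same_state :: "nat list \<Rightarrow> qstate \<Rightarrow> qstate \<Rightarrow> bool" where
  "same_state ks \<Psi>1 \<Psi>2 = (\<forall>T X. finite T \<and> X \<in> loc_alg ks T \<longrightarrow> \<Psi>1 T X = \<Psi>2 T X)"

definition ergodic :: "nat list \<Rightarrow> qstate \<Rightarrow> bool" where
  "ergodic ks \<Psi> = (stationary ks \<Psi> \<and>
     (\<forall>\<Psi>1 \<Psi>2 (w::real). stationary ks \<Psi>1 \<and> stationary ks \<Psi>2 \<and> 0 < w \<and> w < 1 \<and>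
        (\<forall>T X. finite T \<and> X \<in> loc_alg ks T \<longrightarrow>
           \<Psi> T X = of_real w * \<Psi>1 T X + of_real (1 - w) * \<Psi>2 T X)
        \<longrightarrow> same_state ks \<Psi>1 \<Psi>2))"

definition ivl :: "nat \<Rightarrow> int set" where
  "ivl n = {0..<int n}"

definition Sn :: "nat list \<Rightarrow> qstate \<Rightarrow> qstate \<Rightarrow> nat \<Rightarrow> ereal" where
  "Sn ks \<Psi> \<Phi> n = rel_entropy ks (ivl n) (\<Psi> (ivl n)) (\<Phi> (ivl n))"

definition rate_exists :: "nat list \<Rightarrow> qstate \<Rightarrow> qstate \<Rightarrow> bool" where
  "rate_exists ks \<Psi> \<Phi> = (\<exists>L. (\<lambda>n. Sn ks \<Psi> \<Phi> n / ereal (real n)) \<longlonglongrightarrow> L)"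

definition rate :: "nat list \<Rightarrow> qstate \<Rightarrow> qstate \<Rightarrow> ereal" where
  "rate ks \<Psi> \<Phi> = lim (\<lambda>n. Sn ks \<Psi> \<Phi> n / ereal (real n))"

definition rate_set :: "nat list \<Rightarrow> qstate set \<Rightarrow> qstate \<Rightarrow> ereal" where
  "rate_set ks \<Omega> \<Phi> = (INF \<Psi>\<in>\<Omega>. rate ks \<Psi> \<Phi>)"

definition elog :: "real \<Rightarrow> ereal" where
  "elog x = (if 0 < x then ereal (ln x) else - \<infinity>)"

definition local_proj :: "nat list \<Rightarrow> nat \<Rightarrow> lmat \<Rightarrow> bool" where
  "local_proj ks n q = (q \<in> loc_alg ks (ivl n) \<and> mmul ks (ivl n) q q = q \<and> madj q = q)"

definition beta :: "nat list \<Rightarrow> real \<Rightarrow> nat \<Rightarrow> qstate \<Rightarrow> qstate \<Rightarrow> ereal" where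
  "beta ks \<epsilon> n \<Psi> \<Phi> = Inf {elog (Re (\<Phi> (ivl n) q)) | q.
      local_proj ks n q \<and> 1 - \<epsilon> \<le> Re (\<Psi> (ivl n) q)}"

definition beta_bar :: "nat list \<Rightarrow> real \<Rightarrow> qstate \<Rightarrow> qstate \<Rightarrow> ereal" where
  "beta_bar ks \<epsilon> \<Psi> \<Phi> = limsup (\<lambda>n. beta ks \<epsilon> n \<Psi> \<Phi> / ereal (real n))"

definition HP :: "nat list \<Rightarrow> qstate \<Rightarrow> qstate \<Rightarrow> bool" where
  "HP ks \<Psi> \<Phi> = (rate_exists ks \<Psi> \<Phi> \<and>
     (\<forall>\<epsilon>. 0 < \<epsilon> \<and> \<epsilon> < 1 \<longrightarrow> beta_bar ks \<epsilon> \<Psi> \<Phi> \<le> - rate ks \<Psi> \<Phi>))"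

end

theory Submission
  imports Defs "HOL-Library.Function_Algebras" "HOL-Analysis.Convex" "HOL-Analysis.Finite_Cartesian_Product"
    "HOL-Computational_Algebra.Fundamental_Theorem_Algebra" "HOL-Real_Asymp.Real_Asymp"
begin

text \<open>
  Let \<open>\<rho> = \<Sum>c. r\<^sub>c E\<^sub>c\<close> and \<open>\<sigma> = \<Sum>d. s\<^sub>d F\<^sub>d\<close> be spectral decompositions. The Nussbaum--Szkola weights
  \<open>r\<^sub>c Tr(E\<^sub>c F\<^sub>d)\<close> and \<open>s\<^sub>d Tr(E\<^sub>c F\<^sub>d)\<close> have classical relative entropy \<open>S(\<rho>, \<sigma>)\<close>, and the Markov
  inequality shows that no operator \<open>X\<close> can have both \<open>\<rho>((1 - X)*(1 - X))\<close> and \<open>\<sigma>(X X*)\<close> much smaller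
  than allowed by \<open>exp (- S)\<close>. For a projection \<open>X\<close> this is the lower bound of the theorem.

  For the upper bound there are countably many sequences of product operators such that every
  stationary \<open>\<Psi>\<close> has relative entropy rate at most \<open>\<delta>\<close> with respect to one of them: take the density
  of \<open>\<Psi>\<close> on a block whose entropy per site is almost minimal, and approximate its logarithm from a
  countable net. Let \<open>T\<^sub>n\<close> be the sum of the first \<open>n\<close> of them, pinched by the spectral projections of
  \<open>\<Phi>\<close> for boundedly many bins of eigenvalues, and let \<open>p\<^sub>n\<close> be the Neyman--Pearson projection
  \<open>{T\<^sub>n > exp (n a) \<Phi>}\<close>. Then \<open>\<Phi>(p\<^sub>n)\<close> is at most \<open>exp (- n a)\<close> up to a factor that is linear in \<open>n\<close>. If \<open>q\<close> is
  a projection provided by the HP-condition for \<open>\<Psi>\<close>, then \<open>X = (1 - p\<^sub>n) q\<close> has exponentially small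
  weight under \<open>T\<^sub>n\<close>, so the first estimate forces \<open>\<Psi>((1 - X)*(1 - X))\<close>, and hence \<open>\<Psi>(p\<^sub>n)\<close>, to be
  close to one.
\<close>

section \<open>Matrices over a finite index set\<close>

text \<open>Two obstacles shape the upper bound. \<open>\<Omega>\<close> may be uncountable, while
  one sequence of projections has to serve all its states. The test is therefore built without
  reference to any \<Psi>, out of a countable family of operators, and a state only decides from
  which n on its own operator is among those summed. The other obstacle is that the density of
  \<Phi> neither commutes with these operators nor has a product structure, and the number of its
  eigenvalues may grow exponentially in n. Pinching by all eigenprojections would cost that number
  as a factor. Rounding the eigenvalues to a geometric scale of ratio exp (- n \<delta>) leaves a
  number of bins that is independent of n, at the price of a factor exp (n \<delta>); eigenvalues
  below exp (- n (s + b)), where exp (n b) is the dimension, have total weight at most exp (- n s)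
  and can share the last bin. Operator inequalities are expressed throughout by squared
  Hilbert-Schmidt norms: Tr (E X* X) is the squared norm of X E when E is a projection, so
  positivity is built into the notation.\<close>

definition mm :: "'i set \<Rightarrow> ('i \<Rightarrow> 'i \<Rightarrow> complex) \<Rightarrow> ('i \<Rightarrow> 'i \<Rightarrow> complex) \<Rightarrow> 'i \<Rightarrow> 'i \<Rightarrow> complex" where
  "mm I X Y = (\<lambda>i j. \<Sum>k\<in>I. X i k * Y k j)"

definition adj :: "('i \<Rightarrow> 'i \<Rightarrow> complex) \<Rightarrow> 'i \<Rightarrow> 'i \<Rightarrow> complex" where
  "adj X = (\<lambda>i j. cnj (X j i))"

definition sm :: "complex \<Rightarrow> ('i \<Rightarrow> 'i \<Rightarrow> complex) \<Rightarrow> 'i \<Rightarrow> 'i \<Rightarrow> complex" where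
  "sm c X = (\<lambda>i j. c * X i j)"

definition idm :: "'i set \<Rightarrow> 'i \<Rightarrow> 'i \<Rightarrow> complex" where
  "idm I = (\<lambda>i j. if i \<in> I \<and> i = j then 1 else 0)"

definition tr :: "'i set \<Rightarrow> ('i \<Rightarrow> 'i \<Rightarrow> complex) \<Rightarrow> complex" where
  "tr I X = (\<Sum>i\<in>I. X i i)"

text \<open>Matrices are total functions on the index type. For matrices supported on
  \<open>I\<close>, equality of functions is equality of the entries in \<open>I\<close>, so that
  \<open>X = 0\<close> can be concluded from a vanishing norm.\<close>

definition supported :: "'i set \<Rightarrow> ('i \<Rightarrow> 'i \<Rightarrow> complex) \<Rightarrow> bool" where
  "supported I X \<longleftrightarrow> (\<forall>i j. X i j \<noteq> 0 \<longrightarrow> i \<in> I \<and> j \<in> I)"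

text \<open>The square of the Hilbert-Schmidt norm. For a projection it is the rank, and for
  projections E and F the value at F E is Tr (E F).\<close>

definition hs :: "'i set \<Rightarrow> ('i \<Rightarrow> 'i \<Rightarrow> complex) \<Rightarrow> real" where
  "hs I X = (\<Sum>i\<in>I. \<Sum>j\<in>I. (cmod (X i j))\<^sup>2)"

definition proj :: "'i set \<Rightarrow> ('i \<Rightarrow> 'i \<Rightarrow> complex) \<Rightarrow> bool" where
  "proj I P \<longleftrightarrow> supported I P \<and> mm I P P = P \<and> adj P = P"

text \<open>Proof methods produce eta-expanded matrices; the pointwise rules would then rewrite a sum of
  matrices below the lambdas and hide it from the matrix lemmas.\<close>

lemmas mat_app = plus_fun_apply zero_fun_apply minus_apply

declare mat_app [simp del]

lemma sum_fun_apply: "(\<Sum>j\<in>J. F j) x = (\<Sum>j\<in>J. F j x)"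
  by (induction J rule: infinite_finite_induct) (simp_all add: mat_app)

lemma mm_assoc: "mm I (mm I X Y) Z = mm I X (mm I Y Z)"
proof (intro ext)
  fix i j
  have "mm I (mm I X Y) Z i j = (\<Sum>k\<in>I. \<Sum>l\<in>I. X i l * Y l k * Z k j)"
    by (simp only: mm_def sum_distrib_right)
  also have "\<dots> = (\<Sum>l\<in>I. \<Sum>k\<in>I. X i l * Y l k * Z k j)"
    by (rule sum.swap)
  also have "\<dots> = mm I X (mm I Y Z) i j"
    by (simp only: mm_def sum_distrib_left mult.assoc)
  finally show "mm I (mm I X Y) Z i j = mm I X (mm I Y Z) i j" .
qed

lemma mm_add_left: "mm I (X + Y) Z = mm I X Z + mm I Y Z"
  by (intro ext) (simp only: mm_def plus_fun_apply distrib_right sum.distrib)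
lemma mm_add_right: "mm I X (Y + Z) = mm I X Y + mm I X Z"
  by (intro ext) (simp only: mm_def plus_fun_apply distrib_left sum.distrib)
lemma mm_diff_left: "mm I (X - Y) Z = mm I X Z - mm I Y Z"
  by (intro ext) (simp only: mm_def minus_apply left_diff_distrib sum_subtractf)
lemma mm_diff_right: "mm I X (Y - Z) = mm I X Y - mm I X Z"
  by (intro ext) (simp only: mm_def minus_apply right_diff_distrib sum_subtractf)
lemma mm_sm_left: "mm I (sm c X) Y = sm c (mm I X Y)"
  by (intro ext) (simp only: mm_def sm_def sum_distrib_left mult.assoc)
lemma mm_sm_right: "mm I X (sm c Y) = sm c (mm I X Y)"
  by (intro ext) (simp only: mm_def sm_def sum_distrib_left mult.left_commute)
lemma mm_zero_left [simp]: "mm I 0 Y = 0"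
  by (intro ext) (simp only: mm_def zero_fun_apply mult_zero_left sum.neutral_const)
lemma mm_zero_right [simp]: "mm I Y 0 = 0"
  by (intro ext) (simp only: mm_def zero_fun_apply mult_zero_right sum.neutral_const)
lemma mm_sum_left: "mm I (\<Sum>j\<in>J. F j) Y = (\<Sum>j\<in>J. mm I (F j) Y)"
  by (intro ext) (simp only: mm_def sum_fun_apply sum_distrib_right, rule sum.swap)
lemma mm_sum_right: "mm I Y (\<Sum>j\<in>J. F j) = (\<Sum>j\<in>J. mm I Y (F j))"
  by (intro ext) (simp only: mm_def sum_fun_apply sum_distrib_left, rule sum.swap)

lemmas mm_simps = mm_add_left mm_add_right mm_diff_left mm_diff_right mm_sm_left mm_sm_right

lemma sm_sm [simp]: "sm a (sm b X) = sm (a * b) X"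
  by (simp add: sm_def mult.assoc)
lemma sm_one [simp]: "sm 1 X = X"
  by (simp add: sm_def)
lemma sm_zero [simp]: "sm 0 X = 0" "sm c 0 = 0"
  by (auto simp: mat_app sm_def fun_eq_iff)
lemma sm_add: "sm c (X + Y) = sm c X + sm c Y" "sm (c + d) X = sm c X + sm d X"
  by (auto simp: mat_app sm_def fun_eq_iff algebra_simps)
lemma sm_diff: "sm c (X - Y) = sm c X - sm c Y" "sm (c - d) X = sm c X - sm d X"
  by (auto simp: mat_app sm_def fun_eq_iff algebra_simps)

lemma adj_adj [simp]: "adj (adj X) = X"
  by (simp add: adj_def)
lemma adj_add: "adj (X + Y) = adj X + adj Y"
  by (auto simp: mat_app adj_def fun_eq_iff)
lemma adj_diff: "adj (X - Y) = adj X - adj Y"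
  by (auto simp: mat_app adj_def fun_eq_iff)
lemma adj_zero [simp]: "adj 0 = 0"
  by (auto simp: mat_app adj_def fun_eq_iff)
lemma adj_sum: "adj (\<Sum>j\<in>J. F j) = (\<Sum>j\<in>J. adj (F j))"
  by (intro ext) (simp add: adj_def sum_fun_apply)
lemma adj_sm: "adj (sm c X) = sm (cnj c) (adj X)"
  by (auto simp: adj_def sm_def fun_eq_iff)
lemma adj_mm: "adj (mm I X Y) = mm I (adj Y) (adj X)"
  by (auto simp: adj_def mm_def fun_eq_iff mult.commute)
lemma adj_idm [simp]: "adj (idm I) = idm I"
  by (auto simp: adj_def idm_def fun_eq_iff)

lemma supported_idm [simp, intro]: "supported I (idm I)"
  by (auto simp: supported_def idm_def)
lemma supported_zero [simp, intro]: "supported I 0"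
  by (auto simp: mat_app supported_def)
lemma supported_add [intro]: "supported I X \<Longrightarrow> supported I Y \<Longrightarrow> supported I (X + Y)"
  by (auto simp: mat_app supported_def) (metis add_0)+
lemma supported_diff [intro]: "supported I X \<Longrightarrow> supported I Y \<Longrightarrow> supported I (X - Y)"
  by (auto simp: mat_app supported_def) (metis diff_0 neg_0_equal_iff_equal diff_0_right)+
lemma supported_sm [intro]: "supported I X \<Longrightarrow> supported I (sm c X)"
  by (auto simp: supported_def sm_def)
lemma supported_sum [intro]: "(\<And>j. j \<in> J \<Longrightarrow> supported I (F j)) \<Longrightarrow> supported I (\<Sum>j\<in>J. F j)"
  by (induction J rule: infinite_finite_induct) auto
lemma supported_mm [intro]:
  assumes "supported I X" "supported I Y" shows "supported I (mm I X Y)"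
  unfolding supported_def
proof (intro allI impI)
  fix i j assume "mm I X Y i j \<noteq> 0"
  then obtain k where "X i k * Y k j \<noteq> 0"
    unfolding mm_def by (meson sum.neutral)
  then show "i \<in> I \<and> j \<in> I" using assms by (auto simp: supported_def)
qed
lemma supported_adj [intro]: "supported I X \<Longrightarrow> supported I (adj X)"
  by (auto simp: supported_def adj_def)

lemma mm_idm_left_entry: "finite I \<Longrightarrow> i \<in> I \<Longrightarrow> mm I (idm I) X i j = X i j"
  by (simp add: mm_def idm_def if_distrib[of "\<lambda>c. c * _"] sum.delta cong: if_cong)
lemma mm_idm_right_entry: "finite I \<Longrightarrow> j \<in> I \<Longrightarrow> mm I X (idm I) i j = X i j"
proof -
  assume a: "finite I" "j \<in> I"
  have "mm I X (idm I) i j = (\<Sum>k\<in>I. if k = j then X i k else 0)"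
    unfolding mm_def idm_def by (intro sum.cong) auto
  with a show ?thesis by simp
qed
lemma mm_idm_left: "finite I \<Longrightarrow> supported I X \<Longrightarrow> mm I (idm I) X = X"
proof (intro ext)
  fix i j assume "finite I" "supported I X"
  then show "mm I (idm I) X i j = X i j"
    by (cases "i \<in> I") (simp add: mm_idm_left_entry, auto simp: mm_def idm_def supported_def)
qed
lemma mm_idm_right: "finite I \<Longrightarrow> supported I X \<Longrightarrow> mm I X (idm I) = X"
proof (intro ext)
  fix i j assume "finite I" "supported I X"
  then show "mm I X (idm I) i j = X i j"
    using sum.neutral[of I "\<lambda>k. X i k * (if k = j then 1 else 0)"]
    by (cases "j \<in> I") (simp add: mm_idm_right_entry, auto simp: mm_def idm_def supported_def)
qed

section \<open>Trace and squared Hilbert-Schmidt norm\<close>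

lemma tr_add: "tr I (X + Y) = tr I X + tr I Y" by (simp add: mat_app tr_def sum.distrib)
lemma tr_diff: "tr I (X - Y) = tr I X - tr I Y" by (simp add: mat_app tr_def sum_subtractf)
lemma tr_sm: "tr I (sm c X) = c * tr I X" by (simp add: tr_def sm_def sum_distrib_left)
lemma tr_zero [simp]: "tr I 0 = 0" by (simp add: mat_app tr_def)
lemma tr_sum: "tr I (\<Sum>j\<in>J. F j) = (\<Sum>j\<in>J. tr I (F j))"
  by (simp add: mat_app mat_app mat_app tr_def sum_fun_apply) (rule sum.swap)
lemma tr_mm_commute: "tr I (mm I X Y) = tr I (mm I Y X)"
  unfolding tr_def mm_def by (subst sum.swap) (simp add: mult.commute)
lemma tr_idm: "finite I \<Longrightarrow> tr I (idm I) = of_nat (card I)"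
  by (simp add: tr_def idm_def)

lemma hs_nonneg [simp]: "0 \<le> hs I X"
  by (simp add: hs_def sum_nonneg)

lemma hs_tr: "complex_of_real (hs I X) = tr I (mm I (adj X) X)"
proof -
  have "tr I (mm I (adj X) X) = (\<Sum>i\<in>I. \<Sum>k\<in>I. cnj (X k i) * X k i)"
    by (simp add: tr_def mm_def adj_def)
  also have "\<dots> = (\<Sum>k\<in>I. \<Sum>i\<in>I. cnj (X k i) * X k i)"
    by (rule sum.swap)
  also have "\<dots> = (\<Sum>k\<in>I. \<Sum>i\<in>I. complex_of_real ((cmod (X k i))\<^sup>2))"
    by (intro sum.cong refl) (metis complex_norm_square mult.commute)
  finally show ?thesis by (simp add: hs_def)
qed

lemma hs_eq: "hs I X = Re (tr I (mm I (adj X) X))"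
  by (simp flip: hs_tr)

lemma hs_adj: "hs I (adj X) = hs I X"
  by (simp add: hs_eq tr_mm_commute)

lemma hs_eq_0:
  assumes "finite I" "supported I X" "hs I X = 0"
  shows "X = 0"
proof (rule ccontr)
  assume "X \<noteq> 0"
  then obtain i j where ij: "X i j \<noteq> 0" by (metis ext zero_fun_apply)
  then have "i \<in> I" "j \<in> I" using assms(2) by (auto simp: supported_def)
  then have "(cmod (X i j))\<^sup>2 \<le> (\<Sum>j\<in>I. (cmod (X i j))\<^sup>2)"
    using assms(1) by (intro member_le_sum) auto
  also have "\<dots> \<le> hs I X"
    unfolding hs_def using assms(1) \<open>i \<in> I\<close>
    by (intro member_le_sum[of i I "\<lambda>i. \<Sum>j\<in>I. (cmod (X i j))\<^sup>2"]) (auto intro: sum_nonneg)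
  finally show False using ij assms(3) by simp
qed

lemma hs_zero [simp]: "hs I 0 = 0" by (simp add: mat_app hs_def)

lemma mm_adj_self_eq_0: "finite I \<Longrightarrow> supported I X \<Longrightarrow> mm I (adj X) X = 0 \<Longrightarrow> X = 0"
  by (rule hs_eq_0) (auto simp: mat_app hs_eq)

text \<open>Young's inequality in every entry. The parameter stays free because the coefficient of
  \<open>X\<close> must come arbitrarily close to 1 when acceptance probabilities are shown to tend
  to 1.\<close>

lemma hs_add_le:
  assumes "0 < \<kappa>"
  shows "hs I (X + Y) \<le> (1 + \<kappa>) * hs I X + (1 + 1 / \<kappa>) * hs I Y"
proof -
  have *: "(cmod (a + b))\<^sup>2 \<le> (1 + \<kappa>) * (cmod a)\<^sup>2 + (1 + 1 / \<kappa>) * (cmod b)\<^sup>2" for a b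
  proof -
    have "(cmod (a + b))\<^sup>2 \<le> (cmod a + cmod b)\<^sup>2"
      by (simp add: norm_triangle_ineq power_mono)
    also have "\<dots> = (cmod a)\<^sup>2 + (cmod b)\<^sup>2 + 2 * (cmod a * cmod b)"
      by (simp add: power2_sum)
    also have "2 * (cmod a * cmod b) \<le> \<kappa> * (cmod a)\<^sup>2 + (1 / \<kappa>) * (cmod b)\<^sup>2"
    proof -
      have "0 \<le> (\<kappa> * cmod a - cmod b)\<^sup>2 / \<kappa>" using assms by simp
      also have "\<dots> = \<kappa> * (cmod a)\<^sup>2 + (1 / \<kappa>) * (cmod b)\<^sup>2 - 2 * (cmod a * cmod b)"
        using assms by (simp add: field_simps power2_eq_square)
      finally show ?thesis by simp
    qed
    finally show ?thesis by (simp add: algebra_simps)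
  qed
  have "hs I (X + Y) \<le> (\<Sum>i\<in>I. \<Sum>j\<in>I. (1 + \<kappa>) * (cmod (X i j))\<^sup>2 + (1 + 1 / \<kappa>) * (cmod (Y i j))\<^sup>2)"
    unfolding hs_def mat_app by (intro sum_mono) (use * in simp)
  also have "\<dots> = (1 + \<kappa>) * hs I X + (1 + 1 / \<kappa>) * hs I Y"
    by (simp only: hs_def sum.distrib sum_distrib_left)
  finally show ?thesis .
qed

text \<open>Cauchy-Schwarz in every entry. Applied to the blocks of a pinching, this is the pinching
  inequality: an operator is dominated by its pinching times the number of blocks.\<close>

lemma hs_sum_le: "hs I (\<Sum>b\<in>B. Y b) \<le> real (card B) * (\<Sum>b\<in>B. hs I (Y b))"
proof -
  have *: "(cmod (\<Sum>b\<in>B. f b))\<^sup>2 \<le> real (card B) * (\<Sum>b\<in>B. (cmod (f b))\<^sup>2)" for f :: "_ \<Rightarrow> complex"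
  proof -
    have "(cmod (\<Sum>b\<in>B. f b))\<^sup>2 \<le> (\<Sum>b\<in>B. 1 * cmod (f b))\<^sup>2"
      using norm_sum[of f B] by (simp add: power_mono)
    also have "\<dots> \<le> (\<Sum>b\<in>B. 1\<^sup>2) * (\<Sum>b\<in>B. (cmod (f b))\<^sup>2)"
      by (rule Cauchy_Schwarz_ineq_sum)
    finally show ?thesis by simp
  qed
  have "hs I (\<Sum>b\<in>B. Y b) \<le> (\<Sum>i\<in>I. \<Sum>j\<in>I. real (card B) * (\<Sum>b\<in>B. (cmod (Y b i j))\<^sup>2))"
    unfolding hs_def sum_fun_apply by (intro sum_mono *)
  also have "\<dots> = real (card B) * (\<Sum>i\<in>I. \<Sum>j\<in>I. \<Sum>b\<in>B. (cmod (Y b i j))\<^sup>2)"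
    by (simp only: sum_distrib_left)
  also have "(\<Sum>i\<in>I. \<Sum>j\<in>I. \<Sum>b\<in>B. (cmod (Y b i j))\<^sup>2) = (\<Sum>i\<in>I. \<Sum>b\<in>B. \<Sum>j\<in>I. (cmod (Y b i j))\<^sup>2)"
    by (intro sum.cong refl sum.swap)
  also have "\<dots> = (\<Sum>b\<in>B. hs I (Y b))"
    unfolding hs_def by (rule sum.swap)
  finally show ?thesis .
qed

lemma hs_mm_le: "hs I (mm I X Y) \<le> hs I X * hs I Y"
proof -
  have "(cmod (mm I X Y i j))\<^sup>2 \<le> (\<Sum>k\<in>I. (cmod (X i k))\<^sup>2) * (\<Sum>k\<in>I. (cmod (Y k j))\<^sup>2)" for i j
  proof -
    have "(cmod (mm I X Y i j))\<^sup>2 \<le> (\<Sum>k\<in>I. cmod (X i k) * cmod (Y k j))\<^sup>2"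
      unfolding mm_def by (intro power_mono order_trans[OF norm_sum]) (simp_all add: norm_mult)
    also have "\<dots> \<le> (\<Sum>k\<in>I. (cmod (X i k))\<^sup>2) * (\<Sum>k\<in>I. (cmod (Y k j))\<^sup>2)"
      by (rule Cauchy_Schwarz_ineq_sum)
    finally show ?thesis .
  qed
  then have "hs I (mm I X Y) \<le> (\<Sum>i\<in>I. \<Sum>j\<in>I. (\<Sum>k\<in>I. (cmod (X i k))\<^sup>2) * (\<Sum>k\<in>I. (cmod (Y k j))\<^sup>2))"
    unfolding hs_def by (intro sum_mono)
  also have "\<dots> = hs I X * (\<Sum>j\<in>I. \<Sum>k\<in>I. (cmod (Y k j))\<^sup>2)"
    by (simp add: hs_def sum_product)
  also have "(\<Sum>j\<in>I. \<Sum>k\<in>I. (cmod (Y k j))\<^sup>2) = hs I Y"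
    unfolding hs_def by (rule sum.swap)
  finally show ?thesis .
qed

section \<open>Projections and resolutions of the identity\<close>

lemma projD: "proj I P \<Longrightarrow> supported I P" "proj I P \<Longrightarrow> mm I P P = P" "proj I P \<Longrightarrow> adj P = P"
  by (auto simp: proj_def)

lemma proj_mm_cancel: "proj I P \<Longrightarrow> mm I P (mm I P X) = mm I P X"
  by (metis mm_assoc projD(2))

lemma hs_proj_left: "proj I P \<Longrightarrow> hs I (mm I P X) = Re (tr I (mm I (adj X) (mm I P X)))"
  by (simp add: hs_eq adj_mm mm_assoc projD proj_mm_cancel)

lemma hs_proj_right: "proj I P \<Longrightarrow> hs I (mm I X P) = Re (tr I (mm I (mm I (adj X) X) P))"
proof -
  assume P: "proj I P"
  have "hs I (mm I X P) = Re (tr I (mm I P (mm I (mm I (adj X) X) P)))"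
    by (simp add: hs_eq adj_mm mm_assoc projD[OF P])
  also have "\<dots> = Re (tr I (mm I (mm I (mm I (adj X) X) P) P))"
    by (simp only: tr_mm_commute)
  also have "\<dots> = Re (tr I (mm I (mm I (adj X) X) P))"
    by (simp add: mm_assoc projD P)
  finally show ?thesis .
qed

lemma proj_tr: "proj I P \<Longrightarrow> tr I P = complex_of_real (hs I P)"
  by (simp add: hs_tr projD)

text \<open>By submultiplicativity the norm in question is at most its own square, and a positive
  number with this property is at least 1. This takes the place of the integrality of the
  rank.\<close>

lemma proj_hs_ge_1: "finite I \<Longrightarrow> proj I P \<Longrightarrow> P \<noteq> 0 \<Longrightarrow> 1 \<le> hs I P"
proof -
  assume a: "finite I" "proj I P" "P \<noteq> 0"
  have "hs I P \<noteq> 0" using hs_eq_0[OF a(1) projD(1)[OF a(2)]] a(3) by blast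
  then have "0 < hs I P" using hs_nonneg[of I P] by linarith
  moreover have "hs I P \<le> hs I P * hs I P"
    using hs_mm_le[of I P P] projD(2)[OF a(2)] by simp
  ultimately show ?thesis by simp
qed

lemma proj_compl: "finite I \<Longrightarrow> proj I P \<Longrightarrow> proj I (idm I - P)"
  by (auto simp: proj_def mm_simps mm_idm_left mm_idm_right adj_diff)

lemma proj_idm: "finite I \<Longrightarrow> proj I (idm I)"
  by (auto simp: proj_def mm_idm_left)

lemma hs_idm: "finite I \<Longrightarrow> hs I (idm I) = real (card I)"
  by (metis Re_complex_of_real of_real_of_nat_eq proj_idm proj_tr tr_idm)

lemma hs_cong: "(\<And>i j. i \<in> I \<Longrightarrow> j \<in> I \<Longrightarrow> X i j = Y i j) \<Longrightarrow> hs I X = hs I Y"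
  by (simp add: hs_def)

lemma hs_idm_mm: "finite I \<Longrightarrow> hs I (mm I (idm I) X) = hs I X" "finite I \<Longrightarrow> hs I (mm I X (idm I)) = hs I X"
  by (rule hs_cong, simp add: mm_idm_left_entry mm_idm_right_entry)+

lemma hs_proj_split: 
  assumes "finite I" "proj I P"
  shows "hs I (mm I P X) + hs I (mm I (idm I - P) X) = hs I X"
proof -
  have "hs I (mm I P X) + hs I (mm I (idm I - P) X)
      = Re (tr I (mm I (adj X) (mm I P X) + mm I (adj X) (mm I (idm I - P) X)))"
    using assms by (simp add: hs_proj_left proj_compl tr_add)
  also have "mm I (adj X) (mm I P X) + mm I (adj X) (mm I (idm I - P) X) = mm I (adj X) (mm I (idm I) X)"
    by (simp add: mm_simps)
  also have "Re (tr I \<dots>) = hs I (mm I (idm I) X)"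
    using assms by (simp add: hs_proj_left proj_idm)
  finally show ?thesis by (simp only: hs_idm_mm(1)[OF assms(1)])
qed

lemma hs_proj_le: "finite I \<Longrightarrow> proj I P \<Longrightarrow> hs I (mm I P X) \<le> hs I X"
  using hs_proj_split[of I P X] hs_nonneg[of I "mm I (idm I - P) X"] by linarith

lemma hs_proj_le_right: "finite I \<Longrightarrow> proj I P \<Longrightarrow> hs I (mm I X P) \<le> hs I X"
  using hs_proj_le[of I P "adj X"] hs_adj[of I "mm I X P"] by (simp add: adj_mm projD hs_adj)

definition resol :: "'i set \<Rightarrow> 'j set \<Rightarrow> ('j \<Rightarrow> 'i \<Rightarrow> 'i \<Rightarrow> complex) \<Rightarrow> bool" where
  "resol I J F \<longleftrightarrow> finite J \<and> (\<forall>j\<in>J. proj I (F j)) \<and> (\<Sum>j\<in>J. F j) = idm I"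

text \<open>Pythagoras. Together with the version for right multiplication it computes the marginals
  of the Nussbaum--Szkola weights.\<close>

lemma resol_hs_left:
  assumes "finite I" "resol I J F"
  shows "(\<Sum>j\<in>J. hs I (mm I (F j) X)) = hs I X"
proof -
  have "(\<Sum>j\<in>J. hs I (mm I (F j) X)) = Re (tr I (mm I (adj X) (mm I (\<Sum>j\<in>J. F j) X)))"
    unfolding mm_sum_left mm_sum_right tr_sum using assms by (simp add: resol_def hs_proj_left)
  also have "\<dots> = hs I (mm I (idm I) X)"
    using assms by (simp add: hs_proj_left proj_idm resol_def)
  finally show ?thesis using assms by (simp add: hs_idm_mm)
qed

lemma resol_hs_right:
  assumes "finite I" "resol I J F"
  shows "(\<Sum>j\<in>J. hs I (mm I X (F j))) = hs I X"
proof -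
  have "(\<Sum>j\<in>J. hs I (mm I X (F j))) = (\<Sum>j\<in>J. hs I (mm I (F j) (adj X)))"
    by (intro sum.cong refl, subst hs_adj[symmetric])
       (use assms in \<open>auto simp: adj_mm resol_def projD\<close>)
  then show ?thesis using resol_hs_left[OF assms, of "adj X"] by (simp add: hs_adj)
qed

section \<open>The Nussbaum--Szkola estimate\<close>

text \<open>For projections the norm factor is Tr (E c F d), so this is the classical relative
  entropy of the two families of Nussbaum--Szkola weights. A pair with \<open>s d = 0 < r c\<close>
  should give infinity but gives a finite value because \<open>ln 0 = 0\<close>; the hypothesis
  \<open>ac\<close> of the estimates below makes such pairs weightless.\<close>

definition ns_entropy :: "'i set \<Rightarrow> 'c set \<Rightarrow> ('c \<Rightarrow> real) \<Rightarrow> ('c \<Rightarrow> 'i \<Rightarrow> 'i \<Rightarrow> complex) \<Rightarrow>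
    'd set \<Rightarrow> ('d \<Rightarrow> real) \<Rightarrow> ('d \<Rightarrow> 'i \<Rightarrow> 'i \<Rightarrow> complex) \<Rightarrow> real" where
  "ns_entropy I C r E J s F = (\<Sum>c\<in>C. \<Sum>d\<in>J. r c * (ln (r c) - ln (s d)) * hs I (mm I (F d) (E c)))"

text \<open>From ln u \<le> u - 1 with u = s / r. The logarithmic ratio may be negative; adding
  \<open>s\<close> makes each term nonnegative, as Markov's inequality requires.\<close>

lemma ln_ratio_bound:
  fixes r s :: real
  assumes "0 < r" "0 < s"
  shows "0 \<le> r * (ln r - ln s) + s"
proof -
  have "ln (s / r) \<le> s / r - 1" using assms by (intro ln_le_minus_one) simp
  then have "ln s - ln r \<le> s / r" using assms by (simp add: ln_div)
  then have "r * (ln s - ln r) \<le> s" using assms by (simp add: field_simps)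
  then show ?thesis by (simp add: algebra_simps)
qed

text \<open>Call a pair good if \<open>r c \<le> exp t * s d\<close>. On the bad pairs the
  logarithmic ratio exceeds t, so by Markov their weight is at most the fraction on the left. On the
  good pairs F E = F (1 - X) E + F X E: the first summand is weighted by \<open>r\<close>, and in
  the second \<open>r\<close> may be exchanged for \<open>exp t * s\<close>. Summing out one index
  in each of them leaves the two sums on the right. \<open>X\<close> is an arbitrary operator since
  it will be a product of two projections.\<close>

lemma nussbaum_szkola:
  assumes I: "finite I" and E: "resol I C E" and F: "resol I J F"
    and r: "\<And>c. c \<in> C \<Longrightarrow> 0 \<le> r c" and s: "\<And>d. d \<in> J \<Longrightarrow> 0 \<le> s d"
    and ac: "\<And>c d. c \<in> C \<Longrightarrow> d \<in> J \<Longrightarrow> 0 < r c \<Longrightarrow> s d = 0 \<Longrightarrow> hs I (mm I (F d) (E c)) = 0"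
    and r1: "(\<Sum>c\<in>C. r c * hs I (E c)) = 1"
    and \<kappa>: "0 < \<kappa>" and t: "0 < t"
  shows "1 - (ns_entropy I C r E J s F + (\<Sum>d\<in>J. s d * hs I (F d))) / t
    \<le> (1 + \<kappa>) * (\<Sum>c\<in>C. r c * hs I (mm I (idm I - X) (E c)))
      + (1 + 1 / \<kappa>) * exp t * (\<Sum>d\<in>J. s d * hs I (mm I (F d) X))"
proof -
  let ?w = "\<lambda>c d. hs I (mm I (F d) (E c))"
  let ?good = "\<lambda>c d. r c \<le> exp t * s d"
  have fin: "finite C" "finite J" using E F by (auto simp: resol_def)
  have pt: "(if ?good c d then 0 else t * (r c * ?w c d))
      \<le> r c * (ln (r c) - ln (s d)) * ?w c d + s d * ?w c d" if "c \<in> C" "d \<in> J" for c d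
  proof (cases "?w c d = 0 \<or> r c = 0")
    case True
    with s[OF that(2)] show ?thesis by (auto simp: mult_nonneg_nonneg)
  next
    case False
    then have rp: "0 < r c" using r[OF that(1)] by linarith
    have sp: "0 < s d" using ac[OF that rp] False s[OF that(2)] by fastforce
    have wp: "0 \<le> ?w c d" by simp
    show ?thesis
    proof (cases "?good c d")
      case True
      have "0 \<le> (r c * (ln (r c) - ln (s d)) + s d) * ?w c d"
        using ln_ratio_bound[OF rp sp] wp by (rule mult_nonneg_nonneg)
      then show ?thesis using True by (simp add: algebra_simps)
    next
      case bad: False
      then have "ln (exp t * s d) \<le> ln (r c)" using rp sp by (subst ln_le_cancel_iff) auto
      then have "t \<le> ln (r c) - ln (s d)" using sp by (simp add: ln_mult)
      then have "t * (r c * ?w c d) \<le> (ln (r c) - ln (s d)) * (r c * ?w c d)"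
        using rp wp by (intro mult_right_mono) auto
      moreover have "0 \<le> s d * ?w c d" using sp wp by simp
      ultimately show ?thesis using bad by (simp add: algebra_simps)
    qed
  qed
  have sw: "(\<Sum>c\<in>C. \<Sum>d\<in>J. s d * ?w c d) = (\<Sum>d\<in>J. s d * hs I (F d))"
  proof -
    have "(\<Sum>c\<in>C. \<Sum>d\<in>J. s d * ?w c d) = (\<Sum>d\<in>J. s d * (\<Sum>c\<in>C. ?w c d))"
      by (subst sum.swap) (simp add: sum_distrib_left)
    then show ?thesis by (simp add: resol_hs_right[OF I E])
  qed
  have rw: "(\<Sum>c\<in>C. \<Sum>d\<in>J. r c * ?w c d) = 1"
    using r1 by (simp add: resol_hs_left[OF I F] flip: sum_distrib_left)
  define bad where "bad = (\<Sum>c\<in>C. \<Sum>d\<in>J. if ?good c d then 0 else r c * ?w c d)"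
  define good where "good = (\<Sum>c\<in>C. \<Sum>d\<in>J. if ?good c d then r c * ?w c d else 0)"
  have "good + bad = (\<Sum>c\<in>C. \<Sum>d\<in>J. r c * ?w c d)"
    unfolding good_def bad_def sum.distrib[symmetric] by (intro sum.cong) auto
  then have gb: "good = 1 - bad" using rw by linarith
  have "t * bad = (\<Sum>c\<in>C. \<Sum>d\<in>J. if ?good c d then 0 else t * (r c * ?w c d))"
    unfolding bad_def sum_distrib_left by (intro sum.cong) auto
  also have "\<dots> \<le> (\<Sum>c\<in>C. \<Sum>d\<in>J. r c * (ln (r c) - ln (s d)) * ?w c d + s d * ?w c d)"
    by (intro sum_mono pt)
  also have "\<dots> = ns_entropy I C r E J s F + (\<Sum>d\<in>J. s d * hs I (F d))"
    using sw by (simp add: sum.distrib ns_entropy_def)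
  finally have badle: "bad \<le> (ns_entropy I C r E J s F + (\<Sum>d\<in>J. s d * hs I (F d))) / t"
    using t by (simp add: field_simps)
  have "good \<le> (\<Sum>c\<in>C. \<Sum>d\<in>J. (1 + \<kappa>) * (r c * hs I (mm I (F d) (mm I (idm I - X) (E c))))
          + (1 + 1 / \<kappa>) * exp t * (s d * hs I (mm I (mm I (F d) X) (E c))))"
    unfolding good_def
  proof (intro sum_mono)
    fix c d assume cd: "c \<in> C" "d \<in> J"
    let ?a = "hs I (mm I (F d) (mm I (idm I - X) (E c)))" and ?b = "hs I (mm I (mm I (F d) X) (E c))"
    have nn: "0 \<le> (1 + \<kappa>) * (r c * ?a)" "0 \<le> (1 + 1 / \<kappa>) * exp t * (s d * ?b)"
      using \<kappa> r[OF cd(1)] s[OF cd(2)] by (auto intro!: mult_nonneg_nonneg)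
    show "(if ?good c d then r c * ?w c d else 0) \<le> (1 + \<kappa>) * (r c * ?a) + (1 + 1 / \<kappa>) * exp t * (s d * ?b)"
    proof (cases "?good c d")
      case True
      have Es: "supported I (E c)" using E cd by (auto simp: resol_def proj_def)
      have "mm I (F d) (E c) = mm I (F d) (mm I (idm I - X) (E c)) + mm I (mm I (F d) X) (E c)"
        by (simp add: mm_simps mm_assoc mm_idm_left I Es)
      then have "?w c d \<le> (1 + \<kappa>) * ?a + (1 + 1 / \<kappa>) * ?b"
        using hs_add_le[OF \<kappa>] by simp
      then have "r c * ?w c d \<le> r c * ((1 + \<kappa>) * ?a + (1 + 1 / \<kappa>) * ?b)"
        using r[OF cd(1)] by (rule mult_left_mono)
      also have "\<dots> = (1 + \<kappa>) * (r c * ?a) + r c * ((1 + 1 / \<kappa>) * ?b)"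
        by (simp add: algebra_simps)
      also have "r c * ((1 + 1 / \<kappa>) * ?b) \<le> exp t * s d * ((1 + 1 / \<kappa>) * ?b)"
        using True \<kappa> by (intro mult_right_mono) auto
      finally show ?thesis by (simp only: True if_True mult_ac)
    next
      case False
      then show ?thesis using nn by simp
    qed
  qed
  also have "\<dots> = (1 + \<kappa>) * (\<Sum>c\<in>C. r c * (\<Sum>d\<in>J. hs I (mm I (F d) (mm I (idm I - X) (E c)))))
      + (1 + 1 / \<kappa>) * exp t * (\<Sum>d\<in>J. s d * (\<Sum>c\<in>C. hs I (mm I (mm I (F d) X) (E c))))"
  proof -
    have "(\<Sum>c\<in>C. \<Sum>d\<in>J. (1 + 1 / \<kappa>) * exp t * (s d * hs I (mm I (mm I (F d) X) (E c))))
      = (\<Sum>d\<in>J. \<Sum>c\<in>C. (1 + 1 / \<kappa>) * exp t * (s d * hs I (mm I (mm I (F d) X) (E c))))"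
      by (rule sum.swap)
    then show ?thesis by (simp only: sum.distrib sum_distrib_left)
  qed
  also have "\<dots> = (1 + \<kappa>) * (\<Sum>c\<in>C. r c * hs I (mm I (idm I - X) (E c)))
      + (1 + 1 / \<kappa>) * exp t * (\<Sum>d\<in>J. s d * hs I (mm I (F d) X))"
    by (simp only: resol_hs_left[OF I F] resol_hs_right[OF I E])
  finally show ?thesis using gb badle by linarith
qed

text \<open>Every term becomes nonnegative once its share of the second weights is added. For
  normalised weights the lower bound is -1, which disappears after division by n.\<close>

lemma ns_entropy_lower:
  assumes I: "finite I" and E: "resol I C E" and F: "resol I J F"
    and r: "\<And>c. c \<in> C \<Longrightarrow> 0 \<le> r c" and s: "\<And>d. d \<in> J \<Longrightarrow> 0 \<le> s d"
    and ac: "\<And>c d. c \<in> C \<Longrightarrow> d \<in> J \<Longrightarrow> 0 < r c \<Longrightarrow> s d = 0 \<Longrightarrow> hs I (mm I (F d) (E c)) = 0"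
    and r1: "(\<Sum>c\<in>C. r c * hs I (E c)) = 1"
  shows "- (\<Sum>d\<in>J. s d * hs I (F d)) \<le> ns_entropy I C r E J s F"
proof -
  have "0 \<le> r c * (ln (r c) - ln (s d)) * hs I (mm I (F d) (E c)) + s d * hs I (mm I (F d) (E c))"
    if "c \<in> C" "d \<in> J" for c d
  proof (cases "hs I (mm I (F d) (E c)) = 0 \<or> r c = 0")
    case True
    with s[OF that(2)] show ?thesis by (auto simp: mult_nonneg_nonneg)
  next
    case False
    then have rp: "0 < r c" using r[OF that(1)] by linarith
    have sp: "0 < s d" using ac[OF that rp] False s[OF that(2)] by fastforce
    have "0 \<le> (r c * (ln (r c) - ln (s d)) + s d) * hs I (mm I (F d) (E c))"
      using ln_ratio_bound[OF rp sp] hs_nonneg by (rule mult_nonneg_nonneg)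
    then show ?thesis by (simp add: algebra_simps)
  qed
  then have "0 \<le> (\<Sum>c\<in>C. \<Sum>d\<in>J. r c * (ln (r c) - ln (s d)) * hs I (mm I (F d) (E c)) + s d * hs I (mm I (F d) (E c)))"
    by (intro sum_nonneg)
  also have "\<dots> = ns_entropy I C r E J s F + (\<Sum>d\<in>J. s d * (\<Sum>c\<in>C. hs I (mm I (F d) (E c))))"
    unfolding ns_entropy_def sum.distrib sum_distrib_left
    using sum.swap[of "\<lambda>c d. s d * hs I (mm I (F d) (E c))" J C] by (simp only:)
  finally show ?thesis by (simp add: resol_hs_right[OF I E])
qed

lemma ns_entropy_split:
  assumes I: "finite I" and E: "resol I C E" and F: "resol I J F"
  shows "ns_entropy I C r E J s F = (\<Sum>c\<in>C. r c * ln (r c) * hs I (E c))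
     - (\<Sum>d\<in>J. ln (s d) * (\<Sum>c\<in>C. r c * hs I (mm I (F d) (E c))))"
proof -
  have "ns_entropy I C r E J s F = (\<Sum>c\<in>C. r c * ln (r c) * (\<Sum>d\<in>J. hs I (mm I (F d) (E c))))
     - (\<Sum>d\<in>J. ln (s d) * (\<Sum>c\<in>C. r c * hs I (mm I (F d) (E c))))"
    unfolding ns_entropy_def sum_distrib_left
    using sum.swap[of "\<lambda>c d. ln (s d) * (r c * hs I (mm I (F d) (E c)))" J C]
    by (simp add: sum_subtractf algebra_simps)
  then show ?thesis by (simp add: resol_hs_left[OF I F])
qed

section \<open>Spectral theorem\<close>

definition poly_mat :: "'i set \<Rightarrow> ('i \<Rightarrow> 'i \<Rightarrow> complex) \<Rightarrow> complex poly \<Rightarrow> 'i \<Rightarrow> 'i \<Rightarrow> complex" where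
  "poly_mat I M p = fold_coeffs (\<lambda>a Y. sm a (idm I) + mm I M Y) p 0"

lemma poly_mat_0 [simp]: "poly_mat I M 0 = 0"
  by (simp add: poly_mat_def)

lemma poly_mat_pCons: "poly_mat I M (pCons a p) = sm a (idm I) + mm I M (poly_mat I M p)"
  by (cases "a = 0 \<and> p = 0") (auto simp: poly_mat_def)

lemma poly_mat_add: "poly_mat I M (p + q) = poly_mat I M p + poly_mat I M q"
  by (induction p q rule: poly_induct2) (simp_all add: poly_mat_pCons sm_add mm_add_right)

lemma poly_mat_smult: "poly_mat I M (smult c p) = sm c (poly_mat I M p)"
  by (induction p) (simp_all add: poly_mat_pCons sm_add mm_sm_right)

lemma poly_mat_diff: "poly_mat I M (p - q) = poly_mat I M p - poly_mat I M q"
proof -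
  have "poly_mat I M (p - q) + poly_mat I M q = poly_mat I M p" by (simp flip: poly_mat_add)
  then show ?thesis by (simp add: eq_diff_eq)
qed

lemma poly_mat_sum: "poly_mat I M (\<Sum>j\<in>J. p j) = (\<Sum>j\<in>J. poly_mat I M (p j))"
  by (induction J rule: infinite_finite_induct) (simp_all add: poly_mat_add)

lemma poly_mat_1: "poly_mat I M 1 = idm I"
  by (simp add: one_pCons poly_mat_pCons)

context
  fixes I :: "'i set" and M :: "'i \<Rightarrow> 'i \<Rightarrow> complex"
  assumes I: "finite I" and M: "supported I M"
begin

lemma poly_mat_supported: "supported I (poly_mat I M p)"
  by (induction p) (auto simp: poly_mat_pCons intro!: M)

lemma poly_mat_X: "poly_mat I M [:0, 1:] = M"
  by (simp add: poly_mat_pCons mm_idm_right I M)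

lemma poly_mat_mult: "poly_mat I M (p * q) = mm I (poly_mat I M p) (poly_mat I M q)"
proof (induction p)
  case (pCons a p)
  have "poly_mat I M (pCons a p * q) = sm a (poly_mat I M q) + mm I M (mm I (poly_mat I M p) (poly_mat I M q))"
    by (simp add: poly_mat_add poly_mat_smult poly_mat_pCons pCons)
  also have "\<dots> = mm I (poly_mat I M (pCons a p)) (poly_mat I M q)"
    by (simp add: poly_mat_pCons mm_add_left mm_sm_left mm_idm_left I poly_mat_supported mm_assoc)
  finally show ?case .
qed simp

lemma poly_mat_commute:
  assumes "supported I Y" "mm I M Y = mm I Y M"
  shows "mm I (poly_mat I M p) Y = mm I Y (poly_mat I M p)"
proof (induction p)
  case (pCons a p)
  have "mm I (poly_mat I M (pCons a p)) Y = sm a Y + mm I M (mm I (poly_mat I M p) Y)"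
    by (simp add: poly_mat_pCons mm_add_left mm_sm_left mm_idm_left I assms(1) mm_assoc)
  also have "\<dots> = sm a Y + mm I (mm I M Y) (poly_mat I M p)"
    by (simp add: pCons mm_assoc)
  also have "\<dots> = mm I Y (poly_mat I M (pCons a p))"
    by (simp add: assms(2) poly_mat_pCons mm_add_right mm_sm_right mm_idm_right I assms(1) mm_assoc)
  finally show ?case .
qed simp

lemma poly_mat_adj:
  assumes "adj M = M"
  shows "adj (poly_mat I M p) = poly_mat I M (map_poly cnj p)"
proof (induction p)
  case (pCons a p)
  have "adj (poly_mat I M (pCons a p)) = sm (cnj a) (idm I) + mm I (adj (poly_mat I M p)) M"
    by (simp add: poly_mat_pCons adj_add adj_sm adj_mm assms)
  also have "mm I (adj (poly_mat I M p)) M = mm I M (poly_mat I M (map_poly cnj p))"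
    using poly_mat_commute[OF M refl] pCons by simp
  finally show ?case by (simp add: map_poly_pCons poly_mat_pCons)
qed simp

text \<open>All powers of \<open>M\<close> lie in the span of the finitely many matrix units over
  \<open>I\<close>, so sufficiently many of them are linearly dependent.\<close>

lemma annihilating_poly: "\<exists>p. p \<noteq> 0 \<and> poly_mat I M p = 0"
proof -
  interpret vs: vector_space "sm :: complex \<Rightarrow> ('i \<Rightarrow> 'i \<Rightarrow> complex) \<Rightarrow> 'i \<Rightarrow> 'i \<Rightarrow> complex"
    by unfold_locales (simp_all only: sm_add sm_sm sm_one)
  define eu :: "'i \<times> 'i \<Rightarrow> 'i \<Rightarrow> 'i \<Rightarrow> complex" where
    "eu = (\<lambda>(i, j) a b. if a = i \<and> b = j then 1 else 0)"
  define B where "B = eu ` (I \<times> I)"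
  have finB: "finite B" using I by (simp add: B_def)
  have span: "X \<in> vs.span B" if X: "supported I X" for X
  proof -
    have "X = (\<Sum>ij\<in>I \<times> I. sm (X (fst ij) (snd ij)) (eu ij))"
    proof (intro ext)
      fix a b
      have "(\<Sum>ij\<in>I \<times> I. sm (X (fst ij) (snd ij)) (eu ij)) a b
          = (\<Sum>ij\<in>I \<times> I. if ij = (a, b) then X a b else 0)"
        unfolding sum_fun_apply by (intro sum.cong refl) (auto simp: sm_def eu_def split: prod.splits)
      also have "\<dots> = X a b"
        using X I by (auto simp: supported_def)
      finally show "X a b = (\<Sum>ij\<in>I \<times> I. sm (X (fst ij) (snd ij)) (eu ij)) a b" by simp
    qed
    also have "\<dots> \<in> vs.span B"
      by (intro vs.span_sum vs.span_scale vs.span_base) (auto simp: B_def)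
    finally show ?thesis .
  qed
  define pw where "pw k = poly_mat I M (monom 1 k)" for k
  show ?thesis
  \<comment> \<open>Linear dependence is a property of sets, so coinciding powers are treated apart;
    their difference already gives the polynomial.\<close>
  proof (cases "inj_on pw {..card B}")
    case False
    then obtain k l where kl: "k \<noteq> l" "pw k = pw l" by (auto simp: inj_on_def)
    have "monom 1 k - monom 1 l \<noteq> (0 :: complex poly)"
      using kl(1) by (auto simp: poly_eq_iff coeff_monom)
    moreover have "poly_mat I M (monom 1 k - monom 1 l) = 0"
      using kl(2) by (simp add: poly_mat_diff pw_def)
    ultimately show ?thesis by blast
  next
    case True
    then have "card (pw ` {..card B}) = Suc (card B)" by (simp add: card_image)
    then have "vs.dependent (pw ` {..card B})"
      using vs.independent_span_bound[OF finB, of "pw ` {..card B}"] span poly_mat_supported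
      by (fastforce simp: pw_def)
    then obtain t u where tu: "finite t" "t \<subseteq> pw ` {..card B}" "(\<Sum>v\<in>t. sm (u v) v) = 0" "\<exists>v\<in>t. u v \<noteq> 0"
      unfolding vs.dependent_explicit by blast
    define K where "K = {k \<in> {..card B}. pw k \<in> t}"
    have finK: "finite K" by (simp add: K_def)
    have tK: "t = pw ` K" and inj: "inj_on pw K"
      using tu(2) True by (auto simp: K_def inj_on_def)
    define p where "p = (\<Sum>k\<in>K. monom (u (pw k)) k)"
    have mon: "poly_mat I M (monom c k) = sm c (pw k)" for c k
      unfolding pw_def by (simp add: poly_mat_smult[symmetric] smult_monom)
    have "poly_mat I M p = (\<Sum>k\<in>K. sm (u (pw k)) (pw k))"
      unfolding p_def poly_mat_sum mon ..
    also have "\<dots> = (\<Sum>v\<in>t. sm (u v) v)"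
      unfolding tK by (simp only: sum.reindex[OF inj] o_def)
    finally have "poly_mat I M p = 0" using tu(3) by (simp only:)
    moreover obtain k where k: "k \<in> K" "u (pw k) \<noteq> 0" using tu(4) tK by auto
    have "coeff p k = u (pw k)"
      using k finK by (simp add: p_def coeff_sum coeff_monom)
    then have "p \<noteq> 0" using k by auto
    ultimately show ?thesis by blast
  qed
qed

text \<open>Real coefficients make g(M) Hermitian. If l + 2 were the least positive exponent that
  kills it, the power l + 1 would be a Hermitian matrix with square 0, hence 0, against
  minimality.\<close>

lemma hermitian_nilpotent_pe:
  assumes h: "adj M = M" and g: "map_poly cnj g = g" and n: "poly_mat I M (g ^ n) = 0"
  shows "poly_mat I M g = 0"
proof -
  define m where "m = (LEAST m. poly_mat I M (g ^ Suc m) = 0)"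
  have "poly_mat I M (g ^ Suc n) = 0" using n by (simp add: poly_mat_mult)
  then have m0: "poly_mat I M (g ^ Suc m) = 0" unfolding m_def by (rule LeastI)
  have least: "poly_mat I M (g ^ Suc k) \<noteq> 0" if "k < m" for k
    using that not_less_Least unfolding m_def by blast
  have "poly (map_poly cnj (g ^ k)) = poly (map_poly cnj g ^ k)" for k
    by (intro ext) simp
  then have cg: "map_poly cnj (g ^ k) = g ^ k" for k
    by (simp only: poly_eq_poly_eq_iff g)
  show ?thesis
  proof (cases m)
    case 0
    then show ?thesis using m0 by simp
  next
    case (Suc l)
    have "g ^ Suc l * g ^ Suc l = g ^ Suc m * g ^ l" using Suc by (simp flip: power_add)
    then have "mm I (poly_mat I M (g ^ Suc l)) (poly_mat I M (g ^ Suc l)) = 0"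
      using m0 by (metis mm_zero_left poly_mat_mult)
    then have "poly_mat I M (g ^ Suc l) = 0"
      using mm_adj_self_eq_0[OF I poly_mat_supported] poly_mat_adj[OF h] cg by metis
    with least[of l] Suc show ?thesis by simp
  qed
qed

end

text \<open>The last clause carries the applications: eigenprojections stay inside an algebra that
  is given as a commutant, and spectral projections of a pinched operator commute with the
  projections of the pinching.\<close>

definition spectral :: "'i set \<Rightarrow> ('i \<Rightarrow> 'i \<Rightarrow> complex) \<Rightarrow> real set \<Rightarrow> (real \<Rightarrow> 'i \<Rightarrow> 'i \<Rightarrow> complex) \<Rightarrow> bool" where
  "spectral I M C E \<longleftrightarrow> resol I C E \<and> (\<forall>c\<in>C. E c \<noteq> 0) \<and>
     (\<forall>c\<in>C. \<forall>d\<in>C. c \<noteq> d \<longrightarrow> mm I (E c) (E d) = 0) \<and>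
     M = (\<Sum>c\<in>C. sm (of_real c) (E c)) \<and>
     (\<forall>Y c. supported I Y \<and> mm I M Y = mm I Y M \<and> c \<in> C \<longrightarrow> mm I (E c) Y = mm I Y (E c))"

text \<open>Two polynomials that agree on the roots of a minimal annihilating polynomial take the
  same value at \<open>M\<close>. The Lagrange polynomials at these roots then yield the
  projections, and every relation between projections is checked at the roots. Being polynomials of
  \<open>M\<close>, they commute with whatever commutes with \<open>M\<close>.\<close>

theorem spectral_theorem:
  assumes I: "finite I" and M: "supported I M" and h: "adj M = M"
  shows "\<exists>C E. spectral I M C E"
proof -
  note sup = poly_mat_supported[OF I M] and mult = poly_mat_mult[OF I M]
  define P where "P = (\<lambda>p. p \<noteq> 0 \<and> poly_mat I M p = 0)"
  obtain p where p: "P p" and pmin: "\<And>q. P q \<Longrightarrow> degree p \<le> degree q"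
    using ex_has_least_nat[of P _ degree] annihilating_poly[OF I M] unfolding P_def by metis
  have p0: "p \<noteq> 0" "poly_mat I M p = 0" using p by (auto simp: P_def)
  \<comment> \<open>Dividing the root off a minimal polynomial leaves \<open>q\<close> with q(M)
    \<noteq> 0, and the columns of q(M) are annihilated by M - z. As \<open>M\<close> is Hermitian,
    z is real.\<close>
  have real: "z \<in> \<real>" if z: "poly p z = 0" for z
  proof -
    obtain q where q: "p = [:-z, 1:] * q" using z by (auto simp: poly_eq_0_iff_dvd)
    have "q \<noteq> 0" using q p0 by auto
    then have "degree q < degree p" using degree_mult_eq[of "[:-z, 1:]" q] unfolding q by simp
    then have Y: "poly_mat I M q \<noteq> 0" using pmin[of q] \<open>q \<noteq> 0\<close> by (auto simp: P_def)
    define Y where "Y = poly_mat I M q"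
    have "poly_mat I M [:-z, 1:] = M - sm z (idm I)"
    proof -
      have "[:-z, 1:] = [:0, 1:] - smult z 1" by (simp add: one_pCons)
      then show ?thesis by (simp only: poly_mat_diff poly_mat_smult poly_mat_1 poly_mat_X[OF I M])
    qed
    then have "mm I (M - sm z (idm I)) Y = 0" using p0 q mult[of "[:-z, 1:]" q] by (simp add: Y_def)
    then have MY: "mm I M Y = sm z Y"
      by (simp add: mm_diff_left mm_sm_left mm_idm_left I Y_def sup)
    have 1: "mm I (adj Y) (mm I M Y) = sm z (mm I (adj Y) Y)" by (simp add: MY mm_sm_right)
    have "mm I (adj Y) (mm I M Y) = adj (mm I (adj Y) (mm I M Y))"
      by (simp add: adj_mm h mm_assoc)
    also have "\<dots> = sm (cnj z) (mm I (adj Y) Y)" unfolding 1 by (simp add: adj_sm adj_mm)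
    finally have "sm (z - cnj z) (mm I (adj Y) Y) = 0" using 1 by (simp add: sm_diff)
    then have "\<forall>i j. (z - cnj z) * mm I (adj Y) Y i j = 0" by (metis sm_def zero_fun_apply)
    moreover have "mm I (adj Y) Y \<noteq> 0" using mm_adj_self_eq_0[OF I, of Y] Y sup by (auto simp: Y_def)
    then obtain i j where "mm I (adj Y) Y i j \<noteq> 0" by (metis ext zero_fun_apply)
    ultimately have "z = cnj z" by (metis eq_iff_diff_eq_0 mult_eq_0_iff)
    then show ?thesis by (simp add: Reals_cnj_iff)
  qed
  define C where "C = {c::real. poly p (of_real c) = 0}"
  have finC: "finite C"
  proof -
    have "complex_of_real ` C \<subseteq> {z. poly p z = 0}" by (auto simp: C_def)
    then have "finite (complex_of_real ` C)" using poly_roots_finite[OF p0(1)] finite_subset by blast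
    then show ?thesis by (rule finite_imageD) (auto simp: inj_on_def)
  qed
  \<comment> \<open>The product of \<open>f\<close> with its conjugate has real coefficients. By the
    Nullstellensatz in one variable \<open>p\<close> divides a power of it, so its value at
    \<open>M\<close> is Hermitian and nilpotent, hence 0; this value is also the product of the
    adjoint of f(M) with f(M).\<close>
  have vanish: "poly_mat I M f = 0" if f: "\<And>c. c \<in> C \<Longrightarrow> poly f (of_real c) = 0" for f
  proof -
    have f': "\<forall>z. poly p z = 0 \<longrightarrow> poly f z = 0"
      using f real by (force simp: C_def elim!: Reals_cases)
    define g where "g = map_poly cnj f * f"
    have "\<forall>z. poly p z = 0 \<longrightarrow> poly g z = 0" using f' by (simp add: g_def)
    then have "p dvd g ^ degree p" using nullstellensatz_univariate[of p g] p0 by auto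
    then obtain r where "g ^ degree p = p * r" by auto
    then have gn: "poly_mat I M (g ^ degree p) = 0" by (simp add: mult p0)
    have "poly (map_poly cnj g) = poly g"
      by (intro ext) (simp add: g_def mult.commute)
    then have "map_poly cnj g = g" by (simp only: poly_eq_poly_eq_iff)
    then have "poly_mat I M g = 0" using hermitian_nilpotent_pe[OF I M h _ gn] by blast
    then have "mm I (adj (poly_mat I M f)) (poly_mat I M f) = 0" by (simp add: g_def mult poly_mat_adj[OF I M h])
    then show ?thesis using mm_adj_self_eq_0[OF I sup] by blast
  qed
  have eq: "poly_mat I M f = poly_mat I M g" if "\<And>c. c \<in> C \<Longrightarrow> poly f (of_real c) = poly g (of_real c)" for f g
    using vanish[of "f - g"] that by (simp add: poly_mat_diff)
  define lag where "lag c = (\<Prod>d\<in>C - {c}. smult (1 / of_real (c - d)) [:- complex_of_real d, 1:])" for c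
  have lag: "poly (lag c) (of_real d) = (if d = c then 1 else 0)" if "c \<in> C" "d \<in> C" for c d
    using that finC by (auto simp: lag_def poly_prod intro!: prod.neutral prod_zero simp flip: diff_divide_distrib)
  define E where "E c = poly_mat I M (lag c)" for c
  have mmE: "mm I (E c) (E d) = (if c = d then E c else 0)" if "c \<in> C" "d \<in> C" for c d
  proof -
    have "poly_mat I M (lag c * lag d) = poly_mat I M (if c = d then lag c else 0)"
      by (rule eq) (use that lag in auto)
    then show ?thesis by (simp add: mult E_def split: if_splits)
  qed
  have adjE: "adj (E c) = E c" if "c \<in> C" for c
    unfolding E_def poly_mat_adj[OF I M h] by (rule eq) (use that lag in auto)
  have sumE: "(\<Sum>c\<in>C. E c) = idm I"
  proof -
    have "poly_mat I M (\<Sum>c\<in>C. lag c) = poly_mat I M 1"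
      by (rule eq) (use finC in \<open>simp add: poly_sum lag\<close>)
    then show ?thesis by (simp only: poly_mat_sum poly_mat_1 E_def)
  qed
  have MC: "M = (\<Sum>c\<in>C. sm (of_real c) (E c))"
  proof -
    have "poly_mat I M (\<Sum>c\<in>C. smult (of_real c) (lag c)) = poly_mat I M [:0, 1:]"
      by (rule eq) (use finC in \<open>simp add: poly_sum lag if_distrib cong: if_cong\<close>)
    then show ?thesis by (simp only: poly_mat_sum poly_mat_X[OF I M] E_def poly_mat_smult)
  qed
  \<comment> \<open>Zero projections are removed so that the index set is exactly the set of
    eigenvalues.\<close>
  let ?C = "{c \<in> C. E c \<noteq> 0}"
  have "spectral I M ?C E"
    unfolding spectral_def resol_def proj_def
  proof (intro conjI ballI allI impI)
    show "finite ?C" using finC by simp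
    have "(\<Sum>c\<in>?C. E c) = (\<Sum>c\<in>C. E c)"
      by (intro sum.mono_neutral_left finC) auto
    then show "(\<Sum>c\<in>?C. E c) = idm I" by (simp only: sumE)
    have "(\<Sum>c\<in>?C. sm (of_real c) (E c)) = (\<Sum>c\<in>C. sm (of_real c) (E c))"
      by (intro sum.mono_neutral_left finC) auto
    then show "M = (\<Sum>c\<in>?C. sm (of_real c) (E c))" by (rule trans[OF MC sym])
    fix Y c assume "supported I Y \<and> mm I M Y = mm I Y M \<and> c \<in> ?C"
    then show "mm I (E c) Y = mm I Y (E c)" using poly_mat_commute[OF I M, of Y] by (simp add: E_def)
  qed (use mmE adjE sup in \<open>auto simp: E_def\<close>)
  then show ?thesis by blast
qed

section \<open>Local algebras and local states\<close>

lemma finite_blocks: "finite (blocks ks)"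
proof -
  have "blocks ks \<subseteq> (SIGMA i:{..<length ks}. {..<ks ! i})" by (auto simp: blocks_def)
  then show ?thesis by (rule finite_subset) auto
qed

lemma finite_Conf: "finite T \<Longrightarrow> finite (Conf ks T)"
  unfolding Conf_def by (rule finite_PiE) (auto simp: finite_blocks)

lemma mat_conv:
  "mmul ks T = mm (Conf ks T)" "madj = adj" "mone ks T = idm (Conf ks T)" "mtr ks T = tr (Conf ks T)"
  "msmul = sm" "madd = (+)"
  by (auto simp: fun_eq_iff mmul_def mm_def madj_def adj_def mone_def idm_def mtr_def tr_def
      msmul_def sm_def madd_def mat_app)

lemma mats_supported: "X \<in> mats ks T \<longleftrightarrow> supported (Conf ks T) X"
  by (simp add: mats_def supported_def)

section \<open>The local algebra as a commutant\<close>

definition same_block :: "int set \<Rightarrow> cfg \<Rightarrow> cfg \<Rightarrow> bool" where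
  "same_block T \<sigma> \<tau> \<longleftrightarrow> (\<forall>t\<in>T. fst (\<sigma> t) = fst (\<tau> t))"

lemma same_block_sym: "same_block T \<sigma> \<tau> = same_block T \<tau> \<sigma>"
  by (auto simp: same_block_def)

lemma same_block_trans: "same_block T \<sigma> \<rho> \<Longrightarrow> same_block T \<rho> \<tau> \<Longrightarrow> same_block T \<sigma> \<tau>"
  by (auto simp: same_block_def)

lemma same_block_refl [simp]: "same_block T \<sigma> \<sigma>"
  by (auto simp: same_block_def)

lemma loc_alg_iff: "X \<in> loc_alg ks T \<longleftrightarrow> supported (Conf ks T) X \<and> (\<forall>\<sigma> \<tau>. X \<sigma> \<tau> \<noteq> 0 \<longrightarrow> same_block T \<sigma> \<tau>)"
  by (auto simp: loc_alg_def supported_def same_block_def)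

lemma loc_alg_supported: "X \<in> loc_alg ks T \<Longrightarrow> supported (Conf ks T) X"
  by (simp add: loc_alg_iff)

definition blkproj :: "nat list \<Rightarrow> int set \<Rightarrow> cfg \<Rightarrow> lmat" where
  "blkproj ks T \<kappa> = (\<lambda>\<sigma> \<tau>. if \<sigma> \<in> Conf ks T \<and> \<sigma> = \<tau> \<and> same_block T \<kappa> \<sigma> then 1 else 0)"

lemma blkproj_left:
  "finite T \<Longrightarrow> mm (Conf ks T) (blkproj ks T \<kappa>) X \<sigma> \<tau> = (if \<sigma> \<in> Conf ks T \<and> same_block T \<kappa> \<sigma> then X \<sigma> \<tau> else 0)"
proof -
  assume "finite T"
  have "mm (Conf ks T) (blkproj ks T \<kappa>) X \<sigma> \<tau>
      = (\<Sum>\<rho>\<in>Conf ks T. if \<rho> = \<sigma> then (if \<sigma> \<in> Conf ks T \<and> same_block T \<kappa> \<sigma> then X \<sigma> \<tau> else 0) else 0)"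
    unfolding mm_def blkproj_def by (intro sum.cong) auto
  then show ?thesis using finite_Conf[OF \<open>finite T\<close>, of ks] by simp
qed

lemma blkproj_right:
  "finite T \<Longrightarrow> mm (Conf ks T) X (blkproj ks T \<kappa>) \<sigma> \<tau> = (if \<tau> \<in> Conf ks T \<and> same_block T \<kappa> \<tau> then X \<sigma> \<tau> else 0)"
proof -
  assume "finite T"
  have "mm (Conf ks T) X (blkproj ks T \<kappa>) \<sigma> \<tau>
      = (\<Sum>\<rho>\<in>Conf ks T. if \<rho> = \<tau> then (if \<tau> \<in> Conf ks T \<and> same_block T \<kappa> \<tau> then X \<sigma> \<tau> else 0) else 0)"
    unfolding mm_def blkproj_def by (intro sum.cong) auto
  then show ?thesis using finite_Conf[OF \<open>finite T\<close>, of ks] by simp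
qed

lemma blkproj_supported: "supported (Conf ks T) (blkproj ks T \<kappa>)"
  by (auto simp: supported_def blkproj_def split: if_splits)

text \<open>Commuting with the diagonal projection onto each family of sitewise blocks means that no
  nonzero entry connects two different families. This puts eigenprojections of local elements into
  the local algebra, through the commutation clause of \<open>spectral\<close>.\<close>

lemma loc_alg_commutant:
  assumes "finite T" "supported (Conf ks T) X"
  shows "X \<in> loc_alg ks T \<longleftrightarrow>
    (\<forall>\<kappa>. mm (Conf ks T) X (blkproj ks T \<kappa>) = mm (Conf ks T) (blkproj ks T \<kappa>) X)"
proof
  assume X: "X \<in> loc_alg ks T"
  show "\<forall>\<kappa>. mm (Conf ks T) X (blkproj ks T \<kappa>) = mm (Conf ks T) (blkproj ks T \<kappa>) X"
  proof (intro allI ext)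
    fix \<kappa> \<sigma> \<tau>
    show "mm (Conf ks T) X (blkproj ks T \<kappa>) \<sigma> \<tau> = mm (Conf ks T) (blkproj ks T \<kappa>) X \<sigma> \<tau>"
    proof (cases "X \<sigma> \<tau> = 0")
      case False
      then have "same_block T \<sigma> \<tau>" "\<sigma> \<in> Conf ks T" "\<tau> \<in> Conf ks T"
        using X by (auto simp: loc_alg_iff supported_def)
      moreover from this have "same_block T \<kappa> \<sigma> = same_block T \<kappa> \<tau>" using same_block_trans same_block_sym by metis
      ultimately show ?thesis by (simp add: blkproj_left[OF assms(1)] blkproj_right[OF assms(1)])
    qed (simp add: blkproj_left[OF assms(1)] blkproj_right[OF assms(1)])
  qed
next
  assume a: "\<forall>\<kappa>. mm (Conf ks T) X (blkproj ks T \<kappa>) = mm (Conf ks T) (blkproj ks T \<kappa>) X"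
  have "same_block T \<sigma> \<tau>" if nz: "X \<sigma> \<tau> \<noteq> 0" for \<sigma> \<tau>
  proof -
    have "mm (Conf ks T) X (blkproj ks T \<sigma>) \<sigma> \<tau> = mm (Conf ks T) (blkproj ks T \<sigma>) X \<sigma> \<tau>"
      using a by simp
    then show ?thesis
      using nz assms by (auto simp: blkproj_left blkproj_right supported_def split: if_splits)
  qed
  then show "X \<in> loc_alg ks T" using assms(2) by (simp add: loc_alg_iff)
qed

lemma loc_alg_add [intro]: "X \<in> loc_alg ks T \<Longrightarrow> Y \<in> loc_alg ks T \<Longrightarrow> X + Y \<in> loc_alg ks T"
  unfolding loc_alg_iff by (auto simp: mat_app) (metis add_0)
lemma loc_alg_diff [intro]: "X \<in> loc_alg ks T \<Longrightarrow> Y \<in> loc_alg ks T \<Longrightarrow> X - Y \<in> loc_alg ks T"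
  unfolding loc_alg_iff by (auto simp: mat_app) (metis diff_0_right)
lemma loc_alg_sm [intro]: "X \<in> loc_alg ks T \<Longrightarrow> sm c X \<in> loc_alg ks T"
  unfolding loc_alg_iff using supported_sm by (auto simp: sm_def)
lemma loc_alg_zero [simp, intro]: "0 \<in> loc_alg ks T"
  unfolding loc_alg_iff by (auto simp: mat_app)
lemma loc_alg_sum [intro]: "(\<And>j. j \<in> J \<Longrightarrow> F j \<in> loc_alg ks T) \<Longrightarrow> (\<Sum>j\<in>J. F j) \<in> loc_alg ks T"
  by (induction J rule: infinite_finite_induct) auto
lemma loc_alg_idm [simp, intro]: "idm (Conf ks T) \<in> loc_alg ks T"
  unfolding loc_alg_iff using supported_idm by (auto simp: idm_def)
lemma loc_alg_adj [intro]: "X \<in> loc_alg ks T \<Longrightarrow> adj X \<in> loc_alg ks T"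
  unfolding loc_alg_iff using supported_adj same_block_sym by (auto simp: adj_def) blast
lemma loc_alg_mm [intro]:
  assumes "X \<in> loc_alg ks T" "Y \<in> loc_alg ks T"
  shows "mm (Conf ks T) X Y \<in> loc_alg ks T"
  unfolding loc_alg_iff
proof (intro conjI allI impI)
  show "supported (Conf ks T) (mm (Conf ks T) X Y)" using assms by (auto simp: loc_alg_iff)
  fix \<sigma> \<tau> assume "mm (Conf ks T) X Y \<sigma> \<tau> \<noteq> 0"
  then obtain \<rho> where "X \<sigma> \<rho> * Y \<rho> \<tau> \<noteq> 0" unfolding mm_def by (meson sum.neutral)
  then have "same_block T \<sigma> \<rho>" "same_block T \<rho> \<tau>" using assms by (auto simp: loc_alg_iff)
  then show "same_block T \<sigma> \<tau>" by (rule same_block_trans)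
qed

lemma spectral_loc_alg:
  assumes "finite T" "M \<in> loc_alg ks T" "spectral (Conf ks T) M C E" "c \<in> C"
  shows "E c \<in> loc_alg ks T"
proof -
  have "supported (Conf ks T) (E c)" using assms(3,4) by (auto simp: spectral_def resol_def proj_def)
  moreover have "mm (Conf ks T) (E c) (blkproj ks T \<kappa>) = mm (Conf ks T) (blkproj ks T \<kappa>) (E c)" for \<kappa>
    using assms loc_alg_commutant[OF assms(1) loc_alg_supported[OF assms(2)]] blkproj_supported
    unfolding spectral_def by blast
  ultimately show ?thesis using loc_alg_commutant[OF assms(1)] by blast
qed

section \<open>Densities of local states\<close>

context
  fixes ks :: "nat list" and T :: "int set" and \<omega> :: "lmat \<Rightarrow> complex"
  assumes T: "finite T" and st: "is_local_state ks T \<omega>"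
begin

lemma finI: "finite (Conf ks T)" by (rule finite_Conf[OF T])

lemma state_add: "X \<in> loc_alg ks T \<Longrightarrow> Y \<in> loc_alg ks T \<Longrightarrow> \<omega> (X + Y) = \<omega> X + \<omega> Y"
  using st by (simp add: is_local_state_def mat_conv)
lemma state_sm: "X \<in> loc_alg ks T \<Longrightarrow> \<omega> (sm c X) = c * \<omega> X"
  using st by (simp add: is_local_state_def mat_conv)
lemma state_pos: "X \<in> loc_alg ks T \<Longrightarrow> Im (\<omega> (mm (Conf ks T) (adj X) X)) = 0"
    "X \<in> loc_alg ks T \<Longrightarrow> 0 \<le> Re (\<omega> (mm (Conf ks T) (adj X) X))"
  using st by (simp_all add: is_local_state_def mat_conv)
lemma state_one: "\<omega> (idm (Conf ks T)) = 1"
  using st by (simp add: is_local_state_def mat_conv)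
lemma state_zero: "\<omega> 0 = 0"
  using state_sm[of 0 0] by simp
lemma state_sum: "(\<And>j. j \<in> J \<Longrightarrow> F j \<in> loc_alg ks T) \<Longrightarrow> \<omega> (\<Sum>j\<in>J. F j) = (\<Sum>j\<in>J. \<omega> (F j))"
  by (induction J rule: infinite_finite_induct) (simp_all add: state_zero state_add loc_alg_sum)
lemma state_diff: "X \<in> loc_alg ks T \<Longrightarrow> Y \<in> loc_alg ks T \<Longrightarrow> \<omega> (X - Y) = \<omega> X - \<omega> Y"
  using state_add[of "X - Y" Y] loc_alg_diff[of X ks T Y] by simp

text \<open>Positivity at 1 + c X forces c \<omega>(X) + cnj c \<omega>(\<open>adj X\<close>) to be
  real for every complex c; c = 1 and c = \<i> determine the value at the adjoint.\<close>

lemma state_adj: assumes X: "X \<in> loc_alg ks T" shows "\<omega> (adj X) = cnj (\<omega> X)"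
proof -
  have *: "\<omega> (mm (Conf ks T) (adj (idm (Conf ks T) + sm c X)) (idm (Conf ks T) + sm c X))
      = 1 + c * \<omega> X + cnj c * \<omega> (adj X) + \<omega> (mm (Conf ks T) (adj (sm c X)) (sm c X))" for c
  proof -
    have "mm (Conf ks T) (adj (idm (Conf ks T) + sm c X)) (idm (Conf ks T) + sm c X)
        = idm (Conf ks T) + sm c X + sm (cnj c) (adj X) + mm (Conf ks T) (adj (sm c X)) (sm c X)"
      using X loc_alg_supported
      by (simp add: adj_add mm_add_left mm_add_right mm_idm_left mm_idm_right finI supported_sm supported_adj adj_sm
          mm_sm_left mm_sm_right sm_add add.assoc)
    then show ?thesis using X by (simp add: state_add state_sm state_one loc_alg_add loc_alg_sm loc_alg_adj loc_alg_mm)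
  qed
  have "Im (c * \<omega> X + cnj c * \<omega> (adj X)) = 0" for c
    using arg_cong[OF *[of c], of Im] X state_pos(1)[of "idm (Conf ks T) + sm c X"] state_pos(1)[of "sm c X"]
    by (auto simp: loc_alg_sm loc_alg_add)
  from this[of 1] this[of \<i>] show ?thesis by (simp add: complex_eq_iff)
qed

lemma density_unique:
  assumes D: "D \<in> loc_alg ks T" "D' \<in> loc_alg ks T"
    and eq: "\<And>X. X \<in> loc_alg ks T \<Longrightarrow> tr (Conf ks T) (mm (Conf ks T) D X) = tr (Conf ks T) (mm (Conf ks T) D' X)"
  shows "D = D'"
proof -
  have "tr (Conf ks T) (mm (Conf ks T) (D - D') (adj (D - D'))) = 0"
    using eq[of "adj (D - D')"] D by (simp add: mm_diff_left tr_diff loc_alg_diff loc_alg_adj)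
  then have "hs (Conf ks T) (D - D') = 0" by (simp add: hs_eq tr_mm_commute)
  moreover have "supported (Conf ks T) (D - D')" using D by (auto simp: loc_alg_iff)
  ultimately have "D - D' = 0" using hs_eq_0[OF finI] by blast
  then show ?thesis by simp
qed

lemma density_exists:
  "\<exists>D\<in>loc_alg ks T. \<forall>X\<in>loc_alg ks T. \<omega> X = tr (Conf ks T) (mm (Conf ks T) D X)"
proof -
  define eu :: "cfg \<Rightarrow> cfg \<Rightarrow> lmat" where "eu \<sigma> \<tau> = (\<lambda>a b. if a = \<sigma> \<and> b = \<tau> then 1 else 0)" for \<sigma> \<tau>
  \<comment> \<open>The indices are transposed because Tr (D X) pairs the entry (\<tau>, \<sigma>)
    of D with the entry (\<sigma>, \<tau>) of X. Only matrix units within one family of blocks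
    belong to the algebra.\<close>
  define D where "D = (\<lambda>\<sigma> \<tau>. if \<sigma> \<in> (Conf ks T) \<and> \<tau> \<in> (Conf ks T) \<and> same_block T \<sigma> \<tau> then \<omega> (eu \<tau> \<sigma>) else 0)"
  have eu: "eu \<sigma> \<tau> \<in> loc_alg ks T" if "\<sigma> \<in> (Conf ks T)" "\<tau> \<in> (Conf ks T)" "same_block T \<sigma> \<tau>" for \<sigma> \<tau>
    using that by (auto simp: loc_alg_iff supported_def eu_def)
  have "D \<in> loc_alg ks T"
    unfolding loc_alg_iff supported_def D_def by (auto split: if_splits)
  moreover have "\<omega> X = tr (Conf ks T) (mm (Conf ks T) D X)" if X: "X \<in> loc_alg ks T" for X
  proof -
    define S where "S = {(\<sigma>, \<tau>) \<in> (Conf ks T) \<times> (Conf ks T). same_block T \<sigma> \<tau>}"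
    have finS: "finite S" unfolding S_def by (rule finite_subset[of _ "(Conf ks T) \<times> (Conf ks T)"]) (auto simp: finI)
    have "X = (\<Sum>p\<in>S. sm (X (fst p) (snd p)) (eu (fst p) (snd p)))"
    proof (intro ext)
      fix a b
      have "(\<Sum>p\<in>S. sm (X (fst p) (snd p)) (eu (fst p) (snd p))) a b = (\<Sum>p\<in>S. if p = (a, b) then X a b else 0)"
        unfolding sum_fun_apply by (intro sum.cong refl) (auto simp: sm_def eu_def)
      also have "\<dots> = X a b"
        using X finS by (auto simp: S_def loc_alg_iff supported_def)
      finally show "X a b = (\<Sum>p\<in>S. sm (X (fst p) (snd p)) (eu (fst p) (snd p))) a b" by simp
    qed
    then have "\<omega> X = \<omega> (\<Sum>p\<in>S. sm (X (fst p) (snd p)) (eu (fst p) (snd p)))" by (rule arg_cong)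
    also have "\<dots> = (\<Sum>p\<in>S. \<omega> (sm (X (fst p) (snd p)) (eu (fst p) (snd p))))"
      by (rule state_sum) (auto simp: S_def intro!: loc_alg_sm eu)
    also have "\<dots> = (\<Sum>p\<in>S. X (fst p) (snd p) * D (snd p) (fst p))"
      by (intro sum.cong refl) (auto simp: S_def state_sm eu D_def same_block_sym)
    also have "\<dots> = (\<Sum>p\<in>(Conf ks T) \<times> (Conf ks T). X (fst p) (snd p) * D (snd p) (fst p))"
      by (rule sum.mono_neutral_left) (auto simp: S_def finI D_def same_block_sym)
    also have "\<dots> = tr (Conf ks T) (mm (Conf ks T) X D)"
      by (simp add: tr_def mm_def sum.cartesian_product case_prod_beta)
    finally show ?thesis by (simp only: tr_mm_commute)
  qed
  ultimately show ?thesis by blast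
qed

lemma density_props:
  "density ks T \<omega> \<in> loc_alg ks T"
  "X \<in> loc_alg ks T \<Longrightarrow> \<omega> X = tr (Conf ks T) (mm (Conf ks T) (density ks T \<omega>) X)"
proof -
  obtain D where D: "D \<in> loc_alg ks T" "\<forall>X\<in>loc_alg ks T. \<omega> X = tr (Conf ks T) (mm (Conf ks T) D X)"
    using density_exists by blast
  have "density ks T \<omega> = D"
    unfolding density_def mat_conv
  proof (rule the_equality)
    fix D' assume D': "D' \<in> loc_alg ks T \<and> (\<forall>X\<in>loc_alg ks T. \<omega> X = tr (Conf ks T) (mm (Conf ks T) D' X))"
    show "D' = D" by (rule density_unique) (use D D' in auto)
  qed (use D in auto)
  then show "density ks T \<omega> \<in> loc_alg ks T"
    "X \<in> loc_alg ks T \<Longrightarrow> \<omega> X = tr (Conf ks T) (mm (Conf ks T) (density ks T \<omega>) X)"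
    using D by auto
qed

lemma density_hermitian: "adj (density ks T \<omega>) = density ks T \<omega>"
proof (rule density_unique)
  let ?D = "density ks T \<omega>"
  fix X assume X: "X \<in> loc_alg ks T"
  have tra: "tr (Conf ks T) (adj Y) = cnj (tr (Conf ks T) Y)" for Y by (simp add: tr_def adj_def)
  have "tr (Conf ks T) (mm (Conf ks T) (adj ?D) X) = cnj (tr (Conf ks T) (mm (Conf ks T) (adj X) ?D))"
    by (simp flip: tra add: adj_mm)
  also have "\<dots> = cnj (\<omega> (adj X))"
    using density_props(2)[OF loc_alg_adj[OF X]] by (simp add: tr_mm_commute)
  also have "\<dots> = tr (Conf ks T) (mm (Conf ks T) ?D X)" using X by (simp add: state_adj density_props(2))
  finally show "tr (Conf ks T) (mm (Conf ks T) (adj ?D) X) = tr (Conf ks T) (mm (Conf ks T) ?D X)" .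
qed (auto simp: density_props(1) intro: loc_alg_adj)

end

text \<open>All that the later estimates use of a local state. The kernel of the density is included
  as the eigenvalue 0, so \<open>E\<close> resolves the whole identity.\<close>

definition sdata :: "nat list \<Rightarrow> int set \<Rightarrow> (lmat \<Rightarrow> complex) \<Rightarrow> real set \<Rightarrow> (real \<Rightarrow> lmat) \<Rightarrow> bool" where
  "sdata ks T \<omega> C E \<longleftrightarrow> spectral (Conf ks T) (density ks T \<omega>) C E \<and>
     (\<forall>c\<in>C. E c \<in> loc_alg ks T \<and> 0 \<le> c \<and> c \<le> 1) \<and>
     (\<Sum>c\<in>C. c * hs (Conf ks T) (E c)) = 1 \<and>
     (\<forall>X\<in>loc_alg ks T. \<omega> X = (\<Sum>c\<in>C. of_real c * tr (Conf ks T) (mm (Conf ks T) (E c) X)))"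

text \<open>The value of the state at \<open>E c\<close> is c times the rank of \<open>E c\<close>.
  Positivity of the state gives 0 \<le> c; the rank is at least 1 and the total mass is 1, which
  gives c \<le> 1. The upper bound is what allows the bins of eigenvalues to start at 1.\<close>

lemma sdata_exists:
  assumes T: "finite T" and st: "is_local_state ks T \<omega>"
  shows "\<exists>C E. sdata ks T \<omega> C E"
proof -
  let ?I = "Conf ks T" and ?D = "density ks T \<omega>"
  note D = density_props[OF T st]
  obtain C E where CE: "spectral ?I ?D C E"
    using spectral_theorem[OF finite_Conf[OF T] loc_alg_supported[OF D(1)] density_hermitian[OF T st]] by blast
  have finC: "finite C" and pr: "\<And>c. c \<in> C \<Longrightarrow> proj ?I (E c)"
    using CE by (auto simp: spectral_def resol_def)
  have loc: "E c \<in> loc_alg ks T" if "c \<in> C" for c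
    using spectral_loc_alg[OF T D(1) CE that] .
  have \<omega>: "\<omega> X = (\<Sum>c\<in>C. of_real c * tr ?I (mm ?I (E c) X))" if "X \<in> loc_alg ks T" for X
  proof -
    have "\<omega> X = tr ?I (mm ?I (\<Sum>c\<in>C. sm (of_real c) (E c)) X)"
      using D(2)[OF that] CE unfolding spectral_def by metis
    then show ?thesis by (simp only: mm_sum_left tr_sum mm_sm_left tr_sm)
  qed
  have \<omega>E: "\<omega> (E c) = of_real (c * hs ?I (E c))" if c: "c \<in> C" for c
  proof -
    have "\<omega> (E c) = (\<Sum>d\<in>C. of_real d * tr ?I (mm ?I (E d) (E c)))" by (rule \<omega>[OF loc[OF c]])
    also have "\<dots> = (\<Sum>d\<in>C. if d = c then of_real (c * hs ?I (E c)) else 0)"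
    proof (rule sum.cong[OF refl])
      fix d assume d: "d \<in> C"
      show "complex_of_real d * tr ?I (mm ?I (E d) (E c)) = (if d = c then of_real (c * hs ?I (E c)) else 0)"
      proof (cases "d = c")
        case True
        then show ?thesis using projD(2)[OF pr[OF c]] proj_tr[OF pr[OF c]] by simp
      next
        case False
        then have "mm ?I (E d) (E c) = 0" using CE c d by (simp add: spectral_def)
        then show ?thesis using False by simp
      qed
    qed
    finally show ?thesis using finC c by simp
  qed
  have hs1: "1 \<le> hs ?I (E c)" if c: "c \<in> C" for c
    using proj_hs_ge_1[OF finite_Conf[OF T] pr[OF c]] CE c by (auto simp: spectral_def)
  have nn: "0 \<le> c" if c: "c \<in> C" for c
  proof -
    have "0 \<le> Re (\<omega> (E c))"
      using state_pos(2)[OF T st loc[OF c]] projD[OF pr[OF c]] by simp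
    then have "0 \<le> c * hs ?I (E c)" using \<omega>E[OF c] by simp
    then show ?thesis using hs1[OF c] by (simp add: zero_le_mult_iff)
  qed
  have "1 = \<omega> (\<Sum>c\<in>C. E c)"
    using CE state_one[OF T st] unfolding spectral_def resol_def by metis
  also have "\<dots> = (\<Sum>c\<in>C. of_real (c * hs ?I (E c)))"
    using state_sum[OF T st, of C E] loc \<omega>E by simp
  finally have "complex_of_real (\<Sum>c\<in>C. c * hs ?I (E c)) = of_real 1" by simp
  then have s1: "(\<Sum>c\<in>C. c * hs ?I (E c)) = 1" by (simp only: of_real_eq_iff)
  have "c \<le> 1" if c: "c \<in> C" for c
  proof -
    have "c * 1 \<le> c * hs ?I (E c)" using nn[OF c] hs1[OF c] by (intro mult_left_mono)
    also have "\<dots> \<le> (\<Sum>c\<in>C. c * hs ?I (E c))"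
      using finC c nn by (intro member_le_sum) auto
    finally show ?thesis using s1 by simp
  qed
  then show ?thesis unfolding sdata_def using CE loc nn s1 \<omega> by blast
qed

lemma sdata_resol: "sdata ks T \<omega> C E \<Longrightarrow> resol (Conf ks T) C E"
  by (simp add: sdata_def spectral_def)

lemma sdata_adj_mm:
  assumes T: "finite T" and s: "sdata ks T \<omega> C E" and X: "X \<in> loc_alg ks T"
  shows "Re (\<omega> (mm (Conf ks T) (adj X) X)) = (\<Sum>c\<in>C. c * hs (Conf ks T) (mm (Conf ks T) X (E c)))"
proof -
  let ?I = "Conf ks T"
  have pr: "\<And>c. c \<in> C \<Longrightarrow> proj ?I (E c)" using sdata_resol[OF s] by (auto simp: resol_def)
  have "\<omega> (mm ?I (adj X) X) = (\<Sum>c\<in>C. of_real c * tr ?I (mm ?I (E c) (mm ?I (adj X) X)))"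
    using s X unfolding sdata_def by (blast intro: loc_alg_mm loc_alg_adj)
  then show ?thesis by (simp add: hs_proj_right pr tr_mm_commute[of _ "E _"])
qed

lemma sdata_proj:
  assumes T: "finite T" and s: "sdata ks T \<omega> C E" and q: "proj (Conf ks T) q" "q \<in> loc_alg ks T"
  shows "Re (\<omega> q) = (\<Sum>c\<in>C. c * hs (Conf ks T) (mm (Conf ks T) q (E c)))"
  using sdata_adj_mm[OF T s q(2)] projD[OF q(1)] by simp

lemma sdata_proj':
  assumes T: "finite T" and s: "sdata ks T \<omega> C E" and q: "proj (Conf ks T) q" "q \<in> loc_alg ks T"
  shows "Re (\<omega> q) = (\<Sum>c\<in>C. c * hs (Conf ks T) (mm (Conf ks T) (E c) q))"
proof -
  have "hs (Conf ks T) (mm (Conf ks T) q (E c)) = hs (Conf ks T) (mm (Conf ks T) (E c) q)" if "c \<in> C" for c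
  proof -
    have "proj (Conf ks T) (E c)" using sdata_resol[OF s] that by (simp add: resol_def)
    then show ?thesis
      using hs_adj[of "Conf ks T" "mm (Conf ks T) q (E c)"] projD(3)[OF q(1)] by (simp add: adj_mm projD(3))
  qed
  then show ?thesis using sdata_proj[OF assms] by simp
qed

section \<open>Relative entropy in terms of spectral data\<close>

lemma mulv_entry: "\<sigma> \<in> Conf ks T \<Longrightarrow> mulv ks T X v \<sigma> = (\<Sum>\<rho>\<in>Conf ks T. X \<sigma> \<rho> * v \<rho>)"
  by (simp add: mulv_def)

lemma mulv_vecs: "mulv ks T X v \<in> vecs ks T"
  by (simp add: mulv_def vecs_def)

lemma mulv_mm: "mulv ks T (mm (Conf ks T) X Y) v = mulv ks T X (mulv ks T Y v)"
proof (intro ext)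
  fix \<sigma>
  show "mulv ks T (mm (Conf ks T) X Y) v \<sigma> = mulv ks T X (mulv ks T Y v) \<sigma>"
  proof (cases "\<sigma> \<in> Conf ks T")
    case True
    have "mulv ks T (mm (Conf ks T) X Y) v \<sigma> = (\<Sum>\<rho>\<in>Conf ks T. \<Sum>l\<in>Conf ks T. X \<sigma> l * Y l \<rho> * v \<rho>)"
      using True by (simp only: mulv_entry mm_def sum_distrib_right)
    also have "\<dots> = (\<Sum>l\<in>Conf ks T. \<Sum>\<rho>\<in>Conf ks T. X \<sigma> l * Y l \<rho> * v \<rho>)"
      by (rule sum.swap)
    also have "\<dots> = (\<Sum>l\<in>Conf ks T. X \<sigma> l * mulv ks T Y v l)"
      by (intro sum.cong refl) (simp add: mulv_entry sum_distrib_left mult.assoc)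
    finally show ?thesis using True by (simp add: mulv_entry)
  qed (simp add: mulv_def)
qed

lemma mulv_idm: "finite T \<Longrightarrow> v \<in> vecs ks T \<Longrightarrow> mulv ks T (idm (Conf ks T)) v = v"
proof (intro ext)
  fix \<sigma> assume a: "finite T" "v \<in> vecs ks T"
  have "(\<Sum>\<rho>\<in>Conf ks T. idm (Conf ks T) \<sigma> \<rho> * v \<rho>) = (\<Sum>\<rho>\<in>Conf ks T. if \<rho> = \<sigma> then v \<rho> else 0)"
    if "\<sigma> \<in> Conf ks T"
    using that by (intro sum.cong) (auto simp: idm_def)
  then show "mulv ks T (idm (Conf ks T)) v \<sigma> = v \<sigma>"
    using a finite_Conf[OF a(1), of ks] by (simp add: mulv_def vecs_def)
qed

lemma mulv_sum: "mulv ks T (\<Sum>j\<in>J. F j) v = (\<lambda>\<sigma>. \<Sum>j\<in>J. mulv ks T (F j) v \<sigma>)"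
  by (intro ext) (simp add: mulv_def sum_fun_apply sum_distrib_right sum.swap[of _ J "Conf ks T"])

lemma mulv_sm: "mulv ks T (sm c X) v = (\<lambda>\<sigma>. c * mulv ks T X v \<sigma>)"
  by (intro ext) (simp add: mulv_def sm_def sum_distrib_left mult.assoc)

lemma mulv_scale: "mulv ks T X (\<lambda>\<sigma>. c * v \<sigma>) = (\<lambda>\<sigma>. c * mulv ks T X v \<sigma>)"
  by (intro ext) (simp add: mulv_def sum_distrib_left mult.left_commute)

lemma mulv_zero: "mulv ks T 0 v = (\<lambda>_. 0)"
  by (intro ext) (simp add: mulv_def mat_app)

definition unitv :: "cfg \<Rightarrow> lvec" where "unitv \<tau> = (\<lambda>\<sigma>. if \<sigma> = \<tau> then 1 else 0)"

lemma unitv_vecs: "\<tau> \<in> Conf ks T \<Longrightarrow> unitv \<tau> \<in> vecs ks T"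
  by (auto simp: unitv_def vecs_def)

lemma mulv_unitv:
  assumes "finite T" "supported (Conf ks T) X" "\<tau> \<in> Conf ks T"
  shows "mulv ks T X (unitv \<tau>) = (\<lambda>\<sigma>. X \<sigma> \<tau>)"
proof (intro ext)
  fix \<sigma>
  have "(\<Sum>\<rho>\<in>Conf ks T. X \<sigma> \<rho> * unitv \<tau> \<rho>) = (\<Sum>\<rho>\<in>Conf ks T. if \<rho> = \<tau> then X \<sigma> \<tau> else 0)"
    by (intro sum.cong) (auto simp: unitv_def)
  then show "mulv ks T X (unitv \<tau>) \<sigma> = X \<sigma> \<tau>"
    using assms finite_Conf[OF assms(1), of ks] by (auto simp: mulv_def supported_def)
qed

lemma supported_eqI:
  assumes "finite T" "supported (Conf ks T) X" "supported (Conf ks T) Y"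
    and "\<And>\<tau>. \<tau> \<in> Conf ks T \<Longrightarrow> mulv ks T X (unitv \<tau>) = mulv ks T Y (unitv \<tau>)"
  shows "X = Y"
proof (intro ext)
  fix \<sigma> \<tau>
  show "X \<sigma> \<tau> = Y \<sigma> \<tau>"
  proof (cases "\<tau> \<in> Conf ks T")
    case True
    then show ?thesis using assms(4)[OF True] by (simp add: mulv_unitv assms fun_eq_iff)
  next
    case False
    then show ?thesis using assms(2,3) unfolding supported_def by metis
  qed
qed

text \<open>If the range of B lies in that of A, then A B = B. Both inclusions together with an
  adjoint give P = Q. This resolves the definite description in \<open>eigproj\<close>.\<close>

lemma proj_range_unique:
  assumes T: "finite T" and P: "proj (Conf ks T) P" and Q: "proj (Conf ks T) Q"
    and sub: "{mulv ks T P w | w. w \<in> vecs ks T} = {mulv ks T Q w | w. w \<in> vecs ks T}"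
  shows "P = Q"
proof -
  let ?I = "Conf ks T"
  have *: "mm ?I A B = B" if A: "proj ?I A" and B: "proj ?I B"
    and s: "{mulv ks T B w | w. w \<in> vecs ks T} \<subseteq> {mulv ks T A w | w. w \<in> vecs ks T}" for A B
  proof (rule supported_eqI[OF T])
    fix \<tau> assume "\<tau> \<in> ?I"
    then have "mulv ks T B (unitv \<tau>) \<in> {mulv ks T A w | w. w \<in> vecs ks T}"
      using s unitv_vecs by blast
    then obtain w where w: "mulv ks T B (unitv \<tau>) = mulv ks T A w" by auto
    show "mulv ks T (mm ?I A B) (unitv \<tau>) = mulv ks T B (unitv \<tau>)"
      unfolding mulv_mm w by (simp add: projD(2)[OF A] flip: mulv_mm)
  qed (use A B in \<open>auto simp: projD(1)\<close>)
  have "Q = adj (mm ?I P Q)" using *[OF P Q] sub projD(3)[OF Q] by simp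
  also have "\<dots> = mm ?I Q P" by (simp add: adj_mm projD(3)[OF P] projD(3)[OF Q])
  also have "\<dots> = P" using *[OF Q P] sub by simp
  finally show ?thesis by simp
qed

section \<open>The functional calculus in terms of a spectral decomposition\<close>

context
  fixes ks :: "nat list" and T :: "int set" and D :: lmat and C :: "real set" and E :: "real \<Rightarrow> lmat"
  assumes T: "finite T" and sp: "spectral (Conf ks T) D C E"
begin

lemma spectral_pr: "c \<in> C \<Longrightarrow> proj (Conf ks T) (E c)" and spectral_fin: "finite C"
  using sp by (auto simp: spectral_def resol_def)

lemma spectral_mm: "c \<in> C \<Longrightarrow> d \<in> C \<Longrightarrow> mm (Conf ks T) (E c) (E d) = (if c = d then E c else 0)"
  using sp spectral_pr by (auto simp: spectral_def projD(2))

lemma spectral_eq: "D = (\<Sum>c\<in>C. sm (of_real c) (E c))"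
  using sp by (simp add: spectral_def)

lemma spectral_mm_D: assumes c: "c \<in> C" shows "mm (Conf ks T) (E c) D = sm (of_real c) (E c)"
    "mm (Conf ks T) D (E c) = sm (of_real c) (E c)"
proof -
  have "mm (Conf ks T) (E c) D = (\<Sum>d\<in>C. sm (of_real d) (mm (Conf ks T) (E c) (E d)))"
    by (subst spectral_eq) (simp only: mm_sum_right mm_sm_right)
  also have "\<dots> = (\<Sum>d\<in>C. if d = c then sm (of_real c) (E c) else 0)"
    using c by (intro sum.cong) (auto simp: spectral_mm)
  finally show "mm (Conf ks T) (E c) D = sm (of_real c) (E c)" using c spectral_fin by simp
  have "mm (Conf ks T) D (E c) = (\<Sum>d\<in>C. sm (of_real d) (mm (Conf ks T) (E d) (E c)))"
    by (subst spectral_eq) (simp only: mm_sum_left mm_sm_left)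
  also have "\<dots> = (\<Sum>d\<in>C. if d = c then sm (of_real c) (E c) else 0)"
    using c by (intro sum.cong) (auto simp: spectral_mm)
  finally show "mm (Conf ks T) D (E c) = sm (of_real c) (E c)" using c spectral_fin by simp
qed

lemma eigspace_comp:
  assumes v: "v \<in> eigspace ks T D z" and c: "c \<in> C" "complex_of_real c \<noteq> z"
  shows "mulv ks T (E c) v = (\<lambda>_. 0)"
proof
  fix \<sigma>
  have "mulv ks T (mm (Conf ks T) (E c) D) v = (\<lambda>\<sigma>. z * mulv ks T (E c) v \<sigma>)"
    using v by (simp add: mulv_mm eigspace_def mulv_scale)
  then have "of_real c * mulv ks T (E c) v \<sigma> = z * mulv ks T (E c) v \<sigma>"
    by (simp add: spectral_mm_D c mulv_sm fun_eq_iff)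
  then show "mulv ks T (E c) v \<sigma> = 0" using c by simp
qed

lemma vec_decomp: "v \<in> vecs ks T \<Longrightarrow> v = (\<lambda>\<sigma>. \<Sum>c\<in>C. mulv ks T (E c) v \<sigma>)"
proof -
  assume v: "v \<in> vecs ks T"
  have "v = mulv ks T (\<Sum>c\<in>C. E c) v"
    using mulv_idm[OF T v] sp by (simp add: spectral_def resol_def)
  then show ?thesis by (simp only: mulv_sum)
qed

lemma eigspace_eq:
  assumes c: "c \<in> C"
  shows "eigspace ks T D (of_real c) = {mulv ks T (E c) w | w. w \<in> vecs ks T}"
proof (intro equalityI subsetI)
  fix v assume v: "v \<in> eigspace ks T D (of_real c)"
  then have vv: "v \<in> vecs ks T" by (simp add: eigspace_def)
  have "(\<Sum>d\<in>C. mulv ks T (E d) v \<sigma>) = (\<Sum>d\<in>C. if d = c then mulv ks T (E c) v \<sigma> else 0)" for \<sigma>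
    by (intro sum.cong) (auto simp: eigspace_comp[OF v])
  then have "v = mulv ks T (E c) v" using vec_decomp[OF vv] c spectral_fin by simp
  then show "v \<in> {mulv ks T (E c) w | w. w \<in> vecs ks T}" using vv by blast
next
  fix v assume "v \<in> {mulv ks T (E c) w | w. w \<in> vecs ks T}"
  then obtain w where "v = mulv ks T (E c) w" by blast
  then show "v \<in> eigspace ks T D (of_real c)"
    by (simp add: eigspace_def mulv_vecs spectral_mm_D c mulv_sm flip: mulv_mm)
qed

lemma eigvals_eq: "eigvals ks T D = complex_of_real ` C"
proof (intro equalityI subsetI)
  fix z assume "z \<in> eigvals ks T D"
  then obtain v where v: "v \<in> eigspace ks T D z" "v \<noteq> (\<lambda>_. 0)" by (auto simp: eigvals_def)
  show "z \<in> complex_of_real ` C"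
  proof (rule ccontr)
    assume "z \<notin> complex_of_real ` C"
    then have "mulv ks T (E c) v = (\<lambda>_. 0)" if "c \<in> C" for c
      using eigspace_comp[OF v(1) that] that by blast
    then have "v = (\<lambda>_. 0)"
      using vec_decomp[of v] v(1) by (simp add: eigspace_def)
    with v show False by blast
  qed
next
  fix z assume "z \<in> complex_of_real ` C"
  then obtain c where c: "c \<in> C" "z = of_real c" by auto
  have "E c \<noteq> 0" using sp c by (simp add: spectral_def)
  then have "\<exists>\<tau>\<in>Conf ks T. mulv ks T (E c) (unitv \<tau>) \<noteq> mulv ks T 0 (unitv \<tau>)"
    using supported_eqI[OF T projD(1)[OF spectral_pr[OF c(1)]] supported_zero] by blast
  then obtain \<tau> where \<tau>: "\<tau> \<in> Conf ks T" "mulv ks T (E c) (unitv \<tau>) \<noteq> (\<lambda>_. 0)" by (auto simp: mulv_zero)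
  moreover have "mulv ks T (E c) (unitv \<tau>) \<in> eigspace ks T D z"
    using eigspace_eq[OF c(1)] unitv_vecs[OF \<tau>(1)] c(2) by blast
  ultimately show "z \<in> eigvals ks T D" by (auto simp: eigvals_def)
qed

lemma eigproj_eq: assumes c: "c \<in> C" shows "eigproj ks T D (of_real c) = E c"
  unfolding eigproj_def
proof (rule the_equality)
  have conv: "is_orth_proj ks T P \<longleftrightarrow> proj (Conf ks T) P" for P
    by (simp add: is_orth_proj_def proj_def mats_supported mat_conv)
  show "is_orth_proj ks T (E c) \<and> {mulv ks T (E c) w | w. w \<in> vecs ks T} = eigspace ks T D (of_real c)"
    by (simp add: conv spectral_pr c eigspace_eq)
  fix P assume "is_orth_proj ks T P \<and> {mulv ks T P w | w. w \<in> vecs ks T} = eigspace ks T D (of_real c)"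
  then show "P = E c"
    using proj_range_unique[OF T, of ks P "E c"] by (simp add: conv spectral_pr c eigspace_eq)
qed

lemma mfun_eq: "mfun ks T f D = (\<Sum>c\<in>C. sm (f (of_real c)) (E c))"
proof (intro ext)
  fix \<sigma> \<tau>
  have "mfun ks T f D \<sigma> \<tau> = (\<Sum>c\<in>C. f (of_real c) * eigproj ks T D (of_real c) \<sigma> \<tau>)"
    by (simp add: mfun_def eigvals_eq sum.reindex inj_on_def)
  also have "\<dots> = (\<Sum>c\<in>C. f (of_real c) * E c \<sigma> \<tau>)"
    by (intro sum.cong) (auto simp: eigproj_eq)
  finally show "mfun ks T f D \<sigma> \<tau> = (\<Sum>c\<in>C. sm (f (of_real c)) (E c)) \<sigma> \<tau>"
    by (simp add: sum_fun_apply sm_def)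
qed

end

text \<open>The trace is the sum of the quadratic form of \<open>X\<close> over the columns of
  \<open>Y\<close>.\<close>

lemma psd_tr:
  assumes T: "finite T" and "psd ks T X" and Y: "supported (Conf ks T) Y"
  shows "0 \<le> Re (tr (Conf ks T) (mm (Conf ks T) (adj Y) (mm (Conf ks T) X Y)))"
proof -
  let ?I = "Conf ks T"
  have "0 \<le> Re (mm ?I (adj Y) (mm ?I X Y) \<tau> \<tau>)" if \<tau>: "\<tau> \<in> ?I" for \<tau>
  proof -
    let ?v = "\<lambda>\<sigma>. Y \<sigma> \<tau>"
    have "?v \<in> vecs ks T" using Y by (auto simp: vecs_def supported_def)
    then have "0 \<le> Re (vinner ks T ?v (mulv ks T X ?v))" using assms(2) by (simp add: psd_def)
    also have "vinner ks T ?v (mulv ks T X ?v) = mm ?I (adj Y) (mm ?I X Y) \<tau> \<tau>"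
      unfolding vinner_def mm_def adj_def by (intro sum.cong) (auto simp: mulv_entry)
    finally show ?thesis .
  qed
  then show ?thesis by (simp add: tr_def sum_nonneg)
qed

text \<open>A finite value means that the support projections satisfy P \<le> Q. The second claim is
  the absolute continuity of the weights: for d = 0 we have Q F = 0 with F = \<open>F d\<close>, so
  compressing Q - P by F gives minus the squared norm of P F, which must be nonnegative. Hence P F =
  0, and E F = E P F = 0 for each E = \<open>E c\<close> with c > 0. The first claim is a trace
  computation.\<close>

lemma rel_entropy_eq:
  assumes T: "finite T" and s\<psi>: "sdata ks T \<psi> C E" and s\<phi>: "sdata ks T \<phi> J F"
    and fin: "rel_entropy ks T \<psi> \<phi> \<noteq> \<infinity>"
  shows "rel_entropy ks T \<psi> \<phi> = ereal (ns_entropy (Conf ks T) C (\<lambda>c. c) E J (\<lambda>d. d) F)"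
    and "\<And>c d. c \<in> C \<Longrightarrow> d \<in> J \<Longrightarrow> 0 < c \<Longrightarrow> d = 0 \<Longrightarrow> hs (Conf ks T) (mm (Conf ks T) (F d) (E c)) = 0"
proof -
  let ?I = "Conf ks T"
  note I = finite_Conf[OF T, of ks]
  have sp: "spectral ?I (density ks T \<psi>) C E" "spectral ?I (density ks T \<phi>) J F"
    using s\<psi> s\<phi> by (auto simp: sdata_def)
  note pE = spectral_pr[OF T sp(1)] and pF = spectral_pr[OF T sp(2)]
  have nn: "\<And>c. c \<in> C \<Longrightarrow> 0 \<le> c" "\<And>d. d \<in> J \<Longrightarrow> 0 \<le> d" using s\<psi> s\<phi> by (auto simp: sdata_def)
  let ?P = "\<Sum>c\<in>C. sm (if complex_of_real c \<noteq> 0 then 1 else 0) (E c)"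
  let ?Q = "\<Sum>d\<in>J. sm (if complex_of_real d \<noteq> 0 then 1 else 0) (F d)"
  have le: "op_le ks T (msupp ks T (density ks T \<psi>)) (msupp ks T (density ks T \<phi>))"
    using fin by (auto simp: rel_entropy_def Let_def split: if_splits)
  have "(\<lambda>\<sigma> \<tau>. ?Q \<sigma> \<tau> - ?P \<sigma> \<tau>) = ?Q - ?P"
    by (intro ext) (simp only: minus_apply)
  then have psd: "psd ks T (?Q - ?P)"
    using le unfolding op_le_def msupp_def mfun_eq[OF T sp(1)] mfun_eq[OF T sp(2)] by (simp only:)
  show "hs ?I (mm ?I (F d) (E c)) = 0" if c: "c \<in> C" and d: "d \<in> J" and c0: "0 < c" and d0: "d = 0" for c d
  proof -
    have QF: "mm ?I ?Q (F d) = 0"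
      unfolding mm_sum_left mm_sm_left
      by (intro sum.neutral ballI) (use d d0 spectral_mm[OF T sp(2) _ d] in auto)
    have EP: "mm ?I (E c) ?P = E c"
    proof -
      have "mm ?I (E c) ?P = (\<Sum>e\<in>C. if e = c then E c else 0)"
        unfolding mm_sum_right mm_sm_right
        by (intro sum.cong) (use c c0 spectral_mm[OF T sp(1) c] in auto)
      then show ?thesis using c spectral_fin[OF T sp(1)] by simp
    qed
    have PP: "mm ?I ?P ?P = ?P"
    proof -
      have "mm ?I ?P ?P = (\<Sum>e\<in>C. sm (if complex_of_real e \<noteq> 0 then 1 else 0) (mm ?I (E e) ?P))"
        by (simp only: mm_sum_left mm_sm_left)
      also have "\<dots> = ?P"
      proof (intro sum.cong refl)
        fix e assume e: "e \<in> C"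
        have "mm ?I (E e) ?P = (\<Sum>a\<in>C. if a = e then sm (if complex_of_real e \<noteq> 0 then 1 else 0) (E e) else 0)"
          unfolding mm_sum_right mm_sm_right
          by (intro sum.cong) (use e spectral_mm[OF T sp(1) e] in auto)
        then have "mm ?I (E e) ?P = sm (if complex_of_real e \<noteq> 0 then 1 else 0) (E e)"
          using e spectral_fin[OF T sp(1)] by simp
        then show "sm (if complex_of_real e \<noteq> 0 then 1 else 0) (mm ?I (E e) ?P)
            = sm (if complex_of_real e \<noteq> 0 then 1 else 0) (E e)" by simp
      qed
      finally show ?thesis .
    qed
    have aP: "adj ?P = ?P"
      unfolding adj_sum adj_sm by (intro sum.cong) (auto simp: projD(3)[OF pE])
    have pP: "proj ?I ?P"
      unfolding proj_def using PP aP pE by (auto simp: projD(1))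
    have "0 \<le> Re (tr ?I (mm ?I (adj (F d)) (mm ?I (?Q - ?P) (F d))))"
      by (rule psd_tr[OF T psd projD(1)[OF pF[OF d]]])
    also have "\<dots> = - hs ?I (mm ?I ?P (F d))"
      unfolding mm_diff_left QF hs_proj_left[OF pP] mm_diff_right tr_diff by simp
    finally have "hs ?I (mm ?I ?P (F d)) = 0" using hs_nonneg[of ?I "mm ?I ?P (F d)"] by linarith
    then have "mm ?I ?P (F d) = 0" 
      by (rule hs_eq_0[OF I supported_mm[OF projD(1)[OF pP] projD(1)[OF pF[OF d]]]])
    then have "mm ?I (mm ?I (E c) ?P) (F d) = 0" by (simp only: mm_assoc mm_zero_right)
    then have "mm ?I (E c) (F d) = 0" by (simp only: EP)
    then have "adj (mm ?I (E c) (F d)) = 0" by simp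
    then have "mm ?I (F d) (E c) = 0" by (simp add: adj_mm projD(3)[OF pE[OF c]] projD(3)[OF pF[OF d]])
    then show ?thesis by simp
  qed
  \<comment> \<open>On the kernel the default value 0 in \<open>mlog\<close> agrees with
    \<open>ln 0 = 0\<close>.\<close>
  have ml: "mlog ks T (density ks T \<psi>) = (\<Sum>c\<in>C. sm (of_real (ln c)) (E c))"
    unfolding mlog_def mfun_eq[OF T sp(1)] using nn(1) by (intro sum.cong) (auto simp: less_le)
  have ml': "mlog ks T (density ks T \<phi>) = (\<Sum>d\<in>J. sm (of_real (ln d)) (F d))"
    unfolding mlog_def mfun_eq[OF T sp(2)] using nn(2) by (intro sum.cong) (auto simp: less_le)
  let ?D = "density ks T \<psi>"
  have trF: "Re (tr ?I (mm ?I ?D X)) = (\<Sum>c\<in>C. c * Re (tr ?I (mm ?I (E c) X)))" for X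
    by (subst spectral_eq[OF T sp(1)]) (simp add: mm_sum_left mm_sm_left tr_sum tr_sm)
  have hsE: "Re (tr ?I (mm ?I (E c) G)) = hs ?I (mm ?I G (E c))" if "proj ?I G" "c \<in> C" for c G
  proof -
    have "hs ?I (mm ?I G (E c)) = Re (tr ?I (mm ?I (E c) (mm ?I G (E c))))"
      unfolding hs_proj_left[OF that(1)] projD(3)[OF pE[OF that(2)]] ..
    also have "\<dots> = Re (tr ?I (mm ?I (mm ?I G (E c)) (E c)))" by (subst tr_mm_commute) (rule refl)
    also have "\<dots> = Re (tr ?I (mm ?I G (E c)))" unfolding mm_assoc projD(2)[OF pE[OF that(2)]] ..
    finally show ?thesis by (subst tr_mm_commute) simp
  qed
  have 1: "Re (tr ?I (mm ?I ?D (mlog ks T ?D))) = (\<Sum>c\<in>C. c * ln c * hs ?I (E c))"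
    unfolding trF ml
  proof (rule sum.cong[OF refl])
    fix c assume c: "c \<in> C"
    have "mm ?I (E c) (\<Sum>c\<in>C. sm (of_real (ln c)) (E c)) = (\<Sum>e\<in>C. if e = c then sm (of_real (ln c)) (E c) else 0)"
      unfolding mm_sum_right mm_sm_right by (intro sum.cong) (use c spectral_mm[OF T sp(1) c] in auto)
    then have "mm ?I (E c) (\<Sum>c\<in>C. sm (of_real (ln c)) (E c)) = sm (of_real (ln c)) (E c)"
      using c spectral_fin[OF T sp(1)] by simp
    then show "c * Re (tr ?I (mm ?I (E c) (\<Sum>c\<in>C. sm (of_real (ln c)) (E c)))) = c * ln c * hs ?I (E c)"
      by (simp add: tr_sm proj_tr[OF pE[OF c]])
  qed
  have 2: "Re (tr ?I (mm ?I ?D (mlog ks T (density ks T \<phi>)))) = (\<Sum>d\<in>J. ln d * (\<Sum>c\<in>C. c * hs ?I (mm ?I (F d) (E c))))"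
  proof -
    have "Re (tr ?I (mm ?I ?D (mlog ks T (density ks T \<phi>)))) = (\<Sum>c\<in>C. \<Sum>d\<in>J. ln d * (c * hs ?I (mm ?I (F d) (E c))))"
      unfolding trF unfolding ml' mm_sum_right mm_sm_right tr_sum tr_sm
      by (intro sum.cong refl) (simp add: hsE pF sum_distrib_left mult.left_commute)
    also have "\<dots> = (\<Sum>d\<in>J. \<Sum>c\<in>C. ln d * (c * hs ?I (mm ?I (F d) (E c))))" by (rule sum.swap)
    finally show ?thesis by (simp only: sum_distrib_left)
  qed
  have "(\<lambda>\<sigma> \<tau>. mlog ks T ?D \<sigma> \<tau> - mlog ks T (density ks T \<phi>) \<sigma> \<tau>) = mlog ks T ?D - mlog ks T (density ks T \<phi>)"
    by (intro ext) (simp add: mat_app)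
  then have "rel_entropy ks T \<psi> \<phi>
      = ereal (Re (tr ?I (mm ?I ?D (mlog ks T ?D - mlog ks T (density ks T \<phi>)))))"
    using le by (simp add: rel_entropy_def Let_def mat_conv)
  also have "\<dots> = ereal (ns_entropy ?I C (\<lambda>c. c) E J (\<lambda>d. d) F)"
    by (simp add: mm_diff_right tr_diff 1 2 ns_entropy_split[OF I sdata_resol[OF s\<psi>] sdata_resol[OF s\<phi>]])
  finally show "rel_entropy ks T \<psi> \<phi> = ereal (ns_entropy ?I C (\<lambda>c. c) E J (\<lambda>d. d) F)" .
qed

text \<open>The second operator remains a bare family of weights and projections because it will be
  the density of \<Phi> for the lower bound and a universal product operator for the upper
  bound.\<close>

lemma ns_state:
  assumes T: "finite T" and sd: "sdata ks T \<psi> C E" and F: "resol (Conf ks T) J F"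
    and s: "\<And>d. d \<in> J \<Longrightarrow> 0 \<le> s d"
    and ac: "\<And>c d. c \<in> C \<Longrightarrow> d \<in> J \<Longrightarrow> 0 < c \<Longrightarrow> s d = 0 \<Longrightarrow> hs (Conf ks T) (mm (Conf ks T) (F d) (E c)) = 0"
    and \<kappa>: "0 < \<kappa>" and t: "0 < t" and X: "X \<in> loc_alg ks T"
  shows "1 - (ns_entropy (Conf ks T) C (\<lambda>c. c) E J s F + (\<Sum>d\<in>J. s d * hs (Conf ks T) (F d))) / t
    \<le> (1 + \<kappa>) * Re (\<psi> (mm (Conf ks T) (adj (idm (Conf ks T) - X)) (idm (Conf ks T) - X)))
      + (1 + 1 / \<kappa>) * exp t * (\<Sum>d\<in>J. s d * hs (Conf ks T) (mm (Conf ks T) (F d) X))"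
proof -
  have "Re (\<psi> (mm (Conf ks T) (adj (idm (Conf ks T) - X)) (idm (Conf ks T) - X)))
      = (\<Sum>c\<in>C. c * hs (Conf ks T) (mm (Conf ks T) (idm (Conf ks T) - X) (E c)))"
    using sdata_adj_mm[OF T sd, of "idm (Conf ks T) - X"] X by (simp add: loc_alg_diff)
  moreover have c: "\<And>c. c \<in> C \<Longrightarrow> 0 \<le> c" "(\<Sum>c\<in>C. c * hs (Conf ks T) (E c)) = 1"
    using sd by (auto simp: sdata_def)
  moreover note nussbaum_szkola[where r = "\<lambda>c. c" and X = X,
        OF finite_Conf[OF T] sdata_resol[OF sd] F c(1) s ac c(2) \<kappa> t]
  ultimately show ?thesis by (simp only:)
qed

section \<open>Densities on intervals and the lower bound\<close>

lemma finite_ivl [simp]: "finite (ivl n)"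
  by (simp add: ivl_def)

lemma local_proj_iff: "local_proj ks n q \<longleftrightarrow> q \<in> loc_alg ks (ivl n) \<and> proj (Conf ks (ivl n)) q"
  by (auto simp: local_proj_def proj_def mat_conv loc_alg_supported)

lemma state_local: "is_state ks \<Psi> \<Longrightarrow> finite T \<Longrightarrow> is_local_state ks T (\<Psi> T)"
  by (simp add: is_state_def)

lemma state_proj_bounds:
  assumes T: "finite T" and st: "is_local_state ks T \<omega>" and q: "proj (Conf ks T) q" "q \<in> loc_alg ks T"
  shows "0 \<le> Re (\<omega> q)" "Re (\<omega> q) \<le> 1" "Re (\<omega> (idm (Conf ks T) - q)) = 1 - Re (\<omega> q)"
proof -
  have nn: "0 \<le> Re (\<omega> q)" if "proj (Conf ks T) q" "q \<in> loc_alg ks T" for q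
    using state_pos(2)[OF T st that(2)] projD[OF that(1)] by simp
  show "0 \<le> Re (\<omega> q)" by (rule nn[OF q])
  show *: "Re (\<omega> (idm (Conf ks T) - q)) = 1 - Re (\<omega> q)"
    using q state_diff[OF T st loc_alg_idm q(2)] state_one[OF T st] by simp
  have "0 \<le> Re (\<omega> (idm (Conf ks T) - q))"
    by (rule nn[OF proj_compl[OF finite_Conf[OF T] q(1)] loc_alg_diff[OF loc_alg_idm q(2)]])
  then show "Re (\<omega> q) \<le> 1" using * by simp
qed

lemma rate_LIMSEQ: "rate_exists ks \<Psi> \<Phi> \<Longrightarrow> (\<lambda>n. Sn ks \<Psi> \<Phi> n / ereal (real n)) \<longlonglongrightarrow> rate ks \<Psi> \<Phi>"
  unfolding rate_exists_def rate_def by (metis limI)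

text \<open>The estimate with \<kappa> = 1 and \<open>X = q\<close>. The summand 1 in
  \<open>D + 1\<close> is the total mass of the second weights.\<close>

lemma Sn_bound:
  assumes "is_state ks \<Psi>" "is_state ks \<Phi>" "Sn ks \<Psi> \<Phi> n \<noteq> \<infinity>"
  obtains D where "Sn ks \<Psi> \<Phi> n = ereal D" "-1 \<le> D"
    "\<And>q t. local_proj ks n q \<Longrightarrow> 0 < t \<Longrightarrow>
      1 - (D + 1) / t \<le> 2 * (1 - Re (\<Psi> (ivl n) q)) + 2 * exp t * Re (\<Phi> (ivl n) q)"
proof -
  let ?T = "ivl n" let ?I = "Conf ks ?T"
  note st = state_local[OF assms(1) finite_ivl] state_local[OF assms(2) finite_ivl]
  obtain C E where sp: "sdata ks ?T (\<Psi> ?T) C E" using sdata_exists[OF finite_ivl st(1)] by blast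
  obtain J F where sf: "sdata ks ?T (\<Phi> ?T) J F" using sdata_exists[OF finite_ivl st(2)] by blast
  note re = rel_entropy_eq[OF finite_ivl sp sf assms(3)[unfolded Sn_def]]
  define D where "D = ns_entropy ?I C (\<lambda>c. c) E J (\<lambda>d. d) F"
  have s1: "(\<Sum>d\<in>J. d * hs ?I (F d)) = 1" "(\<Sum>c\<in>C. c * hs ?I (E c)) = 1"
    and nn: "\<And>d. d \<in> J \<Longrightarrow> 0 \<le> d" "\<And>c. c \<in> C \<Longrightarrow> 0 \<le> c"
    using sf sp by (auto simp: sdata_def)
  show ?thesis
  proof
    show "Sn ks \<Psi> \<Phi> n = ereal D" using re(1) by (simp add: Sn_def D_def)
    show "-1 \<le> D"
      using ns_entropy_lower[OF finite_Conf[OF finite_ivl] sdata_resol[OF sp] sdata_resol[OF sf], of "\<lambda>c. c" "\<lambda>d. d"] nn re(2) s1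
      by (simp add: D_def)
    fix q and t :: real assume q: "local_proj ks n q" and t: "0 < t"
    have pq: "proj ?I q" "q \<in> loc_alg ks ?T" using q by (auto simp: local_proj_iff)
    have "1 - (D + 1) / t \<le> (1 + 1) * Re (\<Psi> ?T (mm ?I (adj (idm ?I - q)) (idm ?I - q)))
        + (1 + 1 / 1) * exp t * (\<Sum>d\<in>J. d * hs ?I (mm ?I (F d) q))"
      using ns_state[OF finite_ivl sp sdata_resol[OF sf], of "\<lambda>d. d" 1 t q] nn re(2) t pq s1(1)
      by (simp add: D_def)
    also have "mm ?I (adj (idm ?I - q)) (idm ?I - q) = idm ?I - q"
      using proj_compl[OF finite_Conf[OF finite_ivl] pq(1)] by (simp add: projD)
    also have "(\<Sum>d\<in>J. d * hs ?I (mm ?I (F d) q)) = Re (\<Phi> ?T q)"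
      using sdata_proj'[OF finite_ivl sf pq] by simp
    finally show "1 - (D + 1) / t \<le> 2 * (1 - Re (\<Psi> ?T q)) + 2 * exp t * Re (\<Phi> ?T q)"
      using state_proj_bounds(3)[OF finite_ivl st(1) pq] by simp
  qed
qed

lemma Sn_rate_less:
  assumes lim: "(\<lambda>n. Sn ks \<Psi> \<Phi> n / ereal (real n)) \<longlonglongrightarrow> L" and b: "L < ereal b"
  shows "\<forall>\<^sub>F n in sequentially. 0 < n \<and> Sn ks \<Psi> \<Phi> n < ereal (b * real n)"
proof -
  have "\<forall>\<^sub>F n in sequentially. Sn ks \<Psi> \<Phi> n / ereal (real n) < ereal b"
    using lim b by (rule order_tendstoD(2))
  moreover have "\<forall>\<^sub>F n in sequentially. 0 < n" by (rule eventually_gt_at_top)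
  ultimately show ?thesis
  proof eventually_elim
    case (elim n)
    then show ?case by (cases "Sn ks \<Psi> \<Phi> n") (auto simp: field_simps)
  qed
qed

lemma rate_nonneg:
  assumes "is_state ks \<Psi>" "is_state ks \<Phi>" "rate_exists ks \<Psi> \<Phi>"
  shows "0 \<le> rate ks \<Psi> \<Phi>"
proof (rule ccontr)
  assume "\<not> 0 \<le> rate ks \<Psi> \<Phi>"
  then obtain b where b: "rate ks \<Psi> \<Phi> < ereal b" "ereal b < 0"
    using ereal_dense2[of "rate ks \<Psi> \<Phi>" 0] by (auto simp: not_le)
  have "\<forall>\<^sub>F n in sequentially. 1 / (- b) < real n"
    using filterlim_real_sequentially by (simp add: filterlim_at_top_dense)
  with Sn_rate_less[OF rate_LIMSEQ[OF assms(3)] b(1)]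
  have "\<forall>\<^sub>F n in sequentially. False"
  proof eventually_elim
    case (elim n)
    then have fin: "Sn ks \<Psi> \<Phi> n \<noteq> \<infinity>" by auto
    obtain D where D: "Sn ks \<Psi> \<Phi> n = ereal D" "-1 \<le> D" by (rule Sn_bound[OF assms(1,2) fin])
    then have "-1 < b * real n" using elim by auto
    moreover have "1 < real n * (-b)" using elim b by (simp add: field_simps)
    ultimately show False by (simp add: mult.commute)
  qed
  then show False by simp
qed

text \<open>Let the threshold t exceed the relative entropy by a fixed fraction. The Markov error
  then stays away from 1, and as \<Psi>(p) tends to 1, exp t * \<Phi>(p) is bounded below by a
  positive constant.\<close>

lemma liminf_lower:
  assumes S: "is_state ks \<Psi>" "is_state ks \<Phi>" and re: "rate_exists ks \<Psi> \<Phi>"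
    and p: "\<And>n. local_proj ks n (p n)" and lim: "(\<lambda>n. Re (\<Psi> (ivl n) (p n))) \<longlonglongrightarrow> 1"
  shows "- rate ks \<Psi> \<Phi> \<le> liminf (\<lambda>n. elog (Re (\<Phi> (ivl n) (p n))) / ereal (real n))"
proof (cases "rate ks \<Psi> \<Phi>")
  case (real l)
  then have l: "0 \<le> l" using rate_nonneg[OF S re] by simp
  show ?thesis
  proof (rule ereal_le_epsilon2)
    fix \<delta> :: real assume "0 < \<delta>"
    \<comment> \<open>One third each goes to the convergence of the rate, to the excess of the
      threshold t = (l + 2 \<epsilon>) n, and to the constant \<gamma> / 4. The number \<gamma> is
      the relative excess: (l + \<epsilon>) n = (1 - \<gamma>) t. A quarter of it pays for the
      summand 1 in \<open>D + 1\<close>, a quarter for the error of \<open>p\<close>, and the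
      remaining half bounds 2 exp t * \<Phi>(p) from below.\<close>
    define \<epsilon> where "\<epsilon> = \<delta> / 3"
    have \<epsilon>: "0 < \<epsilon>" using \<open>0 < \<delta>\<close> by (simp add: \<epsilon>_def)
    define \<gamma> where "\<gamma> = \<epsilon> / (l + 2 * \<epsilon>)"
    have lp: "0 < l + 2 * \<epsilon>" using l \<epsilon> by simp
    have \<gamma>: "0 < \<gamma>" using lp \<epsilon> by (simp add: \<gamma>_def)
    have "rate ks \<Psi> \<Phi> < ereal (l + \<epsilon>)" using \<epsilon> by (simp add: real)
    note e1 = Sn_rate_less[OF rate_LIMSEQ[OF re] this]
    have e2: "\<forall>\<^sub>F n in sequentially. 1 - \<gamma> / 8 < Re (\<Psi> (ivl n) (p n))"
      by (rule order_tendstoD(1)[OF lim]) (use \<gamma> in simp)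
    have e3: "\<forall>\<^sub>F n in sequentially. 4 / ((l + 2 * \<epsilon>) * \<gamma>) < real n"
      using filterlim_real_sequentially by (simp add: filterlim_at_top_dense)
    have e4: "\<forall>\<^sub>F n in sequentially. \<bar>ln (\<gamma> / 4)\<bar> / \<epsilon> < real n"
      using filterlim_real_sequentially by (simp add: filterlim_at_top_dense)
    have "\<forall>\<^sub>F n in sequentially. ereal (- (l + 3 * \<epsilon>)) \<le> elog (Re (\<Phi> (ivl n) (p n))) / ereal (real n)"
      using e1 e2 e3 e4
    proof eventually_elim
      case (elim n)
      have n: "0 < real n" using elim by simp
      have fin: "Sn ks \<Psi> \<Phi> n \<noteq> \<infinity>" using elim by auto
      obtain D where D: "Sn ks \<Psi> \<Phi> n = ereal D" "-1 \<le> D"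
        and test: "\<And>q t. local_proj ks n q \<Longrightarrow> 0 < t \<Longrightarrow>
          1 - (D + 1) / t \<le> 2 * (1 - Re (\<Psi> (ivl n) q)) + 2 * exp t * Re (\<Phi> (ivl n) q)"
        by (rule Sn_bound[OF S fin]) blast
      define t where "t = (l + 2 * \<epsilon>) * real n"
      have t: "0 < t" using lp n by (simp add: t_def)
      have "D < (l + \<epsilon>) * real n" using elim D by simp
      moreover have "1 < \<gamma> / 4 * t"
      proof -
        have "0 < (l + 2 * \<epsilon>) * \<gamma>" using lp \<gamma> by (rule mult_pos_pos)
        then have "4 < real n * ((l + 2 * \<epsilon>) * \<gamma>)" using elim(3) by (simp only: pos_divide_less_eq)
        also have "\<dots> = \<gamma> * t" by (simp only: t_def mult_ac)
        finally show ?thesis by linarith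
      qed
      moreover have "(l + \<epsilon>) * real n = (1 - \<gamma>) * t"
      proof -
        have "\<gamma> * (l + 2 * \<epsilon>) = \<epsilon>" using lp by (simp add: \<gamma>_def)
        then have "(1 - \<gamma>) * (l + 2 * \<epsilon>) = l + \<epsilon>" by (simp add: left_diff_distrib)
        then show ?thesis unfolding t_def by (simp only: mult.assoc[symmetric])
      qed
      moreover have "(1 - \<gamma> + \<gamma> / 4) * t = (1 - \<gamma>) * t + \<gamma> / 4 * t" by (simp add: algebra_simps)
      ultimately have "D + 1 \<le> (1 - \<gamma> + \<gamma> / 4) * t" by linarith
      define y z where "y = (D + 1) / t" and "z = exp t * Re (\<Phi> (ivl n) (p n))"
      have "y \<le> 1 - \<gamma> + \<gamma> / 4"
        using \<open>D + 1 \<le> _\<close> t by (simp add: y_def pos_divide_le_eq)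
      moreover have "1 - y \<le> 2 * (1 - Re (\<Psi> (ivl n) (p n))) + 2 * z"
        using test[OF p t] by (simp add: y_def z_def)
      moreover note elim(2)
      ultimately have "\<gamma> \<le> 4 * z" by (simp add: field_simps)
      then have "\<gamma> / 4 \<le> z" by simp
      then have "\<gamma> / 4 * exp (- t) \<le> (exp t * Re (\<Phi> (ivl n) (p n))) * exp (- t)"
        unfolding z_def by (intro mult_right_mono) auto
      also have "\<dots> = Re (\<Phi> (ivl n) (p n)) * (exp t * exp (- t))" by (simp only: mult_ac)
      finally have "\<gamma> / 4 * exp (- t) \<le> Re (\<Phi> (ivl n) (p n))"
        by (simp only: exp_minus_inverse mult_1_right)
      moreover have pos: "0 < \<gamma> / 4 * exp (- t)" using \<gamma> by simp
      ultimately have pp: "0 < Re (\<Phi> (ivl n) (p n))" and le: "\<gamma> / 4 * exp (- t) \<le> Re (\<Phi> (ivl n) (p n))"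
        by linarith+
      have ge: "ln (\<gamma> / 4 * exp (- t)) \<le> ln (Re (\<Phi> (ivl n) (p n)))"
        using ln_le_cancel_iff[OF pos pp] le by blast
      have "ln (\<gamma> / 4 * exp (- t)) = ln (\<gamma> / 4) - t" using ln_mult[of "\<gamma> / 4" "exp (- t)"] \<gamma> by simp
      moreover have "\<bar>ln (\<gamma> / 4)\<bar> < real n * \<epsilon>" 
        using elim(4) by (simp only: pos_divide_less_eq[OF \<epsilon>])
      then have "- (real n * \<epsilon>) \<le> ln (\<gamma> / 4)" by linarith
      moreover have "- (l + 3 * \<epsilon>) * real n = - (real n * \<epsilon>) - t"
        by (simp add: t_def algebra_simps)
      ultimately have "- (l + 3 * \<epsilon>) * real n \<le> ln (Re (\<Phi> (ivl n) (p n)))"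
        using ge by linarith
      then have "- (l + 3 * \<epsilon>) \<le> ln (Re (\<Phi> (ivl n) (p n))) / real n" using n by (simp add: pos_le_divide_eq)
      then show ?case using pp n by (simp add: elog_def)
    qed
    then have "ereal (- (l + 3 * \<epsilon>)) \<le> liminf (\<lambda>n. elog (Re (\<Phi> (ivl n) (p n))) / ereal (real n))"
      by (rule Liminf_bounded)
    then show "- rate ks \<Psi> \<Phi> \<le> liminf (\<lambda>n. elog (Re (\<Phi> (ivl n) (p n))) / ereal (real n)) + ereal \<delta>"
      using real by (cases "liminf (\<lambda>n. elog (Re (\<Phi> (ivl n) (p n))) / ereal (real n))") (auto simp: \<epsilon>_def)
  qed
next
  case PInf
  then show ?thesis by simp
next
  case MInf
  then show ?thesis using rate_nonneg[OF S re] by simp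
qed

section \<open>Tensor products and shifts\<close>

lemma restrict_Conf: "\<sigma> \<in> Conf ks T' \<Longrightarrow> T \<subseteq> T' \<Longrightarrow> restrict \<sigma> T \<in> Conf ks T"
  by (auto simp: Conf_def)

lemma sum_Conf_union:
  assumes dis: "T1 \<inter> T2 = {}"
  shows "(\<Sum>\<sigma>\<in>Conf ks (T1 \<union> T2). g (restrict \<sigma> T1) (restrict \<sigma> T2)) = (\<Sum>\<alpha>\<in>Conf ks T1. \<Sum>\<beta>\<in>Conf ks T2. g \<alpha> \<beta>)"
proof -
  have "(\<Sum>\<sigma>\<in>Conf ks (T1 \<union> T2). g (restrict \<sigma> T1) (restrict \<sigma> T2)) = (\<Sum>p\<in>Conf ks T1 \<times> Conf ks T2. g (fst p) (snd p))"
  proof (rule sum.reindex_bij_witness[where j = "\<lambda>\<sigma>. (restrict \<sigma> T1, restrict \<sigma> T2)"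
        and i = "\<lambda>p t. if t \<in> T1 then fst p t else snd p t"])
    fix \<sigma> assume \<sigma>: "\<sigma> \<in> Conf ks (T1 \<union> T2)"
    then show "(\<lambda>t. if t \<in> T1 then fst (restrict \<sigma> T1, restrict \<sigma> T2) t else snd (restrict \<sigma> T1, restrict \<sigma> T2) t) = \<sigma>"
      by (auto simp: fun_eq_iff restrict_def Conf_def PiE_def extensional_def)
    show "(restrict \<sigma> T1, restrict \<sigma> T2) \<in> Conf ks T1 \<times> Conf ks T2"
      using \<sigma> by (auto intro: restrict_Conf)
  next
    fix p assume p: "p \<in> Conf ks T1 \<times> Conf ks T2"
    obtain a b where ab: "p = (a, b)" "a \<in> Conf ks T1" "b \<in> Conf ks T2" using p by auto
    have "restrict (\<lambda>t. if t \<in> T1 then a t else b t) T1 = a"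
      using ab(2) by (auto simp: fun_eq_iff restrict_def Conf_def PiE_def extensional_def)
    moreover have "restrict (\<lambda>t. if t \<in> T1 then a t else b t) T2 = b"
      using ab(3) dis by (auto simp: fun_eq_iff restrict_def Conf_def PiE_def extensional_def)
    ultimately show "(restrict (\<lambda>t. if t \<in> T1 then fst p t else snd p t) T1,
        restrict (\<lambda>t. if t \<in> T1 then fst p t else snd p t) T2) = p" by (simp only: ab(1) fst_conv snd_conv)
    show "(\<lambda>t. if t \<in> T1 then fst p t else snd p t) \<in> Conf ks (T1 \<union> T2)"
      using ab(2,3) by (auto simp: ab(1) Conf_def PiE_def extensional_def Pi_def)
  qed simp
  then show ?thesis by (simp add: sum.cartesian_product case_prod_beta)
qed

definition tensor :: "nat list \<Rightarrow> int set \<Rightarrow> int set \<Rightarrow> lmat \<Rightarrow> lmat \<Rightarrow> lmat" where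
  "tensor ks T1 T2 X Y = (\<lambda>\<sigma> \<tau>. if \<sigma> \<in> Conf ks (T1 \<union> T2) \<and> \<tau> \<in> Conf ks (T1 \<union> T2)
     then X (restrict \<sigma> T1) (restrict \<tau> T1) * Y (restrict \<sigma> T2) (restrict \<tau> T2) else 0)"

lemma tensor_mm:
  assumes dis: "T1 \<inter> T2 = {}"
  shows "mm (Conf ks (T1 \<union> T2)) (tensor ks T1 T2 X Y) (tensor ks T1 T2 X' Y')
    = tensor ks T1 T2 (mm (Conf ks T1) X X') (mm (Conf ks T2) Y Y')"
proof (intro ext)
  fix \<sigma> \<tau>
  let ?I = "Conf ks (T1 \<union> T2)"
  show "mm ?I (tensor ks T1 T2 X Y) (tensor ks T1 T2 X' Y') \<sigma> \<tau>
    = tensor ks T1 T2 (mm (Conf ks T1) X X') (mm (Conf ks T2) Y Y') \<sigma> \<tau>"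
  proof (cases "\<sigma> \<in> ?I \<and> \<tau> \<in> ?I")
    case True
    let ?g = "\<lambda>a b. (X (restrict \<sigma> T1) a * X' a (restrict \<tau> T1)) * (Y (restrict \<sigma> T2) b * Y' b (restrict \<tau> T2))"
    have "mm ?I (tensor ks T1 T2 X Y) (tensor ks T1 T2 X' Y') \<sigma> \<tau> = (\<Sum>\<rho>\<in>?I. ?g (restrict \<rho> T1) (restrict \<rho> T2))"
      unfolding mm_def tensor_def using True by (intro sum.cong) (auto simp: mult_ac)
    also have "\<dots> = (\<Sum>a\<in>Conf ks T1. \<Sum>b\<in>Conf ks T2. ?g a b)" by (rule sum_Conf_union[OF dis])
    also have "\<dots> = mm (Conf ks T1) X X' (restrict \<sigma> T1) (restrict \<tau> T1) * mm (Conf ks T2) Y Y' (restrict \<sigma> T2) (restrict \<tau> T2)"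
      by (simp only: mm_def sum_product)
    finally show ?thesis using True by (simp add: tensor_def)
  qed (auto simp: mm_def tensor_def)
qed

lemma tensor_adj: "adj (tensor ks T1 T2 X Y) = tensor ks T1 T2 (adj X) (adj Y)"
  by (intro ext) (simp add: adj_def tensor_def)

lemma tensor_hs:
  assumes dis: "T1 \<inter> T2 = {}"
  shows "hs (Conf ks (T1 \<union> T2)) (tensor ks T1 T2 X Y) = hs (Conf ks T1) X * hs (Conf ks T2) Y"
proof -
  let ?I = "Conf ks (T1 \<union> T2)"
  let ?x = "\<lambda>a a'. (cmod (X a a'))\<^sup>2" and ?y = "\<lambda>b b'. (cmod (Y b b'))\<^sup>2"
  have "hs ?I (tensor ks T1 T2 X Y) = (\<Sum>\<sigma>\<in>?I. \<Sum>\<tau>\<in>?I. ?x (restrict \<sigma> T1) (restrict \<tau> T1) * ?y (restrict \<sigma> T2) (restrict \<tau> T2))"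
    unfolding hs_def tensor_def by (intro sum.cong refl) (simp add: norm_mult power_mult_distrib)
  also have "\<dots> = (\<Sum>\<sigma>\<in>?I. (\<Sum>a'\<in>Conf ks T1. ?x (restrict \<sigma> T1) a') * (\<Sum>b'\<in>Conf ks T2. ?y (restrict \<sigma> T2) b'))"
  proof (rule sum.cong[OF refl])
    fix \<sigma>
    show "(\<Sum>\<tau>\<in>?I. ?x (restrict \<sigma> T1) (restrict \<tau> T1) * ?y (restrict \<sigma> T2) (restrict \<tau> T2))
      = (\<Sum>a'\<in>Conf ks T1. ?x (restrict \<sigma> T1) a') * (\<Sum>b'\<in>Conf ks T2. ?y (restrict \<sigma> T2) b')"
      using sum_Conf_union[OF dis, of "\<lambda>a b. ?x (restrict \<sigma> T1) a * ?y (restrict \<sigma> T2) b" ks]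
      by (simp only: sum_product)
  qed
  also have "\<dots> = (\<Sum>a\<in>Conf ks T1. \<Sum>b\<in>Conf ks T2. (\<Sum>a'\<in>Conf ks T1. ?x a a') * (\<Sum>b'\<in>Conf ks T2. ?y b b'))"
    by (rule sum_Conf_union[OF dis])
  also have "\<dots> = hs (Conf ks T1) X * hs (Conf ks T2) Y"
    by (simp only: hs_def sum_product[of "\<lambda>a. \<Sum>a'\<in>Conf ks T1. ?x a a'"])
  finally show ?thesis .
qed

lemma tensor_loc_alg:
  assumes "X \<in> loc_alg ks T1" "Y \<in> loc_alg ks T2"
  shows "tensor ks T1 T2 X Y \<in> loc_alg ks (T1 \<union> T2)"
  unfolding loc_alg_iff supported_def
proof (intro conjI allI impI)
  fix \<sigma> \<tau> assume nz: "tensor ks T1 T2 X Y \<sigma> \<tau> \<noteq> 0"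
  then show "\<sigma> \<in> Conf ks (T1 \<union> T2)" "\<tau> \<in> Conf ks (T1 \<union> T2)"
    by (auto simp: tensor_def split: if_splits)
  have "X (restrict \<sigma> T1) (restrict \<tau> T1) \<noteq> 0" "Y (restrict \<sigma> T2) (restrict \<tau> T2) \<noteq> 0"
    using nz by (auto simp: tensor_def split: if_splits)
  then have "same_block T1 (restrict \<sigma> T1) (restrict \<tau> T1)" "same_block T2 (restrict \<sigma> T2) (restrict \<tau> T2)"
    using assms by (auto simp: loc_alg_iff)
  then show "same_block (T1 \<union> T2) \<sigma> \<tau>" by (auto simp: same_block_def)
qed

lemma tensor_sum_left: "tensor ks T1 T2 (\<Sum>j\<in>J. F j) Y = (\<Sum>j\<in>J. tensor ks T1 T2 (F j) Y)"
proof (intro ext)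
  fix \<sigma> \<tau>
  show "tensor ks T1 T2 (\<Sum>j\<in>J. F j) Y \<sigma> \<tau> = (\<Sum>j\<in>J. tensor ks T1 T2 (F j) Y) \<sigma> \<tau>"
    by (cases "\<sigma> \<in> Conf ks (T1 \<union> T2) \<and> \<tau> \<in> Conf ks (T1 \<union> T2)")
       (auto simp: tensor_def sum_fun_apply sum_distrib_right)
qed

lemma tensor_sum_right: "tensor ks T1 T2 X (\<Sum>j\<in>J. F j) = (\<Sum>j\<in>J. tensor ks T1 T2 X (F j))"
proof (intro ext)
  fix \<sigma> \<tau>
  show "tensor ks T1 T2 X (\<Sum>j\<in>J. F j) \<sigma> \<tau> = (\<Sum>j\<in>J. tensor ks T1 T2 X (F j)) \<sigma> \<tau>"
    by (cases "\<sigma> \<in> Conf ks (T1 \<union> T2) \<and> \<tau> \<in> Conf ks (T1 \<union> T2)")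
       (auto simp: tensor_def sum_fun_apply sum_distrib_left)
qed

lemma Conf_ext:
  assumes "\<sigma> \<in> Conf ks T" "\<tau> \<in> Conf ks T" "\<And>t. t \<in> T \<Longrightarrow> \<sigma> t = \<tau> t"
  shows "\<sigma> = \<tau>"
  using assms unfolding Conf_def by (rule PiE_ext)

lemma restrict_eq_iff: "restrict \<sigma> T = restrict \<tau> T \<longleftrightarrow> (\<forall>t\<in>T. \<sigma> t = \<tau> t)"
  by (auto simp: restrict_def fun_eq_iff)

text \<open>In this form the consistency of a state says that summing out the second tensor factor
  yields its marginal on the first region.\<close>

lemma tensor_emb_left: "emb ks T1 (T1 \<union> T2) X = tensor ks T1 T2 X (idm (Conf ks T2))" if "T1 \<inter> T2 = {}"
proof (intro ext)
  fix \<sigma> \<tau>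
  have "T1 \<union> T2 - T1 = T2" using that by auto
  then show "emb ks T1 (T1 \<union> T2) X \<sigma> \<tau> = tensor ks T1 T2 X (idm (Conf ks T2)) \<sigma> \<tau>"
    using restrict_Conf[of \<sigma> ks "T1 \<union> T2" T2]
    by (simp add: emb_def tensor_def idm_def restrict_eq_iff)
qed

lemma tensor_emb_right: "emb ks T2 (T1 \<union> T2) Y = tensor ks T1 T2 (idm (Conf ks T1)) Y" if "T1 \<inter> T2 = {}"
proof (intro ext)
  fix \<sigma> \<tau>
  have "T1 \<union> T2 - T2 = T1" using that by auto
  then show "emb ks T2 (T1 \<union> T2) Y \<sigma> \<tau> = tensor ks T1 T2 (idm (Conf ks T1)) Y \<sigma> \<tau>"
    using restrict_Conf[of \<sigma> ks "T1 \<union> T2" T1]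
    by (simp add: emb_def tensor_def idm_def restrict_eq_iff)
qed

lemma tensor_idm: "tensor ks T1 T2 (idm (Conf ks T1)) (idm (Conf ks T2)) = idm (Conf ks (T1 \<union> T2))"
proof (intro ext)
  fix \<sigma> \<tau>
  show "tensor ks T1 T2 (idm (Conf ks T1)) (idm (Conf ks T2)) \<sigma> \<tau> = idm (Conf ks (T1 \<union> T2)) \<sigma> \<tau>"
    using restrict_Conf[of \<sigma> ks "T1 \<union> T2" T1] restrict_Conf[of \<sigma> ks "T1 \<union> T2" T2]
      Conf_ext[of \<sigma> ks "T1 \<union> T2" \<tau>]
    by (auto simp: tensor_def idm_def restrict_eq_iff)
qed

text \<open>Transports an element over \<open>T\<close> to one over the translate of
  \<open>T\<close> by a; \<open>shift_mat\<close> is the case a = 1.\<close>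

definition shift_by :: "int \<Rightarrow> lmat \<Rightarrow> lmat" where
  "shift_by a X = (\<lambda>\<sigma> \<tau>. X (\<lambda>t. \<sigma> (t + a)) (\<lambda>t. \<tau> (t + a)))"

abbreviation transl :: "int \<Rightarrow> int set \<Rightarrow> int set" where
  "transl a T \<equiv> (\<lambda>t. t + a) ` T"

lemma shift_Conf_iff: "(\<lambda>t. \<sigma> (t + a)) \<in> Conf ks T \<longleftrightarrow> \<sigma> \<in> Conf ks (transl a T)"
proof
  assume l: "(\<lambda>t. \<sigma> (t + a)) \<in> Conf ks T"
  show "\<sigma> \<in> Conf ks (transl a T)"
    unfolding Conf_def
  proof (rule PiE_I)
    fix t assume "t \<in> transl a T"
    then show "\<sigma> t \<in> blocks ks" using l by (auto simp: Conf_def)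
  next
    fix t assume t: "t \<notin> transl a T"
    then have "t - a \<notin> T" by force
    then have "(\<lambda>t. \<sigma> (t + a)) (t - a) = undefined" using l unfolding Conf_def by (rule PiE_arb[rotated])
    then show "\<sigma> t = undefined" by simp
  qed
next
  assume r: "\<sigma> \<in> Conf ks (transl a T)"
  show "(\<lambda>t. \<sigma> (t + a)) \<in> Conf ks T"
    unfolding Conf_def
  proof (rule PiE_I)
    fix t assume "t \<in> T"
    then show "\<sigma> (t + a) \<in> blocks ks" using r by (auto simp: Conf_def)
  next
    fix t assume "t \<notin> T"
    then have "t + a \<notin> transl a T" by auto
    with r show "\<sigma> (t + a) = undefined" unfolding Conf_def by (rule PiE_arb)
  qed
qed

lemma sum_Conf_shift: "(\<Sum>\<sigma>\<in>Conf ks (transl a T). g (\<lambda>t. \<sigma> (t + a))) = (\<Sum>\<sigma>\<in>Conf ks T. g \<sigma>)"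
proof (rule sum.reindex_bij_witness[where j = "\<lambda>\<sigma> t. \<sigma> (t + a)" and i = "\<lambda>\<sigma> t. \<sigma> (t - a)"])
  fix \<sigma> assume "\<sigma> \<in> Conf ks T"
  then show "(\<lambda>t. \<sigma> (t - a)) \<in> Conf ks (transl a T)"
    using shift_Conf_iff[of "\<lambda>t. \<sigma> (t - a)" a ks T] by simp
qed (auto simp: shift_Conf_iff)

lemma shift_by_mm: "mm (Conf ks (transl a T)) (shift_by a X) (shift_by a Y) = shift_by a (mm (Conf ks T) X Y)"
  by (intro ext) (simp add: mm_def shift_by_def sum_Conf_shift[of "\<lambda>\<rho>. X _ \<rho> * Y \<rho> _"])

lemma shift_by_adj: "adj (shift_by a X) = shift_by a (adj X)"
  by (simp add: adj_def shift_by_def)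

lemma shift_by_sum: "shift_by a (\<Sum>j\<in>J. F j) = (\<Sum>j\<in>J. shift_by a (F j))"
  by (intro ext) (simp add: shift_by_def sum_fun_apply)

lemma shift_by_hs: "hs (Conf ks (transl a T)) (shift_by a X) = hs (Conf ks T) X"
proof -
  have "hs (Conf ks (transl a T)) (shift_by a X) = (\<Sum>\<sigma>\<in>Conf ks (transl a T). \<Sum>\<tau>\<in>Conf ks T. (cmod (X (\<lambda>t. \<sigma> (t + a)) \<tau>))\<^sup>2)"
    unfolding hs_def shift_by_def by (intro sum.cong refl sum_Conf_shift)
  also have "\<dots> = hs (Conf ks T) X" unfolding hs_def by (rule sum_Conf_shift)
  finally show ?thesis .
qed

lemma shift_by_idm: "shift_by a (idm (Conf ks T)) = idm (Conf ks (transl a T))"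
proof (intro ext)
  fix \<sigma> \<tau> :: cfg
  have "(\<lambda>t. \<sigma> (t + a)) = (\<lambda>t. \<tau> (t + a)) \<longleftrightarrow> \<sigma> = \<tau>"
  proof
    assume eq: "(\<lambda>t. \<sigma> (t + a)) = (\<lambda>t. \<tau> (t + a))"
    show "\<sigma> = \<tau>"
    proof
      fix t show "\<sigma> t = \<tau> t" using fun_cong[OF eq, of "t - a"] by simp
    qed
  qed simp
  then show "shift_by a (idm (Conf ks T)) \<sigma> \<tau> = idm (Conf ks (transl a T)) \<sigma> \<tau>"
    by (simp add: shift_by_def idm_def shift_Conf_iff)
qed

lemma shift_by_loc_alg: "X \<in> loc_alg ks T \<Longrightarrow> shift_by a X \<in> loc_alg ks (transl a T)"
  unfolding loc_alg_iff supported_def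
proof (intro conjI allI impI)
  assume X: "(\<forall>i j. X i j \<noteq> 0 \<longrightarrow> i \<in> Conf ks T \<and> j \<in> Conf ks T) \<and> (\<forall>\<sigma> \<tau>. X \<sigma> \<tau> \<noteq> 0 \<longrightarrow> same_block T \<sigma> \<tau>)"
  fix \<sigma> \<tau> assume "shift_by a X \<sigma> \<tau> \<noteq> 0"
  then have nz: "X (\<lambda>t. \<sigma> (t + a)) (\<lambda>t. \<tau> (t + a)) \<noteq> 0" by (simp add: shift_by_def)
  show "\<sigma> \<in> Conf ks (transl a T)" "\<tau> \<in> Conf ks (transl a T)"
    using X nz shift_Conf_iff by blast+
  have "same_block T (\<lambda>t. \<sigma> (t + a)) (\<lambda>t. \<tau> (t + a))" using X nz by blast
  then show "same_block (transl a T) \<sigma> \<tau>" by (auto simp: same_block_def)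
qed

lemma stationary_sh:
  assumes "stationary ks \<Psi>" "finite T" "X \<in> loc_alg ks T"
  shows "\<Psi> (transl (int m) T) (shift_by (int m) X) = \<Psi> T X"
proof (induction m)
  case 0
  show ?case by (simp add: shift_by_def)
next
  case (Suc m)
  have "\<Psi> (transl 1 (transl (int m) T)) (shift_mat (shift_by (int m) X)) = \<Psi> (transl (int m) T) (shift_by (int m) X)"
    using assms shift_by_loc_alg[OF assms(3)] by (simp add: stationary_def)
  moreover have "transl 1 (transl (int m) T) = transl (int (Suc m)) T" by (auto simp: image_image algebra_simps)
  moreover have "shift_mat (shift_by (int m) X) = shift_by (int (Suc m)) X"
    by (simp add: shift_mat_def shift_by_def algebra_simps)
  ultimately show ?case using Suc by simp
qed

lemma state_emb:
  assumes "is_state ks \<Psi>" "finite T'" "T \<subseteq> T'" "X \<in> loc_alg ks T"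
  shows "\<Psi> T' (emb ks T T' X) = \<Psi> T X"
proof -
  have "\<forall>T T' X. finite T' \<and> T \<subseteq> T' \<and> X \<in> loc_alg ks T \<longrightarrow> \<Psi> T' (emb ks T T' X) = \<Psi> T X"
    using assms(1) unfolding is_state_def by (rule conjunct2)
  then show ?thesis using assms(2-4) by (simp only: simp_thms)
qed

section \<open>Weighted resolutions\<close>

text \<open>Spectral form of an operator \<Sum> s F with trace at most 1. Strict positivity of the
  weights gives it a logarithm on the whole space and makes every state absolutely continuous with
  respect to it.\<close>

definition wresol :: "nat list \<Rightarrow> int set \<Rightarrow> 'j set \<Rightarrow> ('j \<Rightarrow> real) \<Rightarrow> ('j \<Rightarrow> lmat) \<Rightarrow> bool" where
  "wresol ks T J s F \<longleftrightarrow> resol (Conf ks T) J F \<and> (\<forall>j\<in>J. F j \<in> loc_alg ks T \<and> 0 < s j) \<and>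
     (\<Sum>j\<in>J. s j * hs (Conf ks T) (F j)) \<le> 1"

definition mean_log :: "'j set \<Rightarrow> ('j \<Rightarrow> real) \<Rightarrow> ('j \<Rightarrow> lmat) \<Rightarrow> (lmat \<Rightarrow> complex) \<Rightarrow> real" where
  "mean_log J s F \<omega> = (\<Sum>j\<in>J. ln (s j) * Re (\<omega> (F j)))"

lemma wresol_sh:
  assumes "wresol ks T J s F"
  shows "wresol ks (transl a T) J s (\<lambda>j. shift_by a (F j))"
  unfolding wresol_def resol_def
proof (intro conjI ballI)
  show "finite J" using assms by (simp add: wresol_def resol_def)
  show "(\<Sum>j\<in>J. shift_by a (F j)) = idm (Conf ks (transl a T))"
    using assms by (simp add: wresol_def resol_def shift_by_idm flip: shift_by_sum)
  show "(\<Sum>j\<in>J. s j * hs (Conf ks (transl a T)) (shift_by a (F j))) \<le> 1"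
    using assms by (simp add: wresol_def shift_by_hs)
  fix j assume j: "j \<in> J"
  have pj: "proj (Conf ks T) (F j)" and lj: "F j \<in> loc_alg ks T" using assms j by (auto simp: wresol_def resol_def)
  show l: "shift_by a (F j) \<in> loc_alg ks (transl a T)" by (rule shift_by_loc_alg[OF lj])
  show "proj (Conf ks (transl a T)) (shift_by a (F j))"
    unfolding proj_def shift_by_mm shift_by_adj using loc_alg_supported[OF l] projD[OF pj] by simp
  show "0 < s j" using assms j by (simp add: wresol_def)
qed

text \<open>The logarithm of a tensor product is the sum of the logarithms acting on the factors, so
  the mean logarithm is additive even for states that correlate the two regions. The labels are
  words of labels of single blocks, which keeps the type \<open>real list\<close> for any number of
  factors.\<close>

lemma wresol_ten:
  fixes J1 :: "real list set" and J2 :: "real set"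
  assumes w1: "wresol ks T1 J1 s1 F1" and w2: "wresol ks T2 J2 s2 F2"
    and dis: "T1 \<inter> T2 = {}" and fin: "finite T1" "finite T2"
  shows "\<exists>(J :: real list set) s F. wresol ks (T1 \<union> T2) J s F \<and>
    (\<forall>\<Psi>. is_state ks \<Psi> \<longrightarrow> mean_log J s F (\<Psi> (T1 \<union> T2)) = mean_log J1 s1 F1 (\<Psi> T1) + mean_log J2 s2 F2 (\<Psi> T2))"
proof -
  define J where "J = (\<lambda>p. snd p # fst p) ` (J1 \<times> J2)"
  define s where "s v = s1 (tl v) * s2 (hd v)" for v
  define F where "F v = tensor ks T1 T2 (F1 (tl v)) (F2 (hd v))" for v
  have f: "finite J1" "finite J2" using w1 w2 by (auto simp: wresol_def resol_def)
  have sumJ: "(\<Sum>v\<in>J. f v) = (\<Sum>w\<in>J1. \<Sum>a\<in>J2. f (a # w))" for f :: "real list \<Rightarrow> 'b::comm_monoid_add"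
  proof -
    have "inj_on (\<lambda>p. snd p # fst p) (J1 \<times> J2)" by (auto simp: inj_on_def)
    then have "(\<Sum>v\<in>J. f v) = (\<Sum>p\<in>J1 \<times> J2. f (snd p # fst p))" unfolding J_def by (simp only: sum.reindex o_def)
    then show ?thesis by (simp add: sum.cartesian_product case_prod_beta)
  qed
  have l1: "w \<in> J1 \<Longrightarrow> F1 w \<in> loc_alg ks T1" and l2: "a \<in> J2 \<Longrightarrow> F2 a \<in> loc_alg ks T2"
    and p1: "w \<in> J1 \<Longrightarrow> proj (Conf ks T1) (F1 w)" and p2: "a \<in> J2 \<Longrightarrow> proj (Conf ks T2) (F2 a)"
    and s1: "w \<in> J1 \<Longrightarrow> 0 < s1 w" and s2: "a \<in> J2 \<Longrightarrow> 0 < s2 a"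
    and i1: "(\<Sum>w\<in>J1. F1 w) = idm (Conf ks T1)" and i2: "(\<Sum>a\<in>J2. F2 a) = idm (Conf ks T2)" for w a
    using w1 w2 by (auto simp: wresol_def resol_def)
  have r1: "(\<Sum>w\<in>J1. tensor ks T1 T2 (F1 w) Y) = tensor ks T1 T2 (idm (Conf ks T1)) Y" for Y
    by (simp only: i1 flip: tensor_sum_left)
  have r2: "(\<Sum>a\<in>J2. tensor ks T1 T2 X (F2 a)) = tensor ks T1 T2 X (idm (Conf ks T2))" for X
    by (simp only: i2 flip: tensor_sum_right)
  have "wresol ks (T1 \<union> T2) J s F"
    unfolding wresol_def resol_def
  proof (intro conjI ballI)
    show "finite J" using f by (simp add: J_def)
    show "(\<Sum>v\<in>J. F v) = idm (Conf ks (T1 \<union> T2))"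
      unfolding sumJ F_def list.sel r2 r1 tensor_idm ..
    have "(\<Sum>v\<in>J. s v * hs (Conf ks (T1 \<union> T2)) (F v))
      = (\<Sum>w\<in>J1. s1 w * hs (Conf ks T1) (F1 w)) * (\<Sum>a\<in>J2. s2 a * hs (Conf ks T2) (F2 a))"
      unfolding sumJ F_def s_def list.sel tensor_hs[OF dis] sum_product by (simp only: mult_ac)
    also have "\<dots> \<le> 1 * 1"
    proof (rule mult_mono)
      show "0 \<le> (\<Sum>a\<in>J2. s2 a * hs (Conf ks T2) (F2 a))"
        by (intro sum_nonneg mult_nonneg_nonneg less_imp_le[OF s2]) auto
    qed (use w1 w2 in \<open>auto simp: wresol_def\<close>)
    finally show "(\<Sum>v\<in>J. s v * hs (Conf ks (T1 \<union> T2)) (F v)) \<le> 1" by simp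
    fix v assume "v \<in> J"
    then obtain w a where v: "v = a # w" "w \<in> J1" "a \<in> J2" by (auto simp: J_def)
    show l: "F v \<in> loc_alg ks (T1 \<union> T2)" using v l1 l2 by (simp add: F_def tensor_loc_alg)
    show "0 < s v" using v s1 s2 by (simp add: s_def)
    show "proj (Conf ks (T1 \<union> T2)) (F v)"
      unfolding proj_def
    proof (intro conjI)
      show "supported (Conf ks (T1 \<union> T2)) (F v)" by (rule loc_alg_supported[OF l])
      show "mm (Conf ks (T1 \<union> T2)) (F v) (F v) = F v"
        by (simp only: F_def tensor_mm[OF dis] v(1) list.sel projD(2)[OF p1[OF v(2)]] projD(2)[OF p2[OF v(3)]])
      show "adj (F v) = F v"
        by (simp only: F_def tensor_adj v(1) list.sel projD(3)[OF p1[OF v(2)]] projD(3)[OF p2[OF v(3)]])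
    qed
  qed
  moreover have "mean_log J s F (\<Psi> (T1 \<union> T2)) = mean_log J1 s1 F1 (\<Psi> T1) + mean_log J2 s2 F2 (\<Psi> T2)"
    if st: "is_state ks \<Psi>" for \<Psi>
  proof -
    have fT: "finite (T1 \<union> T2)" using fin by simp
    note ls = state_local[OF st fT]
    let ?g = "\<lambda>w a. Re (\<Psi> (T1 \<union> T2) (tensor ks T1 T2 (F1 w) (F2 a)))"
    have cons: "\<Psi> (T1 \<union> T2) (emb ks T (T1 \<union> T2) X) = \<Psi> T X" if "T \<subseteq> T1 \<union> T2" "X \<in> loc_alg ks T" for T X
      using state_emb[OF st fT that] .
    have g1: "(\<Sum>a\<in>J2. ?g w a) = Re (\<Psi> T1 (F1 w))" if w: "w \<in> J1" for w
    proof -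
      have "(\<Sum>a\<in>J2. \<Psi> (T1 \<union> T2) (tensor ks T1 T2 (F1 w) (F2 a))) = \<Psi> (T1 \<union> T2) (\<Sum>a\<in>J2. tensor ks T1 T2 (F1 w) (F2 a))"
        by (rule state_sum[OF fT ls, symmetric]) (use l1 l2 w in \<open>simp add: tensor_loc_alg\<close>)
      also have "\<dots> = \<Psi> T1 (F1 w)"
        unfolding r2 tensor_emb_left[OF dis, symmetric] by (rule cons) (use l1 w in auto)
      finally show ?thesis by (simp only: Re_sum[symmetric])
    qed
    have g2: "(\<Sum>w\<in>J1. ?g w a) = Re (\<Psi> T2 (F2 a))" if a: "a \<in> J2" for a
    proof -
      have "(\<Sum>w\<in>J1. \<Psi> (T1 \<union> T2) (tensor ks T1 T2 (F1 w) (F2 a))) = \<Psi> (T1 \<union> T2) (\<Sum>w\<in>J1. tensor ks T1 T2 (F1 w) (F2 a))"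
        by (rule state_sum[OF fT ls, symmetric]) (use l1 l2 a in \<open>simp add: tensor_loc_alg\<close>)
      also have "\<dots> = \<Psi> T2 (F2 a)"
        unfolding r1 tensor_emb_right[OF dis, symmetric] by (rule cons) (use l2 a in auto)
      finally show ?thesis by (simp only: Re_sum[symmetric])
    qed
    have "mean_log J s F (\<Psi> (T1 \<union> T2)) = (\<Sum>w\<in>J1. \<Sum>a\<in>J2. ln (s1 w) * ?g w a + ln (s2 a) * ?g w a)"
      unfolding mean_log_def sumJ
    proof (intro sum.cong refl)
      fix w a assume wa: "w \<in> J1" "a \<in> J2"
      have "ln (s (a # w)) = ln (s1 w) + ln (s2 a)"
        using ln_mult_pos[OF s1[OF wa(1)] s2[OF wa(2)]] by (simp add: s_def)
      then show "ln (s (a # w)) * Re (\<Psi> (T1 \<union> T2) (F (a # w))) = ln (s1 w) * ?g w a + ln (s2 a) * ?g w a"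
        by (simp add: F_def distrib_right)
    qed
    also have "\<dots> = (\<Sum>w\<in>J1. ln (s1 w) * (\<Sum>a\<in>J2. ?g w a)) + (\<Sum>w\<in>J1. \<Sum>a\<in>J2. ln (s2 a) * ?g w a)"
      by (simp only: sum.distrib sum_distrib_left)
    also have "(\<Sum>w\<in>J1. \<Sum>a\<in>J2. ln (s2 a) * ?g w a) = (\<Sum>a\<in>J2. \<Sum>w\<in>J1. ln (s2 a) * ?g w a)"
      by (rule sum.swap)
    also have "\<dots> = (\<Sum>a\<in>J2. ln (s2 a) * (\<Sum>w\<in>J1. ?g w a))" by (simp only: sum_distrib_left)
    also have "(\<Sum>w\<in>J1. ln (s1 w) * (\<Sum>a\<in>J2. ?g w a)) = mean_log J1 s1 F1 (\<Psi> T1)"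
      unfolding mean_log_def by (intro sum.cong refl) (simp add: g1)
    also have "(\<Sum>a\<in>J2. ln (s2 a) * (\<Sum>w\<in>J1. ?g w a)) = mean_log J2 s2 F2 (\<Psi> T2)"
      unfolding mean_log_def by (intro sum.cong refl) (simp add: g2)
    finally show ?thesis .
  qed
  ultimately show ?thesis by blast
qed

section \<open>Universal product resolutions\<close>

lemma card_Conf: "finite T \<Longrightarrow> card (Conf ks T) = card (blocks ks) ^ card T"
  unfolding Conf_def by (simp add: card_PiE)

lemma card_blocks_pos: "ks \<noteq> [] \<Longrightarrow> \<forall>k\<in>set ks. 0 < k \<Longrightarrow> 0 < card (blocks ks)"
proof -
  assume "ks \<noteq> []" "\<forall>k\<in>set ks. 0 < k"
  then have "(0, 0) \<in> blocks ks" by (simp add: blocks_def)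
  then show ?thesis using finite_blocks by (auto simp: card_gt_0_iff)
qed

lemma card_ivl [simp]: "card (ivl n) = n"
  by (simp add: ivl_def)

lemma wresol_trivial:
  assumes T: "finite T" and pos: "0 < card (Conf ks T)"
  shows "wresol ks T {j} (\<lambda>_. 1 / card (Conf ks T)) (\<lambda>_. idm (Conf ks T))"
  using pos finite_Conf[OF T, of ks]
  by (simp add: wresol_def resol_def proj_idm hs_idm)

text \<open>The interval is filled from the right by n div l translates of the block, which
  contribute equally by stationarity. Fewer than l sites remain; they carry the normalised trace, at
  a cost of at most l times the logarithm of the dimension of a site. The construction does not see
  \<Psi>, so one family serves all stationary states.\<close>

lemma wresol_power:
  fixes J :: "real set"
  assumes d: "0 < card (blocks ks)" and l: "0 < l" and w: "wresol ks (ivl l) J s F"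
  shows "\<exists>(J' :: real list set) s' F'. wresol ks (ivl n) J' s' F' \<and>
    (\<forall>\<Psi>. stationary ks \<Psi> \<longrightarrow> real (n div l) * mean_log J s F (\<Psi> (ivl l)) - l * ln (card (blocks ks))
       \<le> mean_log J' s' F' (\<Psi> (ivl n)))"
proof (induction n rule: less_induct)
  case (less n)
  show ?case
  proof (cases "n < l")
    case True
    let ?N = "card (Conf ks (ivl n))"
    have N: "0 < ?N" using d by (simp add: card_Conf)
    have "real (n div l) * mean_log J s F (\<Psi> (ivl l)) - l * ln (card (blocks ks))
       \<le> mean_log {[]} (\<lambda>_. 1 / ?N) (\<lambda>_. idm (Conf ks (ivl n))) (\<Psi> (ivl n))" if "stationary ks \<Psi>" for \<Psi>
    proof -
      have "is_state ks \<Psi>" using that by (simp add: stationary_def)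
      note one = state_one[OF finite_ivl state_local[OF this finite_ivl]]
      have "real n * ln (card (blocks ks)) \<le> real l * ln (card (blocks ks))"
        using True d by (intro mult_right_mono) auto
      moreover have "ln (1 / real ?N) = - (real n * ln (card (blocks ks)))"
        using d by (simp add: card_Conf ln_div ln_realpow)
      ultimately show ?thesis using True by (simp add: mean_log_def one)
    qed
    then show ?thesis using wresol_trivial[OF finite_ivl N, of "[]"] by blast
  next
    case False
    then have nl: "l \<le> n" by simp
    then have "n - l < n" using l by simp
    from less[OF this] obtain J1 :: "real list set" and s1 F1 where w1: "wresol ks (ivl (n - l)) J1 s1 F1"
      and x1: "\<forall>\<Psi>. stationary ks \<Psi> \<longrightarrow> real ((n - l) div l) * mean_log J s F (\<Psi> (ivl l)) - l * ln (card (blocks ks))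
       \<le> mean_log J1 s1 F1 (\<Psi> (ivl (n - l)))" by blast
    define a where "a = int (n - l)"
    have Tu: "ivl (n - l) \<union> transl a (ivl l) = ivl n" and dis: "ivl (n - l) \<inter> transl a (ivl l) = {}"
    proof -
      have t: "transl a (ivl l) = {a..<int n}"
      proof (intro equalityI subsetI)
        fix t assume "t \<in> {a..<int n}"
        then have "t - a \<in> ivl l" "t = (t - a) + a" using nl by (auto simp: ivl_def a_def)
        then show "t \<in> transl a (ivl l)" by blast
      qed (use nl in \<open>auto simp: ivl_def a_def\<close>)
      show "ivl (n - l) \<union> transl a (ivl l) = ivl n" "ivl (n - l) \<inter> transl a (ivl l) = {}"
        unfolding t using nl by (auto simp: ivl_def a_def)
    qed
    obtain J' :: "real list set" and s' F' where w': "wresol ks (ivl n) J' s' F'"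
      and x': "\<forall>\<Psi>. is_state ks \<Psi> \<longrightarrow> mean_log J' s' F' (\<Psi> (ivl n))
        = mean_log J1 s1 F1 (\<Psi> (ivl (n - l))) + mean_log J s (\<lambda>j. shift_by a (F j)) (\<Psi> (transl a (ivl l)))"
      using wresol_ten[OF w1 wresol_sh[OF w, of a] dis] unfolding Tu by auto
    have "real (n div l) * mean_log J s F (\<Psi> (ivl l)) - l * ln (card (blocks ks)) \<le> mean_log J' s' F' (\<Psi> (ivl n))"
      if st: "stationary ks \<Psi>" for \<Psi>
    proof -
      have "is_state ks \<Psi>" using st by (simp add: stationary_def)
      then have "mean_log J' s' F' (\<Psi> (ivl n)) = mean_log J1 s1 F1 (\<Psi> (ivl (n - l))) + mean_log J s (\<lambda>j. shift_by a (F j)) (\<Psi> (transl a (ivl l)))"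
        using x' by blast
      also have "mean_log J s (\<lambda>j. shift_by a (F j)) (\<Psi> (transl a (ivl l))) = mean_log J s F (\<Psi> (ivl l))"
        unfolding mean_log_def
      proof (rule sum.cong[OF refl])
        fix j assume "j \<in> J"
        then have "F j \<in> loc_alg ks (ivl l)" using w by (simp add: wresol_def)
        then show "ln (s j) * Re (\<Psi> (transl a (ivl l)) (shift_by a (F j))) = ln (s j) * Re (\<Psi> (ivl l) (F j))"
          unfolding a_def by (simp only: stationary_sh[OF st finite_ivl])
      qed
      finally have eq: "mean_log J' s' F' (\<Psi> (ivl n)) = mean_log J1 s1 F1 (\<Psi> (ivl (n - l))) + mean_log J s F (\<Psi> (ivl l))" .
      have "n div l = Suc ((n - l) div l)" using nl l by (simp add: div_if)
      then have "real (n div l) * mean_log J s F (\<Psi> (ivl l))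
          = real ((n - l) div l) * mean_log J s F (\<Psi> (ivl l)) + mean_log J s F (\<Psi> (ivl l))"
        by (simp add: distrib_right)
      moreover have "real ((n - l) div l) * mean_log J s F (\<Psi> (ivl l)) - l * ln (card (blocks ks))
          \<le> mean_log J1 s1 F1 (\<Psi> (ivl (n - l)))" using x1 st by blast
      ultimately show ?thesis unfolding eq by linarith
    qed
    then show ?thesis using w' by blast
  qed
qed

section \<open>A countable net of logarithms\<close>

definition log_mat :: "'j set \<Rightarrow> ('j \<Rightarrow> real) \<Rightarrow> ('j \<Rightarrow> lmat) \<Rightarrow> lmat" where
  "log_mat J s F = (\<Sum>j\<in>J. sm (of_real (ln (s j))) (F j))"

lemma log_mat_loc_alg: "wresol ks T J s F \<Longrightarrow> log_mat J s F \<in> loc_alg ks T"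
  unfolding log_mat_def wresol_def by (intro loc_alg_sum loc_alg_sm) auto

lemma mean_log_lgm:
  assumes T: "finite T" and st: "is_local_state ks T \<omega>" and w: "wresol ks T J s F"
  shows "mean_log J s F \<omega> = Re (\<omega> (log_mat J s F))"
proof -
  have l: "\<And>j. j \<in> J \<Longrightarrow> F j \<in> loc_alg ks T" using w by (simp add: wresol_def)
  have "\<omega> (log_mat J s F) = (\<Sum>j\<in>J. \<omega> (sm (of_real (ln (s j))) (F j)))"
    unfolding log_mat_def by (rule state_sum[OF T st]) (rule loc_alg_sm[OF l])
  also have "\<dots> = (\<Sum>j\<in>J. of_real (ln (s j)) * \<omega> (F j))"
    by (intro sum.cong refl state_sm[OF T st] l)
  finally show ?thesis by (simp add: mean_log_def)
qed

type_synonym wdata = "real set \<times> (real \<Rightarrow> real) \<times> (real \<Rightarrow> lmat)"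

definition log_wdata :: "wdata \<Rightarrow> lmat" where
  "log_wdata r = log_mat (fst r) (fst (snd r)) (snd (snd r))"

definition wdata_set :: "nat list \<Rightarrow> nat \<Rightarrow> wdata set" where
  "wdata_set ks l = {r. wresol ks (ivl l) (fst r) (fst (snd r)) (snd (snd r))}"

text \<open>Over each block length a logarithm has finitely many entries in its support, so cutting
  the entries into cells of width 1 / N leaves countably many cells. One weighted resolution is
  chosen for each cell that contains the logarithm of one. Closeness is measured for logarithms
  because the mean logarithm is linear in them.\<close>

lemma wdata_net:
  assumes d: "0 < card (blocks ks)"
  shows "\<exists>R :: nat \<Rightarrow> nat \<times> wdata. (\<forall>k. 0 < fst (R k) \<and> snd (R k) \<in> wdata_set ks (fst (R k))) \<and>
    (\<forall>l r. \<forall>\<delta>>0. 0 < l \<and> r \<in> wdata_set ks l \<longrightarrow>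
      (\<exists>k. fst (R k) = l \<and> (\<forall>\<sigma> \<tau>. cmod (log_wdata (snd (R k)) \<sigma> \<tau> - log_wdata r \<sigma> \<tau>) \<le> \<delta>)))"
proof -
  define key :: "nat \<Rightarrow> nat \<Rightarrow> wdata \<Rightarrow> cfg \<times> cfg \<Rightarrow> int \<times> int" where
    "key l N r = restrict (\<lambda>p. (\<lfloor>real N * Re (log_wdata r (fst p) (snd p))\<rfloor>, \<lfloor>real N * Im (log_wdata r (fst p) (snd p))\<rfloor>))
       (Conf ks (ivl l) \<times> Conf ks (ivl l))" for l N r
  have key: "key l N r \<in> PiE (Conf ks (ivl l) \<times> Conf ks (ivl l)) (\<lambda>_. UNIV)" for l N r
    unfolding key_def by (intro restrict_PiE_iff[THEN iffD2] ballI UNIV_I)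
  define A where "A = {(l, N, key l N r) | l N r. 0 < l \<and> r \<in> wdata_set ks l}"
  have "A \<subseteq> (SIGMA l:UNIV. SIGMA N:UNIV. PiE (Conf ks (ivl l) \<times> Conf ks (ivl l)) (\<lambda>_. UNIV))"
    unfolding A_def using key by blast
  moreover have "countable (SIGMA l:(UNIV::nat set). SIGMA N:(UNIV::nat set).
      PiE (Conf ks (ivl l) \<times> Conf ks (ivl l)) (\<lambda>_. UNIV :: (int \<times> int) set))"
    by (intro countable_SIGMA countable_PiE) (auto simp: finite_Conf)
  ultimately have cA: "countable A" by (rule countable_subset)
  \<comment> \<open>The normalised trace on one site shows that there is a cell at all;
    \<open>from_nat_into\<close> enumerates only nonempty sets.\<close>
  have "(1, 0, key 1 0 ({0}, (\<lambda>_. 1 / card (Conf ks (ivl 1))), (\<lambda>_. idm (Conf ks (ivl 1))))) \<in> A"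
    unfolding A_def wdata_set_def
    using wresol_trivial[OF finite_ivl, of ks 1 "0::real"] d by (auto simp: card_Conf)
  then have neA: "A \<noteq> {}" by blast
  define pick where "pick a = (SOME r. r \<in> wdata_set ks (fst a) \<and> key (fst a) (fst (snd a)) r = snd (snd a))" for a
  have pick: "pick a \<in> wdata_set ks (fst a) \<and> key (fst a) (fst (snd a)) (pick a) = snd (snd a)" if "a \<in> A" for a
  proof -
    have "\<exists>r. r \<in> wdata_set ks (fst a) \<and> key (fst a) (fst (snd a)) r = snd (snd a)"
      using that unfolding A_def by fastforce
    then show ?thesis unfolding pick_def by (rule someI_ex)
  qed
  have posA: "0 < fst a" if "a \<in> A" for a using that by (auto simp: A_def)
  define R where "R k = (fst (from_nat_into A k), pick (from_nat_into A k))" for k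
  have inA: "from_nat_into A k \<in> A" for k by (rule from_nat_into[OF neA])
  have "0 < fst (R k) \<and> snd (R k) \<in> wdata_set ks (fst (R k))" for k
    using posA[OF inA] pick[OF inA] by (simp add: R_def)
  moreover have "\<exists>k. fst (R k) = l \<and> (\<forall>\<sigma> \<tau>. cmod (log_wdata (snd (R k)) \<sigma> \<tau> - log_wdata r \<sigma> \<tau>) \<le> \<delta>)"
    if \<delta>: "0 < \<delta>" and l: "0 < l" and r: "r \<in> wdata_set ks l" for l r and \<delta> :: real
  proof -
    obtain N :: nat where N: "2 / \<delta> < real N" using reals_Archimedean2 by blast
    then have N0: "0 < real N" using \<delta> by (meson divide_pos_pos order_less_trans zero_less_numeral)
    let ?a = "(l, N, key l N r)"
    have aA: "?a \<in> A" using l r unfolding A_def by blast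
    obtain k where k: "from_nat_into A k = ?a" using from_nat_into_surj[OF cA aA] by blast
    define r' where "r' = snd (R k)"
    have fk: "fst (R k) = l" and r': "r' \<in> wdata_set ks l" and keq: "key l N r' = key l N r"
      using pick[OF aA] k by (auto simp: R_def r'_def)
    have "cmod (log_wdata r' \<sigma> \<tau> - log_wdata r \<sigma> \<tau>) \<le> \<delta>" for \<sigma> \<tau>
    proof (cases "\<sigma> \<in> Conf ks (ivl l) \<and> \<tau> \<in> Conf ks (ivl l)")
      case True
      have "key l N r' (\<sigma>, \<tau>) = key l N r (\<sigma>, \<tau>)" using keq by simp
      then have fl: "\<lfloor>real N * Re (log_wdata r' \<sigma> \<tau>)\<rfloor> = \<lfloor>real N * Re (log_wdata r \<sigma> \<tau>)\<rfloor>"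
        "\<lfloor>real N * Im (log_wdata r' \<sigma> \<tau>)\<rfloor> = \<lfloor>real N * Im (log_wdata r \<sigma> \<tau>)\<rfloor>"
        using True by (auto simp: key_def)
      have flx: "\<bar>x - y\<bar> \<le> 1 / real N" if "\<lfloor>real N * x\<rfloor> = \<lfloor>real N * y\<rfloor>" for x y
      proof -
        have "\<bar>real N * x - real N * y\<bar> \<le> 1" using that by linarith
        then have "real N * \<bar>x - y\<bar> \<le> 1" by (simp add: abs_mult flip: right_diff_distrib)
        then show ?thesis using N0 by (simp add: pos_le_divide_eq mult.commute)
      qed
      have "cmod (log_wdata r' \<sigma> \<tau> - log_wdata r \<sigma> \<tau>) \<le> \<bar>Re (log_wdata r' \<sigma> \<tau> - log_wdata r \<sigma> \<tau>)\<bar> + \<bar>Im (log_wdata r' \<sigma> \<tau> - log_wdata r \<sigma> \<tau>)\<bar>"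
        by (rule cmod_le)
      also have "\<dots> \<le> 1 / real N + 1 / real N"
        using flx[OF fl(1)] flx[OF fl(2)] by simp
      also have "\<dots> \<le> \<delta>" using N N0 \<delta> by (simp add: field_simps)
      finally show ?thesis .
    next
      case False
      have "log_wdata q \<in> loc_alg ks (ivl l)" if "q \<in> wdata_set ks l" for q
        using that log_mat_loc_alg unfolding wdata_set_def log_wdata_def by blast
      then have "log_wdata q \<sigma> \<tau> = 0" if "q \<in> wdata_set ks l" for q
        using that False unfolding loc_alg_iff supported_def by blast
      then show ?thesis using r r' \<delta> by simp
    qed
    then show ?thesis using fk unfolding r'_def by blast
  qed
  ultimately show ?thesis by blast
qed


text \<open>The relative entropy is minus the entropy of the state minus its mean logarithm; only
  the latter depends on the resolution.\<close>

lemma ns_entropy_xlog: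
  assumes T: "finite T" and sd: "sdata ks T \<omega> C E" and w: "wresol ks T J s F"
  shows "ns_entropy (Conf ks T) C (\<lambda>c. c) E J s F = (\<Sum>c\<in>C. c * ln c * hs (Conf ks T) (E c)) - mean_log J s F \<omega>"
proof -
  have F: "resol (Conf ks T) J F" using w by (simp add: wresol_def)
  have "(\<Sum>d\<in>J. ln (s d) * (\<Sum>c\<in>C. c * hs (Conf ks T) (mm (Conf ks T) (F d) (E c)))) = mean_log J s F \<omega>"
    unfolding mean_log_def
  proof (rule sum.cong[OF refl])
    fix d assume d: "d \<in> J"
    have "proj (Conf ks T) (F d)" "F d \<in> loc_alg ks T" using w d by (auto simp: wresol_def resol_def)
    then show "ln (s d) * (\<Sum>c\<in>C. c * hs (Conf ks T) (mm (Conf ks T) (F d) (E c))) = ln (s d) * Re (\<omega> (F d))"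
      by (simp only: sdata_proj[OF T sd])
  qed
  then show ?thesis by (simp only: ns_entropy_split[OF finite_Conf[OF T] sdata_resol[OF sd] F])
qed

lemma sdata_eigen:
  assumes T: "finite T" and sd: "sdata ks T \<omega> C E" and c: "c \<in> C"
  shows "Re (\<omega> (E c)) = c * hs (Conf ks T) (E c)"
proof -
  have sp: "spectral (Conf ks T) (density ks T \<omega>) C E" using sd by (simp add: sdata_def)
  have "E c \<in> loc_alg ks T" using sd c by (simp add: sdata_def)
  then have "Re (\<omega> (E c)) = (\<Sum>d\<in>C. d * hs (Conf ks T) (mm (Conf ks T) (E c) (E d)))"
    by (rule sdata_proj[OF T sd spectral_pr[OF T sp c]])
  also have "\<dots> = (\<Sum>d\<in>C. if d = c then c * hs (Conf ks T) (E c) else 0)"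
    by (intro sum.cong refl) (auto simp: spectral_mm[OF T sp c])
  finally show ?thesis using c spectral_fin[OF T sp] by simp
qed

text \<open>The density of a state may be singular. Halving its eigenvalues frees half of the mass,
  which suffices for the weight 1 / (2 dim) on the kernel. As the state does not charge the kernel,
  the price is exactly \<open>ln 2\<close>.\<close>

lemma sdata_wres:
  assumes T: "finite T" and sd: "sdata ks T \<omega> C E" and N: "0 < card (Conf ks T)"
  defines "s \<equiv> \<lambda>c. if 0 < c then c / 2 else 1 / (2 * card (Conf ks T))"
  shows "wresol ks T C s E"
    and "mean_log C s E \<omega> = (\<Sum>c\<in>C. c * ln c * hs (Conf ks T) (E c)) - ln 2"
proof -
  let ?I = "Conf ks T"
  have r: "resol ?I C E" by (rule sdata_resol[OF sd])
  have s1: "(\<Sum>c\<in>C. c * hs ?I (E c)) = 1" and nn: "\<And>c. c \<in> C \<Longrightarrow> 0 \<le> c"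
    and loc: "\<And>c. c \<in> C \<Longrightarrow> E c \<in> loc_alg ks T"
    using sd by (auto simp: sdata_def)
  have "(\<Sum>c\<in>C. hs ?I (E c)) = (\<Sum>c\<in>C. hs ?I (mm ?I (E c) (idm ?I)))"
    using finite_Conf[OF T] by (simp add: hs_idm_mm)
  also have "\<dots> = real (card ?I)"
    using resol_hs_left[OF finite_Conf[OF T] r, of "idm ?I"] by (simp add: hs_idm finite_Conf[OF T])
  finally have hsum: "(\<Sum>c\<in>C. hs ?I (E c)) = real (card ?I)" .
  have "(\<Sum>c\<in>C. s c * hs ?I (E c)) \<le> (\<Sum>c\<in>C. c * hs ?I (E c) * (1 / 2) + hs ?I (E c) * (1 / real (2 * card ?I)))"
  proof (rule sum_mono)
    fix c assume c: "c \<in> C"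
    have "0 \<le> hs ?I (E c) * (1 / real (2 * card ?I))" by simp
    moreover have "0 \<le> c * hs ?I (E c)" using nn[OF c] by simp
    ultimately show "s c * hs ?I (E c) \<le> c * hs ?I (E c) * (1 / 2) + hs ?I (E c) * (1 / real (2 * card ?I))"
      by (simp add: s_def)
  qed
  also have "\<dots> = 1 * (1 / 2) + real (card ?I) * (1 / real (2 * card ?I))"
    unfolding sum.distrib by (simp only: s1 hsum flip: sum_distrib_right)
  also have "\<dots> = 1" using N by simp
  finally show "wresol ks T C s E"
    using r loc N by (simp add: wresol_def s_def)
  have "mean_log C s E \<omega> = (\<Sum>c\<in>C. c * ln c * hs ?I (E c) - ln 2 * (c * hs ?I (E c)))"
    unfolding mean_log_def
  proof (rule sum.cong[OF refl])
    fix c assume c: "c \<in> C"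
    show "ln (s c) * Re (\<omega> (E c)) = c * ln c * hs ?I (E c) - ln 2 * (c * hs ?I (E c))"
    proof (cases "0 < c")
      case True
      then show ?thesis by (simp add: sdata_eigen[OF T sd c] s_def ln_div algebra_simps)
    next
      case False
      then have "c = 0" using nn[OF c] by simp
      then show ?thesis using sdata_eigen[OF T sd c] by simp
    qed
  qed
  also have "\<dots> = (\<Sum>c\<in>C. c * ln c * hs ?I (E c)) - ln 2 * (\<Sum>c\<in>C. c * hs ?I (E c))"
    by (simp only: sum_subtractf sum_distrib_left)
  finally show "mean_log C s E \<omega> = (\<Sum>c\<in>C. c * ln c * hs ?I (E c)) - ln 2" by (simp add: s1)
qed

text \<open>The quantifiers are the point: the resolutions are fixed before \<Psi> and \<delta>,
  which determine only the index k and the constant c. Let h be the infimum of the entropy per site.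
  A good block and a nearby member of the net give a mean logarithm of at least - n (h + \<delta>)
  up to a constant, whereas the entropy of n sites is at least n h - ln 2. The terms n h
  cancel.\<close>

lemma universal_resolutions:
  assumes d: "0 < card (blocks ks)"
  shows "\<exists>(J :: nat \<Rightarrow> nat \<Rightarrow> real list set) s F. (\<forall>k n. wresol ks (ivl n) (J k n) (s k n) (F k n)) \<and>
    (\<forall>\<Psi> \<delta>. stationary ks \<Psi> \<and> 0 < \<delta> \<longrightarrow> (\<exists>k c. \<forall>n. \<exists>C E. sdata ks (ivl n) (\<Psi> (ivl n)) C E \<and>
       ns_entropy (Conf ks (ivl n)) C (\<lambda>c. c) E (J k n) (s k n) (F k n) \<le> \<delta> * real n + c))"
proof -
  obtain R :: "nat \<Rightarrow> nat \<times> wdata" where R: "\<And>k. 0 < fst (R k)" "\<And>k. snd (R k) \<in> wdata_set ks (fst (R k))"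
    and net: "\<And>l r \<delta>. 0 < \<delta> \<Longrightarrow> 0 < l \<Longrightarrow> r \<in> wdata_set ks l \<Longrightarrow>
      \<exists>k. fst (R k) = l \<and> (\<forall>\<sigma> \<tau>. cmod (log_wdata (snd (R k)) \<sigma> \<tau> - log_wdata r \<sigma> \<tau>) \<le> \<delta>)"
    using wdata_net[OF d] by metis
  define b where "b = ln (real (card (blocks ks)))"
  define xr where "xr k \<Psi> = mean_log (fst (snd (R k))) (fst (snd (snd (R k)))) (snd (snd (snd (R k)))) (\<Psi> (ivl (fst (R k))))"
    for k and \<Psi> :: qstate
  define P where "P k n q \<longleftrightarrow> wresol ks (ivl n) (fst q) (fst (snd q)) (snd (snd q)) \<and>
    (\<forall>\<Psi>. stationary ks \<Psi> \<longrightarrow> real (n div fst (R k)) * xr k \<Psi> - fst (R k) * b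
       \<le> mean_log (fst q) (fst (snd q)) (snd (snd q)) (\<Psi> (ivl n)))"
    for k n and q :: "real list set \<times> (real list \<Rightarrow> real) \<times> (real list \<Rightarrow> lmat)"
  have "\<exists>q. P k n q" for k n
  proof -
    have "wresol ks (ivl (fst (R k))) (fst (snd (R k))) (fst (snd (snd (R k)))) (snd (snd (snd (R k))))"
      using R(2)[of k] by (simp add: wdata_set_def)
    from wresol_power[OF d R(1) this, of n] obtain J' :: "real list set" and s' F' where
      "wresol ks (ivl n) J' s' F'"
      "\<forall>\<Psi>. stationary ks \<Psi> \<longrightarrow> real (n div fst (R k)) * xr k \<Psi> - fst (R k) * b \<le> mean_log J' s' F' (\<Psi> (ivl n))"
      unfolding xr_def b_def by blast
    then have "P k n (J', s', F')" by (simp add: P_def)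
    then show ?thesis by blast
  qed
  then obtain Q where Q: "\<And>k n. P k n (Q k n)" by metis
  define J s F where "J k n = fst (Q k n)" and "s k n = fst (snd (Q k n))" and "F k n = snd (snd (Q k n))" for k n
  have w: "wresol ks (ivl n) (J k n) (s k n) (F k n)" for k n
    using Q[of k n] by (simp add: P_def J_def s_def F_def)
  have x: "real (n div fst (R k)) * xr k \<Psi> - fst (R k) * b \<le> mean_log (J k n) (s k n) (F k n) (\<Psi> (ivl n))"
    if "stationary ks \<Psi>" for k n \<Psi>
    using Q[of k n] that by (simp add: P_def J_def s_def F_def)
  have "\<exists>k c. \<forall>n. \<exists>C E. sdata ks (ivl n) (\<Psi> (ivl n)) C E \<and>
       ns_entropy (Conf ks (ivl n)) C (\<lambda>c. c) E (J k n) (s k n) (F k n) \<le> \<delta> * real n + c"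
    if st: "stationary ks \<Psi>" and \<delta>: "0 < \<delta>" for \<Psi> and \<delta> :: real
  proof -
    have iss: "is_state ks \<Psi>" using st by (simp add: stationary_def)
    have "\<forall>n. \<exists>q. sdata ks (ivl n) (\<Psi> (ivl n)) (fst q) (snd q)"
      using sdata_exists[OF finite_ivl state_local[OF iss finite_ivl]] by simp
    then obtain q where q: "\<And>n. sdata ks (ivl n) (\<Psi> (ivl n)) (fst (q n)) (snd (q n))" by metis
    define C E where "C n = fst (q n)" and "E n = snd (q n)" for n
    have sd: "sdata ks (ivl n) (\<Psi> (ivl n)) (C n) (E n)" for n using q by (simp add: C_def E_def)
    define H where "H n = - (\<Sum>c\<in>C n. c * ln c * hs (Conf ks (ivl n)) (E n c))" for n
    have H0: "0 \<le> H n" for n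
    proof -
      have "c * ln c * hs (Conf ks (ivl n)) (E n c) \<le> 0" if "c \<in> C n" for c
      proof -
        have "0 \<le> c" "c \<le> 1" using sd[of n] that by (auto simp: sdata_def)
        then have "c * ln c \<le> 0" by (cases "c = 0") (auto intro!: mult_nonneg_nonpos)
        then show ?thesis by (simp add: mult_nonpos_nonneg)
      qed
      then show ?thesis unfolding H_def by (simp add: sum_nonpos)
    qed
    \<comment> \<open>The \<open>ln 2\<close> is the price of making the block density invertible.
      Since h is an infimum over all lengths, n h \<le> H n + ln 2 holds for every n.\<close>
    define h where "h = Inf ((\<lambda>l. (H l + ln 2) / real l) ` {1..})"
    have bdd: "bdd_below ((\<lambda>l. (H l + ln 2) / real l) ` {1..})"
      by (rule bdd_belowI[of _ 0]) (auto intro!: divide_nonneg_nonneg add_nonneg_nonneg H0)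
    have h0: "0 \<le> h"
      unfolding h_def by (rule cInf_greatest) (auto intro!: divide_nonneg_nonneg add_nonneg_nonneg H0)
    have hn: "real n * h \<le> H n + ln 2" for n
    proof (cases "n = 0")
      case True
      then show ?thesis using H0[of n] by simp
    next
      case False
      then have "h \<le> (H n + ln 2) / real n" unfolding h_def by (intro cInf_lower[OF _ bdd]) auto
      then show ?thesis using False by (simp add: pos_le_divide_eq mult.commute)
    qed
    have "\<exists>l\<in>{1..}. (H l + ln 2) / real l < h + \<delta> / 2"
      using cInf_lessD[of "(\<lambda>l. (H l + ln 2) / real l) ` {1..}" "h + \<delta> / 2"] \<delta> by (auto simp: h_def)
    then obtain l :: nat where l: "0 < l" and hl: "(H l + ln 2) / real l < h + \<delta> / 2"
      by (metis atLeast_iff less_eq_Suc_le One_nat_def)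
    let ?I = "Conf ks (ivl l)" and ?D = "density ks (ivl l) (\<Psi> (ivl l))"
    have N: "0 < card ?I" using d by (simp add: card_Conf)
    note own = sdata_wres[OF finite_ivl sd N]
    define s0 where "s0 = (\<lambda>c. if 0 < c then c / 2 else 1 / real (2 * card ?I))"
    define r0 :: wdata where "r0 = (C l, s0, E l)"
    have r0: "r0 \<in> wdata_set ks l" using own(1) by (simp add: wdata_set_def r0_def s0_def)
    define K where "K = (\<Sum>\<sigma>\<in>?I. \<Sum>\<rho>\<in>?I. cmod (?D \<sigma> \<rho>))"
    have K0: "0 \<le> K" unfolding K_def by (intro sum_nonneg) simp
    \<comment> \<open>Entrywise distance \<epsilon> changes the expectation by at most K \<epsilon>,
      and 1 + K is a positive denominator.\<close>
    define \<epsilon> where "\<epsilon> = (\<delta> / 2) / (1 + K)"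
    have \<epsilon>: "0 < \<epsilon>" using \<delta> K0 by (simp add: \<epsilon>_def)
    obtain k where k: "fst (R k) = l" and near: "\<And>\<sigma> \<tau>. cmod (log_wdata (snd (R k)) \<sigma> \<tau> - log_wdata r0 \<sigma> \<tau>) \<le> \<epsilon>"
      using net[OF \<epsilon> l r0] by blast
    have stl: "is_local_state ks (ivl l) (\<Psi> (ivl l))" by (rule state_local[OF iss finite_ivl])
    have wl: "log_wdata r \<in> loc_alg ks (ivl l)" if "r \<in> wdata_set ks l" for r
      using that log_mat_loc_alg unfolding wdata_set_def log_wdata_def by blast
    have xw: "mean_log (fst r) (fst (snd r)) (snd (snd r)) (\<Psi> (ivl l)) = Re (\<Psi> (ivl l) (log_wdata r))" if "r \<in> wdata_set ks l" for r
      unfolding log_wdata_def by (rule mean_log_lgm[OF finite_ivl stl]) (use that in \<open>simp add: wdata_set_def\<close>)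
    have Rk: "snd (R k) \<in> wdata_set ks l" using R(2)[of k] k by simp
    have xk: "xr k \<Psi> = Re (\<Psi> (ivl l) (log_wdata (snd (R k))))" using xw[OF Rk] by (simp add: xr_def k)
    have "mean_log (C l) s0 (E l) (\<Psi> (ivl l)) = - H l - ln 2"
      using own(2) by (simp add: H_def s0_def)
    then have x0: "Re (\<Psi> (ivl l) (log_wdata r0)) = - H l - ln 2" using xw[OF r0] by (simp add: r0_def)
    let ?X = "log_wdata r0 - log_wdata (snd (R k))"
    have "\<Psi> (ivl l) ?X = tr ?I (mm ?I ?D ?X)"
      by (rule density_props(2)[OF finite_ivl stl loc_alg_diff[OF wl[OF r0] wl[OF Rk]]])
    also have "cmod \<dots> \<le> (\<Sum>\<sigma>\<in>?I. \<Sum>\<rho>\<in>?I. cmod (?D \<sigma> \<rho>) * \<epsilon>)"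
      unfolding tr_def mm_def
    proof (intro order_trans[OF norm_sum] sum_mono)
      fix \<sigma> \<rho>
      show "cmod (?D \<sigma> \<rho> * ?X \<rho> \<sigma>) \<le> cmod (?D \<sigma> \<rho>) * \<epsilon>"
        unfolding norm_mult minus_apply
        by (rule mult_left_mono) (use near[of \<rho> \<sigma>] in \<open>simp_all add: norm_minus_commute\<close>)
    qed
    also have "\<dots> = K * \<epsilon>" by (simp only: K_def sum_distrib_right)
    also have "\<dots> \<le> \<delta> / 2"
    proof -
      have "K * \<epsilon> \<le> (1 + K) * \<epsilon>" using \<epsilon> by (intro mult_right_mono) auto
      also have "\<dots> = \<delta> / 2"
        unfolding \<epsilon>_def using K0 by (intro nonzero_mult_div_cancel_left[of "1 + K" "\<delta> / 2", folded times_divide_eq_right]) simp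
      finally show ?thesis .
    qed
    finally have "Re (\<Psi> (ivl l) ?X) \<le> \<delta> / 2" using complex_Re_le_cmod order_trans by blast
    then have "- xr k \<Psi> \<le> H l + ln 2 + \<delta> / 2"
      using x0 xk state_diff[OF finite_ivl stl wl[OF r0] wl[OF Rk]] by simp
    also have "\<dots> \<le> real l * (h + \<delta>)"
    proof -
      have "H l + ln 2 < (h + \<delta> / 2) * real l" using hl l by (simp add: pos_divide_less_eq)
      moreover have "\<delta> / 2 \<le> \<delta> / 2 * real l" using \<delta> l by simp
      ultimately show ?thesis by (simp add: algebra_simps)
    qed
    finally have xk': "- xr k \<Psi> \<le> real l * (h + \<delta>)" .
    have "ns_entropy (Conf ks (ivl n)) (C n) (\<lambda>c. c) (E n) (J k n) (s k n) (F k n) \<le> \<delta> * real n + (l * b + ln 2)" for n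
    proof -
      have "ns_entropy (Conf ks (ivl n)) (C n) (\<lambda>c. c) (E n) (J k n) (s k n) (F k n) = - H n - mean_log (J k n) (s k n) (F k n) (\<Psi> (ivl n))"
        unfolding H_def by (subst ns_entropy_xlog[OF finite_ivl sd w]) simp
      also have "\<dots> \<le> - H n + real (n div l) * (- xr k \<Psi>) + l * b"
        using x[OF st, of n k] k by simp
      also have "real (n div l) * (- xr k \<Psi>) \<le> real (n div l) * (real l * (h + \<delta>))"
        using xk' by (intro mult_left_mono) auto
      also have "\<dots> = real (n div l * l) * (h + \<delta>)" by simp
      \<comment> \<open>Rounding n down to a multiple of l is harmless because h + \<delta> \<ge>
        0.\<close>
      also have "\<dots> \<le> real n * (h + \<delta>)"
        using h0 \<delta> by (intro mult_right_mono of_nat_mono div_times_less_eq_dividend) auto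
      also have "\<dots> = real n * h + \<delta> * real n" by (simp add: algebra_simps)
      finally show ?thesis using hn[of n] by simp
    qed
    then show ?thesis using sd by blast
  qed
  then show ?thesis using w by blast
qed

section \<open>A Neyman--Pearson projection for the pinched universal operator\<close>

text \<open>Applied to the bins of eigenvalues of the density and to the positive part of the
  Neyman--Pearson operator.\<close>

lemma spectral_subsum:
  assumes I: "finite I" and sp: "spectral I M C E" and S: "S \<subseteq> C"
  shows "proj I (\<Sum>c\<in>S. E c)"
    and "c \<in> C \<Longrightarrow> mm I (E c) (\<Sum>c\<in>S. E c) = (if c \<in> S then E c else 0)"
    and "hs I (mm I (\<Sum>c\<in>S. E c) Y) = (\<Sum>c\<in>S. hs I (mm I (E c) Y))"
    and "supported I X \<Longrightarrow> mm I M X = mm I X M \<Longrightarrow> mm I (\<Sum>c\<in>S. E c) X = mm I X (\<Sum>c\<in>S. E c)"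
proof -
  have finC: "finite C" and pr: "\<And>c. c \<in> C \<Longrightarrow> proj I (E c)"
    and orth: "\<And>c d. c \<in> C \<Longrightarrow> d \<in> C \<Longrightarrow> mm I (E c) (E d) = (if d = c then E c else 0)"
    using sp by (auto simp: spectral_def resol_def projD(2))
  have finS: "finite S" using S finC by (rule finite_subset)
  have e: "mm I (E c) (\<Sum>c\<in>S. E c) = (if c \<in> S then E c else 0)" if c: "c \<in> C" for c
  proof -
    have "mm I (E c) (\<Sum>c\<in>S. E c) = (\<Sum>d\<in>S. if d = c then E c else 0)"
      unfolding mm_sum_right by (intro sum.cong refl orth c) (use S in blast)
    then show ?thesis using finS by simp
  qed
  then show "c \<in> C \<Longrightarrow> mm I (E c) (\<Sum>c\<in>S. E c) = (if c \<in> S then E c else 0)" .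
  have "mm I (\<Sum>c\<in>S. E c) (\<Sum>c\<in>S. E c) = (\<Sum>c\<in>S. mm I (E c) (\<Sum>c\<in>S. E c))" by (rule mm_sum_left)
  also have "\<dots> = (\<Sum>c\<in>S. E c)" by (intro sum.cong refl) (use e S in auto)
  finally have idem: "mm I (\<Sum>c\<in>S. E c) (\<Sum>c\<in>S. E c) = (\<Sum>c\<in>S. E c)" .
  have "adj (\<Sum>c\<in>S. E c) = (\<Sum>c\<in>S. E c)"
    unfolding adj_sum by (intro sum.cong refl projD(3)[OF pr]) (use S in blast)
  moreover have "supported I (\<Sum>c\<in>S. E c)" by (intro supported_sum projD(1)[OF pr]) (use S in blast)
  ultimately show p: "proj I (\<Sum>c\<in>S. E c)" using idem by (simp add: proj_def)
  have "hs I (mm I (\<Sum>c\<in>S. E c) Y) = Re (tr I (mm I (adj Y) (mm I (\<Sum>c\<in>S. E c) Y)))" by (rule hs_proj_left[OF p])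
  also have "\<dots> = (\<Sum>c\<in>S. Re (tr I (mm I (adj Y) (mm I (E c) Y))))"
    by (simp only: mm_sum_left mm_sum_right tr_sum Re_sum)
  also have "\<dots> = (\<Sum>c\<in>S. hs I (mm I (E c) Y))"
    by (intro sum.cong refl hs_proj_left[symmetric] pr) (use S in blast)
  finally show "hs I (mm I (\<Sum>c\<in>S. E c) Y) = (\<Sum>c\<in>S. hs I (mm I (E c) Y))" .
  assume X: "supported I X" "mm I M X = mm I X M"
  have "mm I (E c) X = mm I X (E c)" if "c \<in> C" for c
    using sp X that unfolding spectral_def by blast
  then show "mm I (\<Sum>c\<in>S. E c) X = mm I X (\<Sum>c\<in>S. E c)"
    unfolding mm_sum_left mm_sum_right by (intro sum.cong refl) (use S in blast)
qed

lemma quadratic_form_sum: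
  assumes "\<And>j. j \<in> J \<Longrightarrow> proj I (F j)"
  shows "Re (tr I (mm I (adj Y) (mm I (\<Sum>j\<in>J. sm (of_real (s j)) (F j)) Y))) = (\<Sum>j\<in>J. s j * hs I (mm I (F j) Y))"
proof -
  have "Re (tr I (mm I (adj Y) (mm I (\<Sum>j\<in>J. sm (of_real (s j)) (F j)) Y)))
      = (\<Sum>j\<in>J. s j * Re (tr I (mm I (adj Y) (mm I (F j) Y))))"
    by (simp add: mm_sum_left mm_sum_right mm_sm_left mm_sm_right tr_sum tr_sm)
  also have "\<dots> = (\<Sum>j\<in>J. s j * hs I (mm I (F j) Y))"
    by (intro sum.cong refl) (simp add: hs_proj_left assms)
  finally show ?thesis .
qed

text \<open>Let FP be the density with its eigenvalues rounded up, W the sum of all given operators,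
  PW its pinching, and p the positive spectral projection of PW - A FP. Then A \<phi>(p) \<le> A Tr
  (FP p) \<le> Tr (PW p) \<le> Tr W \<le> m + 1. For Z = (1 - p) q the pinching inequality replaces
  W by PW at a cost of B + 1; on the range of 1 - p, PW is at most A FP; and since p commutes with
  the bins, the form of FP at Z is at most the one at q.\<close>

lemma pinched_test:
  fixes m B :: nat
  assumes T: "finite T" and sd: "sdata ks T \<phi> C E"
    and w: "\<And>k. k \<le> m \<Longrightarrow> wresol ks T (J k) (s k) (F k)"
    and x: "0 < x" "x < 1" and A: "0 < A"
  shows "\<exists>p\<in>loc_alg ks T. proj (Conf ks T) p \<and> A * Re (\<phi> p) \<le> real (Suc m) \<and>
    (\<forall>q k. q \<in> loc_alg ks T \<and> proj (Conf ks T) q \<and> k \<le> m \<longrightarrow>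
      (\<Sum>j\<in>J k. s k j * hs (Conf ks T) (mm (Conf ks T) (F k j) (mm (Conf ks T) (idm (Conf ks T) - p) q)))
        \<le> real (Suc B) * A * (Re (\<phi> q) / x + x ^ B * real (card (Conf ks T))))"
proof -
  let ?I = "Conf ks T"
  note I = finite_Conf[OF T, of ks]
  have sp: "spectral ?I (density ks T \<phi>) C E" and c01: "\<And>c. c \<in> C \<Longrightarrow> 0 \<le> c" "\<And>c. c \<in> C \<Longrightarrow> c \<le> 1"
    and lE: "\<And>c. c \<in> C \<Longrightarrow> E c \<in> loc_alg ks T"
    using sd by (auto simp: sdata_def)
  have finC: "finite C" by (rule spectral_fin[OF T sp])
  have pF: "\<And>k j. k \<le> m \<Longrightarrow> j \<in> J k \<Longrightarrow> proj ?I (F k j)" and lF: "\<And>k j. k \<le> m \<Longrightarrow> j \<in> J k \<Longrightarrow> F k j \<in> loc_alg ks T"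
    and sF: "\<And>k j. k \<le> m \<Longrightarrow> j \<in> J k \<Longrightarrow> 0 < s k j"
    and tF: "\<And>k. k \<le> m \<Longrightarrow> (\<Sum>j\<in>J k. s k j * hs ?I (F k j)) \<le> 1"
    using w by (auto simp: wresol_def resol_def)
  \<comment> \<open>For j < B bin j holds the eigenvalues in (x ^ (j + 1), x ^ j]; bin B takes all
    those up to x ^ B and causes the additive error. The exponent 0 is always admissible because c
    \<le> 1.\<close>
  define bin where "bin c = Max {j. j \<le> B \<and> c \<le> x ^ j}" for c :: real
  have bin: "bin c \<le> B" "c \<le> x ^ bin c" "x ^ bin c \<le> c / x + x ^ B" if "c \<in> C" for c
  proof -
    let ?S = "{j. j \<le> B \<and> c \<le> x ^ j}"
    have fS: "finite ?S" and "0 \<in> ?S" using c01(2)[OF that] by auto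
    then have mem: "bin c \<in> ?S" unfolding bin_def by (intro Max_in) auto
    then show "bin c \<le> B" "c \<le> x ^ bin c" by auto
    show "x ^ bin c \<le> c / x + x ^ B"
    proof (cases "bin c = B")
      case True
      then show ?thesis using c01(1)[OF that] x by simp
    next
      case False
      then have "Suc (bin c) \<le> B" using mem by simp
      moreover have "Suc (bin c) \<notin> ?S" using Max_ge[OF fS, of "Suc (bin c)"] unfolding bin_def[symmetric] by auto
      ultimately have "x ^ Suc (bin c) < c" by simp
      then have "x ^ bin c \<le> c / x" using x by (simp add: pos_le_divide_eq mult.commute)
      then show ?thesis using x by (simp add: add_increasing2)
    qed
  qed
  define G where "G b = (\<Sum>c\<in>{c \<in> C. bin c = b}. E c)" for b
  have sub: "{c \<in> C. bin c = b} \<subseteq> C" for b by auto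
  note Gs = spectral_subsum[OF I sp sub, folded G_def]
  have lG: "G b \<in> loc_alg ks T" for b unfolding G_def by (intro loc_alg_sum lE) auto
  have GG: "mm ?I (G a) (G b) = (if a = b then G b else 0)" for a b
  proof -
    have "mm ?I (G a) (G b) = (\<Sum>c\<in>{c \<in> C. bin c = a}. mm ?I (E c) (G b))"
      unfolding G_def[of a] by (rule mm_sum_left)
    also have "\<dots> = (\<Sum>c\<in>{c \<in> C. bin c = a}. if a = b then E c else 0)"
      by (intro sum.cong refl) (auto simp: Gs(2))
    finally show ?thesis by (simp add: G_def)
  qed
  have bins: "(\<Sum>b\<le>B. \<Sum>c\<in>{c \<in> C. bin c = b}. f c) = (\<Sum>c\<in>C. f c)" for f :: "real \<Rightarrow> 'z::comm_monoid_add"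
    by (rule sum.group) (use finC bin(1) in auto)
  have rG: "resol ?I {..B} G"
    unfolding resol_def
  proof (intro conjI ballI)
    show "(\<Sum>b\<le>B. G b) = idm ?I"
      unfolding G_def bins using sp by (simp add: spectral_def resol_def)
  qed (use Gs(1) in auto)
  have xG: "(\<Sum>b\<le>B. x ^ b * hs ?I (mm ?I (G b) Y)) = (\<Sum>c\<in>C. x ^ bin c * hs ?I (mm ?I (E c) Y))" for Y
  proof -
    have "(\<Sum>b\<le>B. x ^ b * hs ?I (mm ?I (G b) Y)) = (\<Sum>b\<le>B. \<Sum>c\<in>{c \<in> C. bin c = b}. x ^ bin c * hs ?I (mm ?I (E c) Y))"
      unfolding Gs(3) sum_distrib_left by (intro sum.cong refl) auto
    then show ?thesis by (simp only: bins)
  qed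
  define W where "W = (\<Sum>k\<le>m. \<Sum>j\<in>J k. sm (of_real (s k j)) (F k j))"
  define QW where "QW Y = (\<Sum>k\<le>m. \<Sum>j\<in>J k. s k j * hs ?I (mm ?I (F k j) Y))" for Y
  have QW: "Re (tr ?I (mm ?I (adj Y) (mm ?I W Y))) = QW Y" for Y
  proof -
    have "Re (tr ?I (mm ?I (adj Y) (mm ?I W Y)))
       = (\<Sum>k\<le>m. Re (tr ?I (mm ?I (adj Y) (mm ?I (\<Sum>j\<in>J k. sm (of_real (s k j)) (F k j)) Y))))"
      unfolding W_def by (simp only: mm_sum_left mm_sum_right tr_sum Re_sum)
    also have "\<dots> = QW Y" unfolding QW_def by (intro sum.cong refl quadratic_form_sum) (use pF in simp)
    finally show ?thesis .
  qed
  have lW: "W \<in> loc_alg ks T" unfolding W_def by (intro loc_alg_sum loc_alg_sm lF) auto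
  have aW: "adj W = W"
    unfolding W_def adj_sum adj_sm
    by (intro sum.cong refl) (simp add: projD(3)[OF pF])
  define PW where "PW = (\<Sum>b\<le>B. mm ?I (G b) (mm ?I W (G b)))"
  define FP where "FP = (\<Sum>b\<le>B. sm (of_real (x ^ b)) (G b))"
  define M where "M = PW - sm (of_real A) FP"
  have lM: "M \<in> loc_alg ks T"
    unfolding M_def PW_def FP_def by (intro loc_alg_diff loc_alg_sum loc_alg_sm loc_alg_mm lG lW)
  have aM: "adj M = M"
    unfolding M_def PW_def FP_def adj_diff adj_sum adj_sm adj_mm
    by (simp add: projD(3)[OF Gs(1)] aW mm_assoc)
  have GPW: "mm ?I (G b) PW = mm ?I (G b) (mm ?I W (G b))" "mm ?I PW (G b) = mm ?I (G b) (mm ?I W (G b))" if "b \<le> B" for b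
  proof -
    have "mm ?I (G b) PW = (\<Sum>a\<le>B. if a = b then mm ?I (G b) (mm ?I W (G b)) else 0)"
      unfolding PW_def mm_sum_right
    proof (rule sum.cong[OF refl])
      fix a
      have "mm ?I (G b) (mm ?I (G a) (mm ?I W (G a))) = mm ?I (mm ?I (G b) (G a)) (mm ?I W (G a))" by (simp only: mm_assoc)
      then show "mm ?I (G b) (mm ?I (G a) (mm ?I W (G a))) = (if a = b then mm ?I (G b) (mm ?I W (G b)) else 0)"
        by (simp add: GG)
    qed
    then show "mm ?I (G b) PW = mm ?I (G b) (mm ?I W (G b))" using that by simp
    have "mm ?I PW (G b) = (\<Sum>a\<le>B. if a = b then mm ?I (G b) (mm ?I W (G b)) else 0)"
      unfolding PW_def mm_sum_left
    proof (rule sum.cong[OF refl])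
      fix a
      have "mm ?I (mm ?I (G a) (mm ?I W (G a))) (G b) = mm ?I (G a) (mm ?I W (mm ?I (G a) (G b)))" by (simp only: mm_assoc)
      then show "mm ?I (mm ?I (G a) (mm ?I W (G a))) (G b) = (if a = b then mm ?I (G b) (mm ?I W (G b)) else 0)"
        by (simp add: GG)
    qed
    then show "mm ?I PW (G b) = mm ?I (G b) (mm ?I W (G b))" using that by simp
  qed
  have GFP: "mm ?I (G b) FP = mm ?I FP (G b)" for b
    unfolding FP_def mm_sum_left mm_sum_right mm_sm_left mm_sm_right by (intro sum.cong refl) (simp add: GG)
  have GM: "mm ?I M (G b) = mm ?I (G b) M" if "b \<le> B" for b
    unfolding M_def mm_diff_left mm_diff_right mm_sm_left mm_sm_right GPW[OF that] GFP ..
  obtain C' E' where sp': "spectral ?I M C' E'"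
    using spectral_theorem[OF I loc_alg_supported[OF lM] aM] by blast
  define p where "p = (\<Sum>c\<in>{c \<in> C'. 0 < c}. E' c)"
  have sub': "{c \<in> C'. 0 < c} \<subseteq> C'" by auto
  note ps = spectral_subsum[OF I sp' sub', folded p_def]
  have lp: "p \<in> loc_alg ks T"
    unfolding p_def by (intro loc_alg_sum spectral_loc_alg[OF T lM sp']) auto
  have Gp: "mm ?I p (G b) = mm ?I (G b) p" if "b \<le> B" for b
    by (rule ps(4)[OF loc_alg_supported[OF lG] GM[OF that]])
  have pE': "\<And>c. c \<in> C' \<Longrightarrow> proj ?I (E' c)" using sp' by (auto simp: spectral_def resol_def)
  \<comment> \<open>The form of \<open>M\<close> computed from its own eigenvalues and from its
    definition. Its sign is known on the range of \<open>p\<close> and on the complement, which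
    yields the two bounds.\<close>
  have form: "(\<Sum>c\<in>C'. c * hs ?I (mm ?I (E' c) Y)) = (\<Sum>b\<le>B. QW (mm ?I (G b) Y)) - A * (\<Sum>b\<le>B. x ^ b * hs ?I (mm ?I (G b) Y))" for Y
  proof -
    have "(\<Sum>c\<in>C'. c * hs ?I (mm ?I (E' c) Y)) = Re (tr ?I (mm ?I (adj Y) (mm ?I (\<Sum>c\<in>C'. sm (of_real c) (E' c)) Y)))"
      by (rule quadratic_form_sum[symmetric]) (rule pE')
    also have "(\<Sum>c\<in>C'. sm (of_real c) (E' c)) = M" using sp' by (simp add: spectral_def)
    also have "Re (tr ?I (mm ?I (adj Y) (mm ?I M Y))) = Re (tr ?I (mm ?I (adj Y) (mm ?I PW Y)))
        - A * Re (tr ?I (mm ?I (adj Y) (mm ?I FP Y)))"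
      by (simp add: M_def mm_diff_left mm_diff_right mm_sm_left mm_sm_right tr_diff tr_sm)
    also have "Re (tr ?I (mm ?I (adj Y) (mm ?I FP Y))) = (\<Sum>b\<le>B. x ^ b * hs ?I (mm ?I (G b) Y))"
      unfolding FP_def by (rule quadratic_form_sum) (rule Gs(1))
    also have "Re (tr ?I (mm ?I (adj Y) (mm ?I PW Y))) = (\<Sum>b\<le>B. Re (tr ?I (mm ?I (adj (mm ?I (G b) Y)) (mm ?I W (mm ?I (G b) Y)))))"
      unfolding PW_def mm_sum_left mm_sum_right tr_sum Re_sum adj_mm
      by (intro sum.cong refl) (simp add: projD(3)[OF Gs(1)] mm_assoc)
    finally show ?thesis by (simp only: QW)
  qed
  show ?thesis
  proof (intro bexI[OF _ lp] conjI allI impI)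
    show "proj ?I p" by (rule ps(1))
    have "Re (\<phi> p) = (\<Sum>c\<in>C. c * hs ?I (mm ?I (E c) p))" by (rule sdata_proj'[OF T sd ps(1) lp])
    also have "\<dots> \<le> (\<Sum>c\<in>C. x ^ bin c * hs ?I (mm ?I (E c) p))"
      by (intro sum_mono mult_right_mono bin(2)) auto
    also have "\<dots> = (\<Sum>b\<le>B. x ^ b * hs ?I (mm ?I (G b) p))" by (simp only: xG)
    finally have "A * Re (\<phi> p) \<le> A * (\<Sum>b\<le>B. x ^ b * hs ?I (mm ?I (G b) p))"
      using A by (intro mult_left_mono) auto
    also have "\<dots> = (\<Sum>b\<le>B. QW (mm ?I (G b) p)) - (\<Sum>c\<in>C'. c * hs ?I (mm ?I (E' c) p))"
      unfolding form by simp
    also have "\<dots> \<le> (\<Sum>b\<le>B. QW (mm ?I (G b) p))"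
    proof -
      have "0 \<le> (\<Sum>c\<in>C'. c * hs ?I (mm ?I (E' c) p))"
      proof (rule sum_nonneg)
        fix c assume c: "c \<in> C'"
        show "0 \<le> c * hs ?I (mm ?I (E' c) p)"
          using ps(2)[OF c] by (cases "0 < c") (use c in auto)
      qed
      then show ?thesis by simp
    qed
    also have "\<dots> = (\<Sum>k\<le>m. \<Sum>j\<in>J k. s k j * (\<Sum>b\<le>B. hs ?I (mm ?I (mm ?I (F k j) (G b)) p)))"
    proof -
      have "(\<Sum>b\<le>B. QW (mm ?I (G b) p)) = (\<Sum>k\<le>m. \<Sum>b\<le>B. \<Sum>j\<in>J k. s k j * hs ?I (mm ?I (F k j) (mm ?I (G b) p)))"
        unfolding QW_def by (rule sum.swap)
      also have "\<dots> = (\<Sum>k\<le>m. \<Sum>j\<in>J k. \<Sum>b\<le>B. s k j * hs ?I (mm ?I (F k j) (mm ?I (G b) p)))"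
        by (intro sum.cong refl sum.swap)
      finally show ?thesis by (simp only: sum_distrib_left mm_assoc)
    qed
    also have "\<dots> \<le> (\<Sum>k\<le>m. \<Sum>j\<in>J k. s k j * hs ?I (F k j))"
    proof (intro sum_mono mult_left_mono)
      fix k j assume kj: "k \<in> {..m}" "j \<in> J k"
      have "(\<Sum>b\<le>B. hs ?I (mm ?I (mm ?I (F k j) (G b)) p)) \<le> (\<Sum>b\<le>B. hs ?I (mm ?I (F k j) (G b)))"
        by (intro sum_mono hs_proj_le_right[OF I ps(1)])
      also have "\<dots> = hs ?I (F k j)" by (rule resol_hs_right[OF I rG])
      finally show "(\<Sum>b\<le>B. hs ?I (mm ?I (mm ?I (F k j) (G b)) p)) \<le> hs ?I (F k j)" .
      show "0 \<le> s k j" using sF[of k j] kj by simp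
    qed
    also have "\<dots> \<le> (\<Sum>k\<le>m. 1)" by (intro sum_mono tF) simp
    finally show "A * Re (\<phi> p) \<le> real (Suc m)" by simp
  next
    fix q k assume q: "q \<in> loc_alg ks T \<and> proj ?I q \<and> k \<le> m"
    define r where "r = idm ?I - p"
    have pr: "proj ?I r" unfolding r_def by (rule proj_compl[OF I ps(1)])
    define Z where "Z = mm ?I r q"
    have "supported ?I Z" unfolding Z_def using pr q by (auto simp: projD(1))
    \<comment> \<open>Cutting Z along the B + 1 bins prepares the pinching inequality.\<close>
    then have Zd: "mm ?I (F k' j) Z = (\<Sum>b\<le>B. mm ?I (F k' j) (mm ?I (G b) Z))" for k' j
      using rG mm_idm_left[OF I] unfolding resol_def by (simp only: mm_sum_right[symmetric] mm_sum_left[symmetric])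
    have nn: "0 \<le> (\<Sum>j\<in>J k'. s k' j * hs ?I (mm ?I (F k' j) Y))" if "k' \<le> m" for k' Y
      by (intro sum_nonneg mult_nonneg_nonneg less_imp_le[OF sF[OF that]]) auto
    have "(\<Sum>j\<in>J k. s k j * hs ?I (mm ?I (F k j) Z)) \<le> (\<Sum>j\<in>J k. s k j * (real (Suc B) * (\<Sum>b\<le>B. hs ?I (mm ?I (F k j) (mm ?I (G b) Z)))))"
    proof (intro sum_mono mult_left_mono)
      fix j assume "j \<in> J k"
      then show "0 \<le> s k j" using sF[of k j] q by simp
      show "hs ?I (mm ?I (F k j) Z) \<le> real (Suc B) * (\<Sum>b\<le>B. hs ?I (mm ?I (F k j) (mm ?I (G b) Z)))"
        unfolding Zd by (rule order_trans[OF hs_sum_le]) simp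
    qed
    also have "\<dots> = real (Suc B) * (\<Sum>b\<le>B. \<Sum>j\<in>J k. s k j * hs ?I (mm ?I (F k j) (mm ?I (G b) Z)))"
      by (subst sum.swap) (simp only: sum_distrib_left mult.left_commute)
    also have "\<dots> \<le> real (Suc B) * (\<Sum>b\<le>B. QW (mm ?I (G b) Z))"
    proof (intro mult_left_mono sum_mono)
      fix b
      show "(\<Sum>j\<in>J k. s k j * hs ?I (mm ?I (F k j) (mm ?I (G b) Z))) \<le> QW (mm ?I (G b) Z)"
        unfolding QW_def using q nn
        by (intro member_le_sum[of k "{..m}" "\<lambda>k. \<Sum>j\<in>J k. s k j * hs ?I (mm ?I (F k j) (mm ?I (G b) Z))"]) auto
    qed simp
    also have "\<dots> \<le> real (Suc B) * (A * (\<Sum>b\<le>B. x ^ b * hs ?I (mm ?I (G b) Z)))"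
    proof (rule mult_left_mono)
      have "(\<Sum>c\<in>C'. c * hs ?I (mm ?I (E' c) Z)) \<le> 0"
      proof (rule sum_nonpos)
        fix c assume c: "c \<in> C'"
        show "c * hs ?I (mm ?I (E' c) Z) \<le> 0"
        proof (cases "0 < c")
          case True
          then have "mm ?I (E' c) p = E' c" using ps(2)[OF c] c by simp
          moreover have "mm ?I (E' c) (idm ?I) = E' c" by (rule mm_idm_right[OF I projD(1)[OF pE'[OF c]]])
          ultimately have "mm ?I (E' c) r = 0" by (simp add: r_def mm_diff_right)
          then have "mm ?I (mm ?I (E' c) r) q = 0" by simp
          then have "mm ?I (E' c) Z = 0" by (simp only: Z_def mm_assoc)
          then show ?thesis by simp
        qed (simp add: mult_nonpos_nonneg)
      qed
      then show "(\<Sum>b\<le>B. QW (mm ?I (G b) Z)) \<le> A * (\<Sum>b\<le>B. x ^ b * hs ?I (mm ?I (G b) Z))"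
        unfolding form by simp
    qed simp
    also have "\<dots> \<le> real (Suc B) * (A * (\<Sum>b\<le>B. x ^ b * hs ?I (mm ?I (G b) q)))"
    proof (intro mult_left_mono sum_mono)
      \<comment> \<open>Here the pinching pays off: \<open>r\<close> can be moved past
        \<open>G b\<close> and then acts as a contraction from the left.\<close>
      fix b assume "b \<in> {..B}"
      then have "mm ?I (G b) r = mm ?I r (G b)"
        using Gp[of b] mm_idm_left[OF I loc_alg_supported[OF lG]] mm_idm_right[OF I loc_alg_supported[OF lG]]
        by (simp add: r_def mm_diff_left mm_diff_right)
      then have "mm ?I (G b) Z = mm ?I r (mm ?I (G b) q)" unfolding Z_def by (simp only: mm_assoc[symmetric])
      then show "hs ?I (mm ?I (G b) Z) \<le> hs ?I (mm ?I (G b) q)" by (simp only: hs_proj_le[OF I pr])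
    qed (use A x in auto)
    also have "(\<Sum>b\<le>B. x ^ b * hs ?I (mm ?I (G b) q)) = (\<Sum>c\<in>C. x ^ bin c * hs ?I (mm ?I (E c) q))" by (rule xG)
    also have "real (Suc B) * (A * (\<Sum>c\<in>C. x ^ bin c * hs ?I (mm ?I (E c) q)))
        \<le> real (Suc B) * (A * (\<Sum>c\<in>C. (c / x + x ^ B) * hs ?I (mm ?I (E c) q)))"
      using A by (intro mult_left_mono sum_mono mult_right_mono bin(3)) auto
    also have "(\<Sum>c\<in>C. (c / x + x ^ B) * hs ?I (mm ?I (E c) q)) = (\<Sum>c\<in>C. c * hs ?I (mm ?I (E c) q)) / x + x ^ B * (\<Sum>c\<in>C. hs ?I (mm ?I (E c) q))"
      by (simp add: distrib_right sum.distrib sum_distrib_left sum_divide_distrib)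
    also have "(\<Sum>c\<in>C. hs ?I (mm ?I (E c) q)) = hs ?I q" by (rule resol_hs_left[OF I sdata_resol[OF sd]])
    also have "(\<Sum>c\<in>C. c * hs ?I (mm ?I (E c) q)) = Re (\<phi> q)" using sdata_proj'[OF T sd] q by simp
    also have "real (Suc B) * (A * (Re (\<phi> q) / x + x ^ B * hs ?I q)) \<le> real (Suc B) * (A * (Re (\<phi> q) / x + x ^ B * real (card ?I)))"
    proof (intro mult_left_mono add_left_mono)
      have "hs ?I q = hs ?I (mm ?I (idm ?I) q)" using hs_idm_mm(1)[OF I] by simp
      also have "\<dots> \<le> hs ?I (idm ?I)" by (rule hs_proj_le_right[OF I]) (use q in simp)
      finally show "hs ?I q \<le> real (card ?I)" by (simp add: hs_idm I)
    qed (use A x in auto)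
    finally show "(\<Sum>j\<in>J k. s k j * hs ?I (mm ?I (F k j) (mm ?I (idm ?I - p) q)))
        \<le> real (Suc B) * A * (Re (\<phi> q) / x + x ^ B * real (card ?I))"
      by (simp only: Z_def r_def mult.assoc)
  qed
qed

section \<open>The main theorem\<close>

text \<open>For y \<le> 0, where \<open>elog\<close> takes its default value, the bound holds since
  the exponential is positive.\<close>

lemma elog_less_ereal: "elog y < ereal b \<Longrightarrow> y \<le> exp b"
proof (cases "0 < y")
  case True
  assume "elog y < ereal b"
  then have "ln y < b" using True by (simp add: elog_def)
  then show ?thesis using True by (metis exp_le_cancel_iff exp_ln less_imp_le)
next
  case False
  then show ?thesis using exp_ge_zero[of b] by linarith
qed

text \<open>A strict bound on the limit superior passes to the infimum \<open>beta\<close> for large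
  n, and a number above an infimum is beaten by an actual projection.\<close>

lemma beta_bar_test:
  assumes "beta_bar ks \<epsilon> \<Psi> \<Phi> < ereal b"
  shows "\<forall>\<^sub>F n in sequentially. \<exists>q. local_proj ks n q \<and> 1 - \<epsilon> \<le> Re (\<Psi> (ivl n) q) \<and> Re (\<Phi> (ivl n) q) \<le> exp (b * real n)"
proof -
  have "\<forall>\<^sub>F n in sequentially. beta ks \<epsilon> n \<Psi> \<Phi> / ereal (real n) < ereal b"
    using assms unfolding beta_bar_def by (rule Limsup_lessD)
  moreover have "\<forall>\<^sub>F n in sequentially. 0 < n" by (rule eventually_gt_at_top)
  ultimately show ?thesis
  proof eventually_elim
    case (elim n)
    have "beta ks \<epsilon> n \<Psi> \<Phi> < ereal (b * real n)"
      using elim by (cases "beta ks \<epsilon> n \<Psi> \<Phi>") (auto simp: pos_divide_less_eq)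
    then obtain e where "e \<in> {elog (Re (\<Phi> (ivl n) q)) | q. local_proj ks n q \<and> 1 - \<epsilon> \<le> Re (\<Psi> (ivl n) q)}"
      "e < ereal (b * real n)"
      unfolding beta_def Inf_less_iff by blast
    then obtain q where q: "local_proj ks n q" "1 - \<epsilon> \<le> Re (\<Psi> (ivl n) q)" "elog (Re (\<Phi> (ivl n) q)) < ereal (b * real n)"
      by blast
    show ?case using q(1,2) elog_less_ereal[OF q(3)] by blast
  qed
qed

text \<open>The test operator is X = (1 - p) q, for which 1 - X = p + (1 - p) (1 - q).\<close>

lemma state_compl_mm_le:
  assumes T: "finite T" and st: "is_local_state ks T \<psi>" and \<kappa>: "0 < \<kappa>"
    and p: "proj (Conf ks T) p" "p \<in> loc_alg ks T" and q: "proj (Conf ks T) q" "q \<in> loc_alg ks T"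
  defines "X \<equiv> mm (Conf ks T) (idm (Conf ks T) - p) q"
  shows "Re (\<psi> (mm (Conf ks T) (adj (idm (Conf ks T) - X)) (idm (Conf ks T) - X)))
    \<le> (1 + \<kappa>) * Re (\<psi> p) + (1 + 1 / \<kappa>) * (1 - Re (\<psi> q))"
proof -
  let ?I = "Conf ks T"
  note I = finite_Conf[OF T, of ks]
  obtain C E where sd: "sdata ks T \<psi> C E" using sdata_exists[OF T st] by blast
  have nn: "\<And>c. c \<in> C \<Longrightarrow> 0 \<le> c" using sd by (simp add: sdata_def)
  let ?P = "idm ?I - p" and ?Q = "idm ?I - q"
  have pP: "proj ?I ?P" and pQ: "proj ?I ?Q" using proj_compl[OF I] p q by auto
  have lX: "X \<in> loc_alg ks T" unfolding X_def by (intro loc_alg_mm loc_alg_diff loc_alg_idm p q)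
  have "mm ?I ?P (idm ?I) = ?P" by (rule mm_idm_right[OF I projD(1)[OF pP]])
  then have split: "idm ?I - X = p + mm ?I ?P ?Q" by (simp add: X_def mm_diff_right)
  have "Re (\<psi> (mm ?I (adj (idm ?I - X)) (idm ?I - X))) = (\<Sum>c\<in>C. c * hs ?I (mm ?I (idm ?I - X) (E c)))"
    by (rule sdata_adj_mm[OF T sd loc_alg_diff[OF loc_alg_idm lX]])
  also have "\<dots> \<le> (\<Sum>c\<in>C. c * ((1 + \<kappa>) * hs ?I (mm ?I p (E c)) + (1 + 1 / \<kappa>) * hs ?I (mm ?I ?Q (E c))))"
  proof (intro sum_mono mult_left_mono nn)
    fix c
    have "hs ?I (mm ?I (idm ?I - X) (E c)) \<le> (1 + \<kappa>) * hs ?I (mm ?I p (E c)) + (1 + 1 / \<kappa>) * hs ?I (mm ?I ?P (mm ?I ?Q (E c)))"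
      unfolding split mm_add_left mm_assoc by (rule hs_add_le[OF \<kappa>])
    also have "\<dots> \<le> (1 + \<kappa>) * hs ?I (mm ?I p (E c)) + (1 + 1 / \<kappa>) * hs ?I (mm ?I ?Q (E c))"
      using \<kappa> by (intro add_left_mono mult_left_mono hs_proj_le[OF I pP]) simp
    finally show "hs ?I (mm ?I (idm ?I - X) (E c)) \<le> (1 + \<kappa>) * hs ?I (mm ?I p (E c)) + (1 + 1 / \<kappa>) * hs ?I (mm ?I ?Q (E c))" .
  qed
  also have "\<dots> = (1 + \<kappa>) * (\<Sum>c\<in>C. c * hs ?I (mm ?I p (E c))) + (1 + 1 / \<kappa>) * (\<Sum>c\<in>C. c * hs ?I (mm ?I ?Q (E c)))"
    by (simp only: distrib_left sum.distrib sum_distrib_left mult.left_commute)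
  also have "(\<Sum>c\<in>C. c * hs ?I (mm ?I p (E c))) = Re (\<psi> p)"
    by (rule sdata_proj[OF T sd p, symmetric])
  also have "(\<Sum>c\<in>C. c * hs ?I (mm ?I ?Q (E c))) = Re (\<psi> ?Q)"
    by (rule sdata_proj[OF T sd pQ loc_alg_diff[OF loc_alg_idm q(2)], symmetric])
  also have "Re (\<psi> ?Q) = 1 - Re (\<psi> q)" by (rule state_proj_bounds(3)[OF T st q])
  finally show ?thesis .
qed

text \<open>Each error term is at most \<kappa>: one each from \<open>y\<close> and
  \<open>v\<close>, and seven, with multiplicity, from expanding the product.\<close>

lemma acceptance_arith:
  fixes a \<kappa> y v :: real
  assumes \<kappa>: "0 < \<kappa>" "\<kappa> < 1" and a: "a \<le> 1" "0 \<le> a" and y: "y \<le> \<kappa>" and v: "v \<le> \<kappa>"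
    and main: "1 - y \<le> (1 + \<kappa>) * ((1 + \<kappa>) * a + (1 + 1 / \<kappa>) * \<kappa>\<^sup>2) + v"
  shows "1 - 9 * \<kappa> \<le> a"
proof -
  have e: "(1 + 1 / \<kappa>) * \<kappa>\<^sup>2 = \<kappa> + \<kappa>\<^sup>2" using \<kappa> by (simp add: field_simps power2_eq_square)
  have k2: "\<kappa>\<^sup>2 \<le> \<kappa>" and k3: "\<kappa> * \<kappa>\<^sup>2 \<le> \<kappa>"
    using \<kappa> by (auto simp: power2_eq_square mult_le_one intro!: mult_left_le)
  have ka: "\<kappa> * a \<le> \<kappa>" "\<kappa>\<^sup>2 * a \<le> \<kappa>"
    using \<kappa> a k2 mult_left_le[of a \<kappa>] order_trans[OF mult_left_le[of a "\<kappa>\<^sup>2"] k2] by auto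
  have "(1 + \<kappa>) * ((1 + \<kappa>) * a + (\<kappa> + \<kappa>\<^sup>2)) = a + 2 * (\<kappa> * a) + \<kappa>\<^sup>2 * a + \<kappa> + 2 * \<kappa>\<^sup>2 + \<kappa> * \<kappa>\<^sup>2"
    by (simp add: algebra_simps power2_eq_square)
  then show ?thesis using main y v k2 k3 ka unfolding e by linarith
qed

text \<open>Stated for an arbitrary real s in place of the rate of the set, so that infinite rates
  are covered by letting s grow. The threshold of the test is A = exp ((s - \<eta>) n).\<close>

lemma achievability:
  assumes d: "0 < card (blocks ks)" and \<Phi>: "is_state ks \<Phi>"
    and st: "\<And>\<Psi>. \<Psi> \<in> \<Omega> \<Longrightarrow> stationary ks \<Psi>"
    and hp: "\<And>\<Psi> \<epsilon>. \<Psi> \<in> \<Omega> \<Longrightarrow> 0 < \<epsilon> \<Longrightarrow> \<epsilon> < 1 \<Longrightarrow> beta_bar ks \<epsilon> \<Psi> \<Phi> \<le> ereal (- s)"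
    and \<eta>: "0 < \<eta>"
  shows "\<exists>p. (\<forall>n. local_proj ks n (p n)) \<and> (\<forall>\<Psi>\<in>\<Omega>. (\<lambda>n. Re (\<Psi> (ivl n) (p n))) \<longlonglongrightarrow> 1) \<and>
    limsup (\<lambda>n. elog (Re (\<Phi> (ivl n) (p n))) / ereal (real n)) \<le> ereal (- s + \<eta>)"
proof -
  obtain J :: "nat \<Rightarrow> nat \<Rightarrow> real list set" and w F where
    W: "\<And>k n. wresol ks (ivl n) (J k n) (w k n) (F k n)" and
    U: "\<And>\<Psi> \<delta>. stationary ks \<Psi> \<Longrightarrow> 0 < \<delta> \<Longrightarrow> \<exists>k c. \<forall>n. \<exists>C E. sdata ks (ivl n) (\<Psi> (ivl n)) C E \<and>
       ns_entropy (Conf ks (ivl n)) C (\<lambda>c. c) E (J k n) (w k n) (F k n) \<le> \<delta> * real n + c"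
    using universal_resolutions[OF d] by metis
  \<comment> \<open>In units of \<delta> n, besides s, the exponents are: -8 from A, +1 from the bin
    ratio, +1 from the projections of the HP-condition, +1 from exp t with t = \<delta> n. The total
    -5 leaves exponential decay.\<close>
  define \<delta> where "\<delta> = \<eta> / 8"
  have \<delta>: "0 < \<delta>" using \<eta> by (simp add: \<delta>_def)
  define b where "b = ln (real (card (blocks ks)))"
  \<comment> \<open>This makes x ^ B times the dimension exp (b n) at most exp (- s n), with B
    independent of n.\<close>
  obtain B :: nat where B: "(s + b) / \<delta> \<le> real B" using real_arch_simple by blast
  define tw where "tw k n Y = (\<Sum>j\<in>J k n. w k n j * hs (Conf ks (ivl n)) (mm (Conf ks (ivl n)) (F k n j) Y))" for k n Y
  \<comment> \<open>The operators with index k \<le> n take part, so each of the countably many is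
    present from some n on, while their total trace is at most n + 1. The case n = 0 is set apart
    because there the bin ratio would be 1.\<close>
  define good where "good n p \<longleftrightarrow> local_proj ks n p \<and> (0 < n \<longrightarrow> exp ((s - \<eta>) * real n) * Re (\<Phi> (ivl n) p) \<le> real (Suc n) \<and>
      (\<forall>q k. local_proj ks n q \<and> k \<le> n \<longrightarrow> tw k n (mm (Conf ks (ivl n)) (idm (Conf ks (ivl n)) - p) q)
         \<le> real (Suc B) * exp ((s - \<eta>) * real n) * (Re (\<Phi> (ivl n) q) / exp (- \<delta> * real n) + exp (- \<delta> * real n) ^ B * real (card (Conf ks (ivl n))))))"
    for n p
  have "\<exists>p. good n p" for n
  proof (cases "n = 0")
    case True
    have "good n (idm (Conf ks (ivl n)))"
      using True finite_Conf[OF finite_ivl] by (simp add: good_def local_proj_iff proj_idm)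
    then show ?thesis by blast
  next
    case False
    obtain C E where sd: "sdata ks (ivl n) (\<Phi> (ivl n)) C E"
      using sdata_exists[OF finite_ivl state_local[OF \<Phi> finite_ivl]] by blast
    have x: "0 < exp (- \<delta> * real n)" "exp (- \<delta> * real n) < 1" using False \<delta> by auto
    have A: "0 < exp ((s - \<eta>) * real n)" by simp
    show ?thesis
      using pinched_test[where J = "\<lambda>k. J k n" and s = "\<lambda>k. w k n" and F = "\<lambda>k. F k n" and m = n and B = B,
          OF finite_ivl sd W x A]
      unfolding good_def local_proj_iff tw_def by blast
  qed
  then obtain p where p: "\<And>n. good n (p n)" by metis
  have lp: "local_proj ks n (p n)" for n using p[of n] by (simp add: good_def)
  have lim1: "(\<lambda>n. Re (\<Psi> (ivl n) (p n))) \<longlonglongrightarrow> 1" if \<Psi>: "\<Psi> \<in> \<Omega>" for \<Psi>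
  proof -
    have iss: "is_state ks \<Psi>" using st[OF \<Psi>] by (simp add: stationary_def)
    have bnd: "0 \<le> Re (\<Psi> (ivl n) (p n))" "Re (\<Psi> (ivl n) (p n)) \<le> 1" for n
      using state_proj_bounds(1,2)[OF finite_ivl state_local[OF iss finite_ivl], of n "p n"] lp[of n]
      by (auto simp: local_proj_iff)
    have ev: "\<forall>\<^sub>F n in sequentially. 1 - 9 * \<kappa> \<le> Re (\<Psi> (ivl n) (p n))" if \<kappa>: "0 < \<kappa>" "\<kappa> < 1" for \<kappa> :: real
    proof -
      \<comment> \<open>Measured against t = \<delta> n, this entropy rate contributes \<kappa> / 2
        to the Markov error; the constants contribute at most as much for large n.\<close>
      have "0 < \<delta> * \<kappa> / 2" using \<delta> \<kappa> by simp
      from U[OF st[OF \<Psi>] this] obtain k c where D: "\<And>n. \<exists>C E. sdata ks (ivl n) (\<Psi> (ivl n)) C E \<and>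
         ns_entropy (Conf ks (ivl n)) C (\<lambda>c. c) E (J k n) (w k n) (F k n) \<le> \<delta> * \<kappa> / 2 * real n + c" by blast
      have k2: "0 < \<kappa>\<^sup>2" "\<kappa>\<^sup>2 < 1" using \<kappa> by (auto simp: power_less_one_iff)
      have "beta_bar ks (\<kappa>\<^sup>2) \<Psi> \<Phi> \<le> ereal (- s)" by (rule hp[OF \<Psi> k2])
      also have "\<dots> < ereal (- s + \<delta>)" using \<delta> by simp
      finally have e1: "\<forall>\<^sub>F n in sequentially. \<exists>q. local_proj ks n q \<and> 1 - \<kappa>\<^sup>2 \<le> Re (\<Psi> (ivl n) q) \<and>
          Re (\<Phi> (ivl n) q) \<le> exp ((- s + \<delta>) * real n)" by (rule beta_bar_test)
      have e2: "\<forall>\<^sub>F n in sequentially. max k 1 \<le> n" by (rule eventually_ge_at_top)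
      have e3: "\<forall>\<^sub>F n in sequentially. (\<bar>c\<bar> + 1) / (\<delta> * \<kappa> / 2) < real n"
        using filterlim_real_sequentially by (simp add: filterlim_at_top_dense)
      have "(\<lambda>n. (1 + 1 / \<kappa>) * (2 * real (Suc B)) * exp (- (5 * \<delta>) * real n)) \<longlonglongrightarrow> 0"
        using \<delta> by real_asymp
      then have e4: "\<forall>\<^sub>F n in sequentially. (1 + 1 / \<kappa>) * (2 * real (Suc B)) * exp (- (5 * \<delta>) * real n) < \<kappa>"
        using \<kappa>(1) by (rule order_tendstoD(2))
      show ?thesis
        using e1 e2 e3 e4
      proof eventually_elim
        case (elim n)
        let ?I = "Conf ks (ivl n)" and ?T = "ivl n"
        have n: "0 < n" "k \<le> n" using elim(2) by auto
        obtain q where q: "local_proj ks n q" "1 - \<kappa>\<^sup>2 \<le> Re (\<Psi> ?T q)" "Re (\<Phi> ?T q) \<le> exp ((- s + \<delta>) * real n)"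
          using elim(1) by blast
        obtain C E where sd: "sdata ks ?T (\<Psi> ?T) C E"
          and Dn: "ns_entropy ?I C (\<lambda>c. c) E (J k n) (w k n) (F k n) \<le> \<delta> * \<kappa> / 2 * real n + c" using D[of n] by blast
        define X where "X = mm ?I (idm ?I - p n) q"
        have pp: "proj ?I (p n)" "p n \<in> loc_alg ks ?T" and qq: "proj ?I q" "q \<in> loc_alg ks ?T"
          using lp[of n] q(1) by (auto simp: local_proj_iff)
        have lX: "X \<in> loc_alg ks ?T" unfolding X_def by (intro loc_alg_mm loc_alg_diff loc_alg_idm pp qq)
        have t: "0 < \<delta> * real n" using \<delta> n by simp
        let ?D = "ns_entropy ?I C (\<lambda>c. c) E (J k n) (w k n) (F k n) + (\<Sum>j\<in>J k n. w k n j * hs ?I (F k n j))"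
        have wp: "\<And>j. j \<in> J k n \<Longrightarrow> 0 < w k n j" and wr: "resol ?I (J k n) (F k n)"
          and ws: "(\<Sum>j\<in>J k n. w k n j * hs ?I (F k n j)) \<le> 1"
          using W[where k = k and n = n] by (auto simp: wresol_def)
        have ns: "1 - ?D / (\<delta> * real n) \<le> (1 + \<kappa>) * Re (\<Psi> ?T (mm ?I (adj (idm ?I - X)) (idm ?I - X)))
            + (1 + 1 / \<kappa>) * exp (\<delta> * real n) * tw k n X"
          unfolding tw_def
        proof (rule ns_state[OF finite_ivl sd wr _ _ \<kappa>(1) t lX])
          show "0 \<le> w k n j" if "j \<in> J k n" for j using wp[OF that] by simp
          show "hs ?I (mm ?I (F k n j) (E c)) = 0" if "j \<in> J k n" "w k n j = 0" for c j using wp[OF that(1)] that(2) by simp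
        qed
        have y: "?D / (\<delta> * real n) \<le> \<kappa>"
        proof -
          have "\<bar>c\<bar> + 1 < real n * (\<delta> * \<kappa> / 2)" 
            using elim(3) by (simp only: pos_divide_less_eq[OF \<open>0 < \<delta> * \<kappa> / 2\<close>])
          then have "?D \<le> \<delta> * \<kappa> / 2 * real n + real n * (\<delta> * \<kappa> / 2)" using Dn ws by linarith
          also have "\<dots> = \<kappa> * (\<delta> * real n)" by (simp add: algebra_simps)
          finally show ?thesis using t by (simp only: pos_divide_le_eq)
        qed
        have v: "(1 + 1 / \<kappa>) * exp (\<delta> * real n) * tw k n X \<le> \<kappa>"
        proof -
          let ?A = "exp ((s - \<eta>) * real n)"
          have "tw k n X \<le> real (Suc B) * ?A * (Re (\<Phi> ?T q) / exp (- \<delta> * real n) + exp (- \<delta> * real n) ^ B * real (card ?I))"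
            using p[of n] n q(1) unfolding good_def X_def by blast
          also have "\<dots> \<le> real (Suc B) * ?A * (exp ((- s + 2 * \<delta>) * real n) + exp (- s * real n))"
          proof (intro mult_left_mono add_mono)
            have "Re (\<Phi> ?T q) / exp (- \<delta> * real n) \<le> exp ((- s + \<delta>) * real n) / exp (- \<delta> * real n)"
              using q(3) by (intro divide_right_mono) auto
            also have "\<dots> = exp ((- s + 2 * \<delta>) * real n)"
              by (simp add: exp_diff[symmetric] algebra_simps)
            finally show "Re (\<Phi> ?T q) / exp (- \<delta> * real n) \<le> exp ((- s + 2 * \<delta>) * real n)" .
            have "real (card ?I) = exp (b * real n)"
              using d by (simp add: card_Conf b_def exp_of_nat2_mult)
            then have "exp (- \<delta> * real n) ^ B * real (card ?I) = exp (real B * (- \<delta> * real n) + b * real n)"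
              by (simp only: exp_add exp_of_nat_mult)
            also have "\<dots> \<le> exp (- s * real n)"
            proof -
              have "s + b \<le> real B * \<delta>" using B \<delta> by (simp add: pos_divide_le_eq)
              then have "(s + b) * real n \<le> real B * \<delta> * real n" by (intro mult_right_mono) auto
              then show ?thesis by (simp add: algebra_simps)
            qed
            finally show "exp (- \<delta> * real n) ^ B * real (card ?I) \<le> exp (- s * real n)" .
          qed simp
          also have "\<dots> = real (Suc B) * (exp (- (6 * \<delta>) * real n) + exp (- (8 * \<delta>) * real n))"
          proof -
            have "?A * exp ((- s + 2 * \<delta>) * real n) = exp (- (6 * \<delta>) * real n)"
              "?A * exp (- s * real n) = exp (- (8 * \<delta>) * real n)"
              unfolding exp_add[symmetric] by (simp_all add: \<delta>_def algebra_simps)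
            then show ?thesis by (simp only: mult.assoc distrib_left)
          qed
          also have "\<dots> \<le> real (Suc B) * (exp (- (6 * \<delta>) * real n) + exp (- (6 * \<delta>) * real n))"
            using \<delta> by (intro mult_left_mono add_left_mono) auto
          finally have twb: "tw k n X \<le> 2 * real (Suc B) * exp (- (6 * \<delta>) * real n)"
            by (simp only: mult_2[symmetric] mult_ac)
          have "(1 + 1 / \<kappa>) * exp (\<delta> * real n) * tw k n X \<le> (1 + 1 / \<kappa>) * exp (\<delta> * real n) * (2 * real (Suc B) * exp (- (6 * \<delta>) * real n))"
            using \<kappa> by (intro mult_left_mono twb) auto
          also have "\<dots> = (1 + 1 / \<kappa>) * (2 * real (Suc B)) * (exp (\<delta> * real n) * exp (- (6 * \<delta>) * real n))"
            by (simp only: mult_ac)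
          also have "exp (\<delta> * real n) * exp (- (6 * \<delta>) * real n) = exp (- (5 * \<delta>) * real n)"
            unfolding exp_add[symmetric] by (simp add: algebra_simps)
          finally show ?thesis using elim(4) by linarith
        qed
        have "Re (\<Psi> ?T (mm ?I (adj (idm ?I - X)) (idm ?I - X))) \<le> (1 + \<kappa>) * Re (\<Psi> ?T (p n)) + (1 + 1 / \<kappa>) * (1 - Re (\<Psi> ?T q))"
          unfolding X_def by (rule state_compl_mm_le[OF finite_ivl state_local[OF iss finite_ivl] \<kappa>(1) pp qq])
        also have "\<dots> \<le> (1 + \<kappa>) * Re (\<Psi> ?T (p n)) + (1 + 1 / \<kappa>) * \<kappa>\<^sup>2"
          using q(2) \<kappa> by (intro add_left_mono mult_left_mono) auto
        finally have "(1 + \<kappa>) * Re (\<Psi> ?T (mm ?I (adj (idm ?I - X)) (idm ?I - X)))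
            \<le> (1 + \<kappa>) * ((1 + \<kappa>) * Re (\<Psi> ?T (p n)) + (1 + 1 / \<kappa>) * \<kappa>\<^sup>2)"
          using \<kappa> by (intro mult_left_mono) auto
        with ns have "1 - ?D / (\<delta> * real n) \<le> (1 + \<kappa>) * ((1 + \<kappa>) * Re (\<Psi> ?T (p n)) + (1 + 1 / \<kappa>) * \<kappa>\<^sup>2)
            + (1 + 1 / \<kappa>) * exp (\<delta> * real n) * tw k n X" by linarith
        then show ?case by (rule acceptance_arith[OF \<kappa> bnd(2) bnd(1) y v])
      qed
    qed
    show ?thesis
    proof (rule order_tendstoI)
      fix a :: real assume "a < 1"
      define \<kappa> where "\<kappa> = min (1 / 2) ((1 - a) / 18)"
      have \<kappa>: "0 < \<kappa>" "\<kappa> < 1" using \<open>a < 1\<close> by (auto simp: \<kappa>_def)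
      have \<kappa>_le: "\<kappa> \<le> (1 - a) / 18" unfolding \<kappa>_def by (rule min.cobounded2)
      show "\<forall>\<^sub>F n in sequentially. a < Re (\<Psi> (ivl n) (p n))"
        using ev[OF \<kappa>]
      proof eventually_elim
        case (elim n)
        have "9 * \<kappa> \<le> (1 - a) / 2" using \<kappa>_le by simp
        then show ?case using elim \<open>a < 1\<close> by (simp add: field_simps)
      qed
    next
      fix a :: real assume "1 < a"
      then show "\<forall>\<^sub>F n in sequentially. Re (\<Psi> (ivl n) (p n)) < a"
        using bnd(2) by (intro always_eventually) (metis le_less_trans)
    qed
  qed
  moreover have "limsup (\<lambda>n. elog (Re (\<Phi> (ivl n) (p n))) / ereal (real n)) \<le> ereal (- s + \<eta>)"
  proof (rule ereal_le_epsilon2)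
    fix e :: real assume e: "0 < e"
    \<comment> \<open>The trace bound n + 1 is invisible on the exponential scale.\<close>
    have "(\<lambda>n. ln (real (Suc n)) / real n) \<longlonglongrightarrow> 0" by real_asymp
    then have "\<forall>\<^sub>F n in sequentially. ln (real (Suc n)) / real n < e" using e by (rule order_tendstoD(2))
    moreover have "\<forall>\<^sub>F n in sequentially. 0 < n" by (rule eventually_gt_at_top)
    ultimately have "\<forall>\<^sub>F n in sequentially. elog (Re (\<Phi> (ivl n) (p n))) / ereal (real n) \<le> ereal (- s + \<eta> + e)"
    proof eventually_elim
      case (elim n)
      have n: "0 < real n" using elim by simp
      have pb: "exp ((s - \<eta>) * real n) * Re (\<Phi> (ivl n) (p n)) \<le> real (Suc n)"
        using p[of n] elim(2) by (simp add: good_def)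
      show ?case
      proof (cases "0 < Re (\<Phi> (ivl n) (p n))")
        case True
        have "ln (exp ((s - \<eta>) * real n) * Re (\<Phi> (ivl n) (p n))) \<le> ln (real (Suc n))"
          using pb True by (subst ln_le_cancel_iff) auto
        then have "(s - \<eta>) * real n + ln (Re (\<Phi> (ivl n) (p n))) \<le> ln (real (Suc n))"
          using ln_mult_pos[of "exp ((s - \<eta>) * real n)"] True by simp
        moreover have "ln (real (Suc n)) < e * real n" using elim(1) n by (simp only: pos_divide_less_eq)
        moreover have "(- s + \<eta> + e) * real n = e * real n - (s - \<eta>) * real n" by (simp add: algebra_simps)
        ultimately have "ln (Re (\<Phi> (ivl n) (p n))) \<le> (- s + \<eta> + e) * real n" by linarith
        then have "ln (Re (\<Phi> (ivl n) (p n))) / real n \<le> - s + \<eta> + e" using n by (simp only: pos_divide_le_eq)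
        then show ?thesis using True n by (simp add: elog_def)
      next
        case False
        then show ?thesis using n by (simp add: elog_def)
      qed
    qed
    then show "limsup (\<lambda>n. elog (Re (\<Phi> (ivl n) (p n))) / ereal (real n)) \<le> ereal (- s + \<eta>) + ereal e"
      using Limsup_bounded by fastforce
  qed
  ultimately show ?thesis using lp by blast
qed

text \<open>A sequence whose \<Psi>-values tend to 1 is eventually admissible in the infimum
  \<open>beta\<close>, at every level.\<close>

lemma beta_bar_le:
  assumes p: "\<And>n. local_proj ks n (p n)" and lim: "(\<lambda>n. Re (\<Psi> (ivl n) (p n))) \<longlonglongrightarrow> 1" and \<epsilon>: "0 < \<epsilon>"
  shows "beta_bar ks \<epsilon> \<Psi> \<Phi> \<le> limsup (\<lambda>n. elog (Re (\<Phi> (ivl n) (p n))) / ereal (real n))"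
  unfolding beta_bar_def
proof (rule Limsup_mono)
  have "\<forall>\<^sub>F n in sequentially. 1 - \<epsilon> < Re (\<Psi> (ivl n) (p n))"
    by (rule order_tendstoD(1)[OF lim]) (use \<epsilon> in simp)
  moreover have "\<forall>\<^sub>F n in sequentially. 0 < n" by (rule eventually_gt_at_top)
  ultimately show "\<forall>\<^sub>F n in sequentially. beta ks \<epsilon> n \<Psi> \<Phi> / ereal (real n) \<le> elog (Re (\<Phi> (ivl n) (p n))) / ereal (real n)"
  proof eventually_elim
    case (elim n)
    have "beta ks \<epsilon> n \<Psi> \<Phi> \<le> elog (Re (\<Phi> (ivl n) (p n)))"
      unfolding beta_def using p[of n] elim(1) by (intro Inf_lower) (auto intro!: exI[of _ "p n"])
    then show ?case using elim(2) by (intro ereal_divide_right_mono) auto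
  qed
qed

text \<open>The HP-condition bounds the exponent of each \<Psi> in \<open>\<Omega>\<close> by minus
  its own rate, hence by -s for every real s below the infimum, and \<open>achievability\<close>
  combines these bounds. In the lower bound every \<Psi> yields minus its own rate, and the best
  choice is the supremum of these numbers. The converse takes singletons for
  \<open>\<Omega>\<close>.\<close>

theorem mainTheorem1:
  fixes ks :: "nat list" and \<Phi> :: qstate and \<Theta> :: "qstate set"
  assumes "ks \<noteq> []" and "\<forall>k\<in>set ks. 0 < k"
    and "is_state ks \<Phi>"
    and "\<forall>\<Psi>\<in>\<Theta>. ergodic ks \<Psi>"
  shows "(\<forall>\<Psi>\<in>\<Theta>. HP ks \<Psi> \<Phi>) \<longleftrightarrow>
    ((\<forall>\<Psi>\<in>\<Theta>. rate_exists ks \<Psi> \<Phi>) \<and>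
     (\<forall>\<Omega>. \<Omega> \<subseteq> \<Theta> \<longrightarrow> (\<forall>\<eta>::real. 0 < \<eta> \<longrightarrow>
        (\<exists>p. (\<forall>n. local_proj ks n (p n)) \<and>
             (\<forall>\<Psi>\<in>\<Omega>. (\<lambda>n. Re (\<Psi> (ivl n) (p n))) \<longlonglongrightarrow> 1) \<and>
             (if rate_set ks \<Omega> \<Phi> < \<infinity>
              then limsup (\<lambda>n. elog (Re (\<Phi> (ivl n) (p n))) / ereal (real n))
                     \<le> - rate_set ks \<Omega> \<Phi> + ereal \<eta>
              else limsup (\<lambda>n. elog (Re (\<Phi> (ivl n) (p n))) / ereal (real n))
                     \<le> - ereal (1 / \<eta>))) \<and>
        (\<forall>p'. (\<forall>n. local_proj ks n (p' n)) \<and>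
              (\<forall>\<Psi>\<in>\<Omega>. (\<lambda>n. Re (\<Psi> (ivl n) (p' n))) \<longlonglongrightarrow> 1) \<longrightarrow>
              - rate_set ks \<Omega> \<Phi> \<le>
                liminf (\<lambda>n. elog (Re (\<Phi> (ivl n) (p' n))) / ereal (real n))))))"
proof (intro iffI conjI ballI allI impI, goal_cases)
  case (1 \<Psi>)
  then show ?case by (simp add: HP_def)
next
  case (2 \<Omega> \<eta>)
  have d: "0 < card (blocks ks)" by (rule card_blocks_pos[OF assms(1,2)])
  have ach: "\<exists>p. (\<forall>n. local_proj ks n (p n)) \<and> (\<forall>\<Psi>\<in>\<Omega>. (\<lambda>n. Re (\<Psi> (ivl n) (p n))) \<longlonglongrightarrow> 1) \<and>
      limsup (\<lambda>n. elog (Re (\<Phi> (ivl n) (p n))) / ereal (real n)) \<le> ereal (- s + \<zeta>)"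
    if s: "ereal s \<le> rate_set ks \<Omega> \<Phi>" and \<zeta>: "0 < \<zeta>" for s \<zeta> :: real
  proof (rule achievability[OF d assms(3) _ _ \<zeta>])
    fix \<Psi> assume \<Psi>: "\<Psi> \<in> \<Omega>"
    then have \<Theta>: "\<Psi> \<in> \<Theta>" using 2(2) by blast
    then show "stationary ks \<Psi>" using assms(4) by (simp add: ergodic_def)
    fix \<epsilon> :: real assume "0 < \<epsilon>" "\<epsilon> < 1"
    then have "beta_bar ks \<epsilon> \<Psi> \<Phi> \<le> - rate ks \<Psi> \<Phi>" using 2(1) \<Theta> by (simp add: HP_def)
    also have "rate_set ks \<Omega> \<Phi> \<le> rate ks \<Psi> \<Phi>"
      unfolding rate_set_def by (rule INF_lower[OF \<Psi>])
    then have "- rate ks \<Psi> \<Phi> \<le> - ereal s" using s by (simp only: ereal_minus_le_minus order_trans)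
    finally show "beta_bar ks \<epsilon> \<Psi> \<Phi> \<le> ereal (- s)" by simp
  qed
  show ?case
  proof (cases "rate_set ks \<Omega> \<Phi>")
    case (real s)
    then show ?thesis using ach[of s \<eta>] 2(3) by simp
  next
    case PInf
    \<comment> \<open>These values give -s + \<zeta> = - 1 / \<eta>. The empty
      \<open>\<Omega>\<close> belongs to this case, its infimum being \<infinity>.\<close>
    then show ?thesis using ach[of "1 / \<eta> + 1" 1] by simp
  next
    case MInf
    have "0 \<le> rate ks \<Psi> \<Phi>" if "\<Psi> \<in> \<Omega>" for \<Psi>
    proof -
      have "\<Psi> \<in> \<Theta>" using 2(2) that by blast
      then have "is_state ks \<Psi>" "rate_exists ks \<Psi> \<Phi>"
        using assms(4) 2(1) by (simp_all add: ergodic_def stationary_def HP_def)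
      then show ?thesis using assms(3) by (intro rate_nonneg)
    qed
    then have "0 \<le> rate_set ks \<Omega> \<Phi>" unfolding rate_set_def by (rule INF_greatest)
    with MInf show ?thesis by simp
  qed
next
  case (3 \<Omega> \<eta> p')
  have "- liminf (\<lambda>n. elog (Re (\<Phi> (ivl n) (p' n))) / ereal (real n)) \<le> rate_set ks \<Omega> \<Phi>"
    unfolding rate_set_def
  proof (rule INF_greatest)
    fix \<Psi> assume "\<Psi> \<in> \<Omega>"
    then have \<Theta>: "\<Psi> \<in> \<Theta>" and lim: "(\<lambda>n. Re (\<Psi> (ivl n) (p' n))) \<longlonglongrightarrow> 1" using 3(2,4) by blast+
    have "is_state ks \<Psi>" "rate_exists ks \<Psi> \<Phi>"
      using \<Theta> assms(4) 3(1) by (simp_all add: ergodic_def stationary_def HP_def)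
    moreover have "local_proj ks n (p' n)" for n using 3(4) by blast
    ultimately have "- rate ks \<Psi> \<Phi> \<le> liminf (\<lambda>n. elog (Re (\<Phi> (ivl n) (p' n))) / ereal (real n))"
      using assms(3) lim by (intro liminf_lower)
    then show "- liminf (\<lambda>n. elog (Re (\<Phi> (ivl n) (p' n))) / ereal (real n)) \<le> rate ks \<Psi> \<Phi>"
      by (simp only: ereal_uminus_le_reorder)
  qed
  then show ?case by (simp only: ereal_uminus_le_reorder)
next
  case (4 \<Psi>)
  have rs: "rate_set ks {\<Psi>} \<Phi> = rate ks \<Psi> \<Phi>" by (simp add: rate_set_def)
  have sub: "{\<Psi>} \<subseteq> \<Theta>" using 4(2) by simp
  have "beta_bar ks \<epsilon> \<Psi> \<Phi> \<le> - rate ks \<Psi> \<Phi>" if \<epsilon>: "0 < \<epsilon>" for \<epsilon>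
  proof -
    have b: "(rate ks \<Psi> \<Phi> < \<infinity> \<longrightarrow> beta_bar ks \<epsilon> \<Psi> \<Phi> \<le> - rate ks \<Psi> \<Phi> + ereal \<eta>) \<and>
        (\<not> rate ks \<Psi> \<Phi> < \<infinity> \<longrightarrow> beta_bar ks \<epsilon> \<Psi> \<Phi> \<le> - ereal (1 / \<eta>))" if \<eta>: "0 < \<eta>" for \<eta> :: real
    proof -
      obtain p where p: "\<And>n. local_proj ks n (p n)" "(\<lambda>n. Re (\<Psi> (ivl n) (p n))) \<longlonglongrightarrow> 1"
        and l: "if rate ks \<Psi> \<Phi> < \<infinity>
            then limsup (\<lambda>n. elog (Re (\<Phi> (ivl n) (p n))) / ereal (real n)) \<le> - rate ks \<Psi> \<Phi> + ereal \<eta>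
            else limsup (\<lambda>n. elog (Re (\<Phi> (ivl n) (p n))) / ereal (real n)) \<le> - ereal (1 / \<eta>)"
        using 4(1)[THEN conjunct2, THEN spec[of _ "{\<Psi>}"], THEN mp, OF sub, THEN spec[of _ \<eta>], THEN mp, OF \<eta>,
            THEN conjunct1] unfolding rs by blast
      show ?thesis using order_trans[OF beta_bar_le[OF p \<epsilon>, of \<Phi>]] l by (simp split: if_splits)
    qed
    show ?thesis
    proof (cases "rate ks \<Psi> \<Phi> < \<infinity>")
      case True
      show ?thesis by (rule ereal_le_epsilon2) (use b True in blast)
    next
      case False
      \<comment> \<open>An infinite rate demands the value -\<infinity>; \<eta> = 1 / (\<bar>c\<bar>
        + 1) pushes the bound below any real c.\<close>
      have "beta_bar ks \<epsilon> \<Psi> \<Phi> \<le> ereal c" for c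
      proof -
        have "beta_bar ks \<epsilon> \<Psi> \<Phi> \<le> - ereal (1 / (1 / (\<bar>c\<bar> + 1)))"
          using b[of "1 / (\<bar>c\<bar> + 1)"] False by simp
        also have "\<dots> \<le> ereal c" by simp
        finally show ?thesis .
      qed
      then have "beta_bar ks \<epsilon> \<Psi> \<Phi> = - \<infinity>" by (rule ereal_bot)
      then show ?thesis by simp
    qed
  qed
  then show ?case using 4 by (simp add: HP_def)
qed

end
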